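(* Let $\mathcal{H}$ be a homogeneous graph and $\mathcal{D}$ a perfect transitive DAG version of $\mathcal{H}$. Then the family of Type II Wishart distributions for $\mathcal{H}$ is a subfamily of the family of DAG Wishart distributions for $\mathcal{D}$; that is, for every $(\alpha,\beta)\in\mathcal{B}$ and every $U^E\in\mathrm{Q}_{\mathcal{H}}$, the probability distribution $\mathcal{W}_{\mathrm{P}_{\mathcal{H}}}(\alpha,\beta,U^E)$ on $\mathrm{P}_{\mathcal{H}}=\mathrm{P}_{\mathcal{D}}$ equals $\pi_{\mathrm{P}_{\mathcal{D}}}(\gamma,U)$ for some $\gamma\in\mathbb{R}^p$ and some positive definite $U$.
   Context: A homogeneous graph is a decomposable (chordal) undirected graph $\mathcal{H}=(V,E)$, $V=\{1,\ldots,p\}$, such that for any two adjacent $i,j$, $\mathrm{ne}(j)\cup\{j\}\subseteq\mathrm{ne}(i)\cup\{i\}$ or $\mathrm{ne}(i)\cup\{i\}\subseteq\mathrm{ne}(j)\cup\{j\}$, where $\mathrm{ne}$ denotes the set of neighbors. All loops are regarded as belonging to $E$. "Clique" means maximal complete vertex set. Let $(C_1,\ldots,C_r)$ be a perfect order of the cliques: an enumeration of all cliques such that, with $H_j=C_1\cup\cdots\cup C_j$, each separator $S_j=H_{j-1}\cap C_j$ ($2\le j\le r$) is contained in some $C_i$, $i<j$. Put $c_j=|C_j|$, $s_j=|S_j|$. A DAG version of $\mathcal{H}$ is an acyclic directed graph $\mathcal{D}$ whose underlying undirected graph is $\mathcal{H}$. $\mathrm{pa}(j)=\{i\ne j:i\to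 j\}$, $pa_j=|\mathrm{pa}(j)|$. $\mathcal{D}$ is perfect if the parents of each vertex are pairwise adjacent, and transitive if $i\to j$ and $j\to k$ imply $i\to k$. Cones. $\mathrm{P}_{\mathcal{H}}$ is the set of positive definite $p\times p$ matrices $\Omega$ with $\Omega_{ij}=0$ whenever $\{i,j\}\notin E$; $\mathrm{PD}_{\mathcal{H}}=\{\Omega^{-1}:\Omega\in\mathrm{P}_{\mathcal{H}}\}$. $\mathrm{Q}_{\mathcal{H}}$ is the set of symmetric incomplete matrices $(\Gamma_{ij})_{\{i,j\}\in E}$ with $\Gamma_C$ positive definite for each clique $C$. Each $\Sigma^E\in\mathrm{Q}_{\mathcal{H}}$ has a unique completion $\Sigma\in\mathrm{PD}_{\mathcal{H}}$ agreeing with it on $E$; for $\Omega\in\mathrm{P}_{\mathcal{H}}$, $\Omega^{-E}:=(\Omega^{-1})^E$. For perfect $\mathcal{D}$, $\mathrm{P}_{\mathcal{D}}=\mathrm{P}_{\mathcal{H}}$ (where $\mathrm{P}_{\mathcal{D}}$ is the set of inverse covariance matrices of centered nonsingular Gaussian laws satisfying the directed local Markov property for $\mathcal{D}$). Type II Wishart. For $\alpha\in\mathbb{R}^r$, $\beta=(\beta_2,\ldots,\beta_r)\in\mathbb{R}^{r-1}$ let $H_{\mathcal{H}}(\alpha,\beta,\Sigma^E)=\prod_{i=1}^r\det(\Sigma_{C_i})^{\alpha_i}/\prod_{i=2}^r\det(\Sigma_{S_i})^{\beta_i}$, and $\nu_{\mathcal{H}}(d\Omega)=H_{\mathcal{H}}(\tfrac{c+1}{2},\tfrac{s+1}{2},\Omega^{-E})\,d\Omega$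 with $c=(c_1,\ldots,c_r)$, $s=(s_2,\ldots,s_r)$, and $d\Omega$ Lebesgue measure on $\mathrm{P}_{\mathcal{H}}$. For $U^E\in\mathrm{Q}_{\mathcal{H}}$ with completion $U$, $$\omega_{\mathrm{P}_{\mathcal{H}}}(\alpha,\beta,U^E,d\Omega)=e^{-\mathrm{tr}(\Omega U)}H_{\mathcal{H}}(\alpha,\beta,\Omega^{-E})\nu_{\mathcal{H}}(d\Omega).$$ $\mathcal{B}$ is the set of $(\alpha,\beta)$ such that $\int\omega_{\mathrm{P}_{\mathcal{H}}}(\alpha,\beta,U^E,d\Omega)<\infty$ for every $U^E\in\mathrm{Q}_{\mathcal{H}}$ and this integral divided by $H_{\mathcal{H}}(\alpha,\beta,U^E)$ does not depend on $U^E$. For $(\alpha,\beta)\in\mathcal{B}$, $\mathcal{W}_{\mathrm{P}_{\mathcal{H}}}(\alpha,\beta,U^E)$ is the normalization of $\omega_{\mathrm{P}_{\mathcal{H}}}(\alpha,\beta,U^E,\cdot)$ to a probability measure. DAG Wishart. For $\gamma\in\mathbb{R}^p$ with $\gamma_j<pa_j/2+1$ for all $j$ and $U$ positive definite, $$\pi_{\mathrm{P}_{\mathcal{D}}}(\gamma,U,d\Omega)=z_{\mathcal{D}}(U,\gamma)^{-1}e^{-\mathrm{tr}(\Omega U)}\prod_{j=1}^pD_{jj}^{\gamma_j}\,d\Omega$$ on $\mathrm{P}_{\mathcal{D}}$, where $\Sigma=\Omega^{-1}$, $D_{jj}=\Sigma_{jj}-\Sigma_{j,\mathrm{pa}(j)}(\Sigma_{\mathrm{pa}(j)})^{-1}\Sigma_{\mathrm{pa}(j),j}$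 and $z_{\mathcal{D}}(U,\gamma)$ is the normalizing constant (finite exactly when $\gamma_j<pa_j/2+1$ for all $j$). *)

theory Defs
  imports "HOL-Probability.Probability"
begin

text \<open>
  The vertex set is the finite type \<open>'n\<close>, so \<open>p = CARD('n)\<close>.
  The edge set \<open>E\<close> of an undirected graph consists of the unordered pairs \<open>{i, j}\<close>,
  all loops \<open>{i} = {i, i}\<close> included.
\<close>

section \<open>Undirected graphs\<close>

definition ugraph :: "'n::finite set set \<Rightarrow> bool" where
  "ugraph E \<longleftrightarrow> (\<forall>e\<in>E. \<exists>i j. e = {i, j}) \<and> (\<forall>i. {i, i} \<in> E)"

definition ne :: "'n::finite set set \<Rightarrow> 'n \<Rightarrow> 'n set" where
  "ne E i = {j. j \<noteq> i \<and> {i, j} \<in> E}"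

definition chordal :: "'n::finite set set \<Rightarrow> bool" where
  "chordal E \<longleftrightarrow>
    (\<forall>c. distinct c \<and> 4 \<le> length c \<and>
         (\<forall>i<length c. {c ! i, c ! ((i + 1) mod length c)} \<in> E) \<longrightarrow>
         (\<exists>i<length c. \<exists>j<length c. i \<noteq> j \<and>
            j \<noteq> (i + 1) mod length c \<and> i \<noteq> (j + 1) mod length c \<and> {c ! i, c ! j} \<in> E))"

definition homogeneous_graph :: "'n::finite set set \<Rightarrow> bool" where
  "homogeneous_graph E \<longleftrightarrow> ugraph E \<and> chordal E \<and>
    (\<forall>i. \<forall>j\<in>ne E i. ne E j \<union> {j} \<subseteq> ne E i \<union> {i} \<or> ne E i \<union> {i} \<subseteq> ne E j \<union> {j})"

definition complete_set :: "'n::finite set set \<Rightarrow> 'n set \<Rightarrow> bool" where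
  "complete_set E C \<longleftrightarrow> (\<forall>i\<in>C. \<forall>j\<in>C. {i, j} \<in> E)"

definition clique :: "'n::finite set set \<Rightarrow> 'n set \<Rightarrow> bool" where
  "clique E C \<longleftrightarrow> complete_set E C \<and> (\<forall>B. complete_set E B \<and> C \<subseteq> B \<longrightarrow> B = C)"

text \<open>
  The cliques are enumerated as a list \<open>Cs\<close> with indices \<open>0, \<dots>, r - 1\<close>, so
  \<open>Cs ! i\<close> is the clique usually written $C_{i+1}$, and separators have indices
  \<open>1, \<dots>, r - 1\<close>.
\<close>

definition separator :: "'n set list \<Rightarrow> nat \<Rightarrow> 'n set" where
  "separator Cs j = (\<Union>i<j. Cs ! i) \<inter> Cs ! j"

definition perfect_order :: "'n::finite set set \<Rightarrow> 'n set list \<Rightarrow> bool" where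
  "perfect_order E Cs \<longleftrightarrow> distinct Cs \<and> set Cs = {C. clique E C} \<and>
    (\<forall>j\<in>{1..<length Cs}. \<exists>i<j. separator Cs j \<subseteq> Cs ! i)"

section \<open>Directed acyclic graphs\<close>

text \<open>A directed graph is the set \<open>D\<close> of its arrows: \<open>(i, j) \<in> D\<close> means \<open>i \<rightarrow> j\<close>.\<close>

definition skeleton :: "('n::finite \<times> 'n) set \<Rightarrow> 'n set set" where
  "skeleton D = {{i, j} | i j. i = j \<or> (i, j) \<in> D \<or> (j, i) \<in> D}"

definition dag_version :: "('n::finite \<times> 'n) set \<Rightarrow> 'n set set \<Rightarrow> bool" where
  "dag_version D E \<longleftrightarrow> acyclic D \<and> skeleton D = E"

definition pa :: "('n::finite \<times> 'n) set \<Rightarrow> 'n \<Rightarrow> 'n set" where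
  "pa D j = {i. i \<noteq> j \<and> (i, j) \<in> D}"

definition nd :: "('n::finite \<times> 'n) set \<Rightarrow> 'n \<Rightarrow> 'n set" where
  "nd D j = {i. i \<noteq> j \<and> (j, i) \<notin> D\<^sup>+}"

definition perfect_dag :: "('n::finite \<times> 'n) set \<Rightarrow> bool" where
  "perfect_dag D \<longleftrightarrow> (\<forall>j. complete_set (skeleton D) (pa D j))"

section \<open>Matrices\<close>

definition posdef :: "real^'n^'n \<Rightarrow> bool" where
  "posdef A \<longleftrightarrow> transpose A = A \<and> (\<forall>x. x \<noteq> 0 \<longrightarrow> 0 < x \<bullet> (A *v x))"

text \<open>
  The principal submatrix $A_C$ is represented by the block matrix
  $\mathrm{diag}(A_C, I)$ of full size, so that the library's determinant and inverse apply:
  its determinant is $\det A_C$ (1 for empty \<open>C\<close>), its inverse is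
  $\mathrm{diag}(A_C^{-1}, I)$, and it is positive definite iff $A_C$ is.
  See the lemmas below.
\<close>

definition principal :: "'n set \<Rightarrow> real^'n^'n \<Rightarrow> real^'n^'n" where
  "principal C A =
    (\<chi> i j. if i \<in> C \<and> j \<in> C then A $ i $ j else if i = j then 1 else 0)"

lemma det_principal:
  fixes A :: "real^'n^'n"
  shows "det (principal C A) =
    (\<Sum>\<pi> | \<pi> permutes C. of_int (sign \<pi>) * (\<Prod>i\<in>C. A $ i $ \<pi> i))"
proof -
  let ?B = "principal C A"
  have zero: "(\<Prod>i\<in>UNIV. ?B $ i $ \<pi> i) = 0" if "\<not> \<pi> permutes C" "\<pi> permutes UNIV" for \<pi>
  proof -
    from that obtain i where "i \<notin> C" "\<pi> i \<noteq> i"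
      unfolding permutes_def by auto
    hence "?B $ i $ \<pi> i = 0" by (auto simp: principal_def)
    thus ?thesis by (meson UNIV_I finite prod_zero)
  qed
  have eq: "(\<Prod>i\<in>UNIV. ?B $ i $ \<pi> i) = (\<Prod>i\<in>C. A $ i $ \<pi> i)" if "\<pi> permutes C" for \<pi>
  proof -
    have "(\<Prod>i\<in>UNIV. ?B $ i $ \<pi> i) = (\<Prod>i\<in>C. ?B $ i $ \<pi> i)"
      by (rule prod.mono_neutral_right)
        (use that in \<open>auto simp: principal_def permutes_not_in\<close>)
    also have "\<dots> = (\<Prod>i\<in>C. A $ i $ \<pi> i)"
      by (rule prod.cong) (use that in \<open>auto simp: principal_def permutes_in_image\<close>)
    finally show ?thesis .
  qed
  have "det ?B = (\<Sum>\<pi> | \<pi> permutes UNIV. of_int (sign \<pi>) * (\<Prod>i\<in>UNIV. ?B $ i $ \<pi> i))"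
    by (simp add: det_def)
  also have "\<dots> = (\<Sum>\<pi> | \<pi> permutes C. of_int (sign \<pi>) * (\<Prod>i\<in>UNIV. ?B $ i $ \<pi> i))"
    by (rule sum.mono_neutral_right)
      (use zero in \<open>auto intro: permutes_subset\<close>)
  also have "\<dots> = (\<Sum>\<pi> | \<pi> permutes C. of_int (sign \<pi>) * (\<Prod>i\<in>C. A $ i $ \<pi> i))"
    by (rule sum.cong) (auto simp: eq)
  finally show ?thesis .
qed

lemma posdef_principal:
  fixes A :: "real^'n^'n"
  shows "posdef (principal C A) \<longleftrightarrow>
    (\<forall>i\<in>C. \<forall>j\<in>C. A $ i $ j = A $ j $ i) \<and>
    (\<forall>x :: 'n \<Rightarrow> real. (\<exists>i\<in>C. x i \<noteq> 0) \<longrightarrow> 0 < (\<Sum>i\<in>C. \<Sum>j\<in>C. x i * A $ i $ j * x j))"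
proof -
  let ?B = "principal C A"
  have sym: "transpose ?B = ?B \<longleftrightarrow> (\<forall>i\<in>C. \<forall>j\<in>C. A $ i $ j = A $ j $ i)"
    by (auto simp: vec_eq_iff transpose_def principal_def)
  have row: "(\<Sum>j\<in>UNIV. ?B $ i $ j * x $ j) =
      (if i \<in> C then \<Sum>j\<in>C. A $ i $ j * x $ j else x $ i)" for x and i
  proof (cases "i \<in> C")
    case True
    have "(\<Sum>j\<in>UNIV. ?B $ i $ j * x $ j) = (\<Sum>j\<in>C. ?B $ i $ j * x $ j)"
      by (rule sum.mono_neutral_right) (use True in \<open>auto simp: principal_def\<close>)
    also have "\<dots> = (\<Sum>j\<in>C. A $ i $ j * x $ j)"
      by (rule sum.cong) (use True in \<open>auto simp: principal_def\<close>)
    finally show ?thesis using True by simp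
  next
    case False
    have "(\<Sum>j\<in>UNIV. ?B $ i $ j * x $ j) = (\<Sum>j\<in>UNIV. if i = j then x $ j else 0)"
      by (rule sum.cong) (use False in \<open>auto simp: principal_def\<close>)
    thus ?thesis using False by simp
  qed
  have quad: "x \<bullet> (?B *v x) =
      (\<Sum>i\<in>C. \<Sum>j\<in>C. x $ i * A $ i $ j * x $ j) + (\<Sum>i\<in>-C. (x $ i)\<^sup>2)" for x
  proof -
    have "x \<bullet> (?B *v x) = (\<Sum>i\<in>UNIV. x $ i * (\<Sum>j\<in>UNIV. ?B $ i $ j * x $ j))"
      by (simp add: inner_vec_def matrix_vector_mult_def)
    also have "\<dots> = (\<Sum>i\<in>C \<union> - C. x $ i * (if i \<in> C then \<Sum>j\<in>C. A $ i $ j * x $ j else x $ i))"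
      by (simp add: row)
    also have "\<dots> = (\<Sum>i\<in>C. x $ i * (\<Sum>j\<in>C. A $ i $ j * x $ j)) + (\<Sum>i\<in>-C. x $ i * x $ i)"
      by (subst sum.union_disjoint) auto
    finally show ?thesis by (simp add: sum_distrib_left power2_eq_square mult.assoc)
  qed
  have "(\<forall>x. x \<noteq> 0 \<longrightarrow> 0 < x \<bullet> (?B *v x)) \<longleftrightarrow>
    (\<forall>x :: 'n \<Rightarrow> real. (\<exists>i\<in>C. x i \<noteq> 0) \<longrightarrow> 0 < (\<Sum>i\<in>C. \<Sum>j\<in>C. x i * A $ i $ j * x j))" (is "?L \<longleftrightarrow> ?R")
  proof
    assume L: ?L
    show ?R
    proof (intro allI impI)
      fix x :: "'n \<Rightarrow> real" assume x: "\<exists>i\<in>C. x i \<noteq> 0"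
      define y :: "real^'n" where "y = (\<chi> i. if i \<in> C then x i else 0)"
      have "y \<noteq> 0" using x by (auto simp: y_def vec_eq_iff)
      hence "0 < y \<bullet> (?B *v y)" using L by blast
      thus "0 < (\<Sum>i\<in>C. \<Sum>j\<in>C. x i * A $ i $ j * x j)"
        by (simp add: quad) (simp add: y_def)
    qed
  next
    assume R: ?R
    show ?L
    proof (intro allI impI)
      fix x :: "real^'n" assume x: "x \<noteq> 0"
      show "0 < x \<bullet> (?B *v x)"
      proof (cases "\<exists>i\<in>C. x $ i \<noteq> 0")
        case True
        hence "0 < (\<Sum>i\<in>C. \<Sum>j\<in>C. x $ i * A $ i $ j * x $ j)" using R by blast
        thus ?thesis by (simp add: quad add_pos_nonneg sum_nonneg)
      next
        case False
        with x obtain k where "k \<in> -C" "x $ k \<noteq> 0" by (auto simp: vec_eq_iff)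
        hence "0 < (\<Sum>i\<in>-C. (x $ i)\<^sup>2)" by (intro sum_pos2[of _ k]) auto
        moreover have "(\<Sum>i\<in>C. \<Sum>j\<in>C. x $ i * A $ i $ j * x $ j) = 0" using False by simp
        ultimately show ?thesis by (simp add: quad)
      qed
    qed
  qed
  thus ?thesis by (simp add: posdef_def sym)
qed

lemma principal_inverse:
  fixes A :: "real^'n^'n"
  assumes "det (principal C A) \<noteq> 0" "i \<in> C" "k \<in> C"
  shows "(\<Sum>j\<in>C. A $ i $ j * matrix_inv (principal C A) $ j $ k) = (if i = k then 1 else 0)"
proof -
  let ?B = "principal C A"
  have "invertible ?B" using assms by (simp add: invertible_det_nz)
  hence "?B ** matrix_inv ?B = mat 1"
    unfolding invertible_def matrix_inv_def by (metis (mono_tags, lifting) someI_ex)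
  hence "(?B ** matrix_inv ?B) $ i $ k = mat 1 $ i $ k" by simp
  hence "(\<Sum>j\<in>UNIV. ?B $ i $ j * matrix_inv ?B $ j $ k) = (if i = k then 1 else 0)"
    by (simp add: matrix_matrix_mult_def mat_def)
  moreover have "(\<Sum>j\<in>UNIV. ?B $ i $ j * matrix_inv ?B $ j $ k) =
      (\<Sum>j\<in>C. ?B $ i $ j * matrix_inv ?B $ j $ k)"
    by (rule sum.mono_neutral_right) (use assms in \<open>auto simp: principal_def\<close>)
  moreover have "\<dots> = (\<Sum>j\<in>C. A $ i $ j * matrix_inv ?B $ j $ k)"
    by (rule sum.cong) (use assms in \<open>auto simp: principal_def\<close>)
  ultimately show ?thesis by simp
qed

section \<open>Cones\<close>

definition P_cone :: "'n::finite set set \<Rightarrow> (real^'n^'n) set" where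
  "P_cone E = {\<Omega>. posdef \<Omega> \<and> (\<forall>i j. {i, j} \<notin> E \<longrightarrow> \<Omega> $ i $ j = 0)}"

definition PD_cone :: "'n::finite set set \<Rightarrow> (real^'n^'n) set" where
  "PD_cone E = matrix_inv ` P_cone E"

text \<open>
  An incomplete matrix $(\Gamma_{ij})_{\{i,j\}\in E}$ is encoded as the matrix whose entries
  outside \<open>E\<close> are set to 0; \<open>restrict_to E A\<close> encodes $A^E$.
\<close>

definition restrict_to :: "'n::finite set set \<Rightarrow> real^'n^'n \<Rightarrow> real^'n^'n" where
  "restrict_to E A = (\<chi> i j. if {i, j} \<in> E then A $ i $ j else 0)"

definition Q_cone :: "'n::finite set set \<Rightarrow> (real^'n^'n) set" where
  "Q_cone E = {\<Gamma>. transpose \<Gamma> = \<Gamma> \<and> restrict_to E \<Gamma> = \<Gamma> \<and>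
    (\<forall>C. clique E C \<longrightarrow> posdef (principal C \<Gamma>))}"

definition completion :: "'n::finite set set \<Rightarrow> real^'n^'n \<Rightarrow> real^'n^'n" where
  "completion E \<Gamma> = (THE \<Sigma>. \<Sigma> \<in> PD_cone E \<and> restrict_to E \<Sigma> = \<Gamma>)"

text \<open>
  Lebesgue measure $d\Omega$ on the space of symmetric matrices vanishing outside \<open>E\<close>:
  the image of the product Lebesgue measure in the free coordinates
  $(\Omega_{ij})_{\{i,j\}\in E}$, one coordinate for each unordered pair.
\<close>

definition lebesgue_sym :: "'n::finite set set \<Rightarrow> (real^'n^'n) measure" where
  "lebesgue_sym E = distr (\<Pi>\<^sub>M e\<in>E. lborel) borel
    (\<lambda>\<omega>. \<chi> i j. if {i, j} \<in> E then \<omega> {i, j} else 0)"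

section \<open>Type II Wishart distributions\<close>

text \<open>
  \<open>\<alpha>\<close> is only used at \<open>0, \<dots>, r - 1\<close> and \<open>\<beta>\<close> only at \<open>1, \<dots>, r - 1\<close>,
  in accordance with the indexing of cliques and separators above.
\<close>

definition H_fun ::
  "'n::finite set list \<Rightarrow> (nat \<Rightarrow> real) \<Rightarrow> (nat \<Rightarrow> real) \<Rightarrow> real^'n^'n \<Rightarrow> real" where
  "H_fun Cs \<alpha> \<beta> \<Sigma> =
    (\<Prod>i<length Cs. det (principal (Cs ! i) \<Sigma>) powr \<alpha> i) /
    (\<Prod>i\<in>{1..<length Cs}. det (principal (separator Cs i) \<Sigma>) powr \<beta> i)"

definition nu :: "'n::finite set set \<Rightarrow> 'n set list \<Rightarrow> (real^'n^'n) measure" where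
  "nu E Cs = density (restrict_space (lebesgue_sym E) (P_cone E))
    (\<lambda>\<Omega>. ennreal (H_fun Cs (\<lambda>i. (real (card (Cs ! i)) + 1) / 2)
      (\<lambda>i. (real (card (separator Cs i)) + 1) / 2) (restrict_to E (matrix_inv \<Omega>))))"

definition omega_measure :: "'n::finite set set \<Rightarrow> 'n set list \<Rightarrow>
    (nat \<Rightarrow> real) \<Rightarrow> (nat \<Rightarrow> real) \<Rightarrow> real^'n^'n \<Rightarrow> (real^'n^'n) measure" where
  "omega_measure E Cs \<alpha> \<beta> UE = density (nu E Cs)
    (\<lambda>\<Omega>. ennreal (exp (- trace (\<Omega> ** completion E UE)) *
      H_fun Cs \<alpha> \<beta> (restrict_to E (matrix_inv \<Omega>))))"

definition B_set ::
  "'n::finite set set \<Rightarrow> 'n set list \<Rightarrow> ((nat \<Rightarrow> real) \<times> (nat \<Rightarrow> real)) set" where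
  "B_set E Cs = {(\<alpha>, \<beta>).
    (\<forall>UE\<in>Q_cone E. emeasure (omega_measure E Cs \<alpha> \<beta> UE) (P_cone E) < \<infinity>) \<and>
    (\<exists>k. \<forall>UE\<in>Q_cone E.
      measure (omega_measure E Cs \<alpha> \<beta> UE) (P_cone E) / H_fun Cs \<alpha> \<beta> UE = k)}"

definition normalized :: "'a measure \<Rightarrow> 'a measure" where
  "normalized M = scale_measure (1 / emeasure M (space M)) M"

definition type2_wishart :: "'n::finite set set \<Rightarrow> 'n set list \<Rightarrow>
    (nat \<Rightarrow> real) \<Rightarrow> (nat \<Rightarrow> real) \<Rightarrow> real^'n^'n \<Rightarrow> (real^'n^'n) measure" where
  "type2_wishart E Cs \<alpha> \<beta> UE = normalized (omega_measure E Cs \<alpha> \<beta> UE)"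

section \<open>Gaussian DAG models and DAG Wishart distributions\<close>

text \<open>The law $N(0, \Omega^{-1})$.\<close>

definition gaussian :: "real^'n^'n \<Rightarrow> (real^'n) measure" where
  "gaussian \<Omega> = density lborel
    (\<lambda>x. ennreal (sqrt (det \<Omega> / (2 * pi) ^ CARD('n)) * exp (- (x \<bullet> (\<Omega> *v x)) / 2)))"

text \<open>The sub-sigma-algebra generated by the coordinates $(x_i)_{i\in A}$.\<close>

definition coord_algebra :: "'n set \<Rightarrow> (real^'n) measure" where
  "coord_algebra A = vimage_algebra UNIV (\<lambda>x. \<lambda>i\<in>A. x $ i) (\<Pi>\<^sub>M i\<in>A. borel)"

text \<open>Conditional independence of $x_A$ and $x_B$ given $x_C$ when $x$ has law \<open>M\<close>.\<close>

definition cond_indep :: "(real^'n) measure \<Rightarrow> 'n set \<Rightarrow> 'n set \<Rightarrow> 'n set \<Rightarrow> bool" where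
  "cond_indep M A B C \<longleftrightarrow>
    (\<forall>S\<in>sets (coord_algebra A). \<forall>T\<in>sets (coord_algebra B). AE x in M.
      real_cond_exp M (coord_algebra C) (indicator (S \<inter> T)) x =
      real_cond_exp M (coord_algebra C) (indicator S) x *
      real_cond_exp M (coord_algebra C) (indicator T) x)"

definition local_markov :: "('n::finite \<times> 'n) set \<Rightarrow> (real^'n) measure \<Rightarrow> bool" where
  "local_markov D M \<longleftrightarrow> (\<forall>j. cond_indep M {j} (nd D j) (pa D j))"

definition P_dag :: "('n::finite \<times> 'n) set \<Rightarrow> (real^'n^'n) set" where
  "P_dag D = {\<Omega>. posdef \<Omega> \<and> local_markov D (gaussian \<Omega>)}"

definition cond_var :: "('n::finite \<times> 'n) set \<Rightarrow> real^'n^'n \<Rightarrow> 'n \<Rightarrow> real" where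
  "cond_var D \<Sigma> j = \<Sigma> $ j $ j -
    (\<Sum>i\<in>pa D j. \<Sum>k\<in>pa D j.
      \<Sigma> $ j $ i * matrix_inv (principal (pa D j) \<Sigma>) $ i $ k * \<Sigma> $ k $ j)"

text \<open>
  For perfect \<open>D\<close> the reference measure $d\Omega$ on $\mathrm{P}_D$ is Lebesgue measure in the
  coordinates indexed by the edges of the underlying undirected graph.
\<close>

definition dag_wishart ::
  "('n::finite \<times> 'n) set \<Rightarrow> real^'n \<Rightarrow> real^'n^'n \<Rightarrow> (real^'n^'n) measure" where
  "dag_wishart D \<gamma> U = normalized
    (density (restrict_space (lebesgue_sym (skeleton D)) (P_dag D))
      (\<lambda>\<Omega>. ennreal (exp (- trace (\<Omega> ** U)) * (\<Prod>j\<in>UNIV. cond_var D (matrix_inv \<Omega>) j powr \<gamma> $ j))))"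

end

theory Submission
  imports Defs
begin

text \<open>
  In a perfect transitive DAG \<open>D\<close>, the cliques of the underlying graph and the separators of a perfect
  order are closed under taking parents (\<open>clique_ancestral\<close>). For the inverse \<open>\<Sigma>\<close> of a matrix in the
  cone and such a set \<open>A\<close>, eliminating the vertices of \<open>A\<close> one by one, children before parents, shows that
  $\det \Sigma_A$ is the product of the conditional variances $D_{jj}$ over $j \in A$
  (\<open>det_ancestral\<close>). Hence both factors \<open>H\<close> of the Type II density, the one in the reference measure
  included, are products of powers of the $D_{jj}$ (\<open>H_fun_cond_var\<close>), and the unnormalized Type II
  measure with scale \<open>UE\<close> is $e^{-\mathrm{tr}(\Omega U)} \prod_j D_{jj}^{\gamma_j} d\Omega$ with \<open>U\<close> the
  completion of \<open>UE\<close> and $\gamma_j$ a signed sum of the exponents of the cliques and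
  separators that contain \<open>j\<close> (\<open>omega_measure_eq\<close>). This is the unnormalized DAG Wishart measure; three
  points remain.

  The supports agree (\<open>P_dag_eq_P_cone\<close>). Everything is organized around vectors \<open>w\<close> such that
  \<open>\<Omega> *v w\<close> is the residual of coordinate \<open>j\<close> after regression on other coordinates. A Gaussian
  density splits into a normal density of this linear form and a factor that is constant along \<open>w\<close>
  (\<open>gaussian_regression\<close>). So conditional independence of \<open>j\<close> and its non-descendants
  given its parents means precisely that the regression on the non-descendants involves the parents
  only, and these sparse residuals for all \<open>j\<close> amount to a triangular factorization of \<open>\<Omega>\<close>
  with the zero pattern of the graph (\<open>residual_expansion\<close>).

  \<open>U\<close> is positive definite because the completion exists and is unique. The entries prescribed by \<open>UE\<close> determine
  the regression of every vertex on its parents, hence the triangular factorization of the inverse of the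
  completion (\<open>completion_exists\<close>, \<open>P_cone_unique_inverse\<close>).

  The bound $\gamma_j < pa_j / 2 + 1$ comes from finiteness of the integral
  (\<open>finite_imp_exponent_bound\<close>). There is a map of the cone that multiplies $D_{jj}$ by $\tau^{-2}$ and
  fixes all other conditional variances; in the free coordinates it is affine with Jacobian
  $\tau^{pa_j + 2}$. If the bound failed, then for $\tau = 1, 1/2, 1/4, \dots$ the images of one
  slab of the cone would be disjoint and contribute at least a common positive amount each.
\<close>

section \<open>Linear algebra of positive definite matrices\<close>

lemma inner_vec_sum: "(x :: real^'n) \<bullet> y = (\<Sum>i\<in>UNIV. x $ i * y $ i)"
  by (simp add: inner_vec_def)

lemma matrix_vector_component_supported:
  fixes A :: "real^'n^'n"
  assumes "\<And>k. k \<notin> C \<Longrightarrow> x $ k = 0"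
  shows "(A *v x) $ i = (\<Sum>k\<in>C. A $ i $ k * x $ k)"
proof -
  have "(A *v x) $ i = (\<Sum>k\<in>UNIV. A $ i $ k * x $ k)"
    by (simp add: matrix_vector_mult_def)
  also have "\<dots> = (\<Sum>k\<in>C. A $ i $ k * x $ k)"
    by (rule sum.mono_neutral_right) (use assms in auto)
  finally show ?thesis .
qed

lemma principal_mult_vector:
  fixes A :: "real^'n^'n"
  shows "(principal C A *v x) $ i = (if i \<in> C then \<Sum>k\<in>C. A $ i $ k * x $ k else x $ i)"
proof (cases "i \<in> C")
  case True
  have "(\<Sum>k\<in>UNIV. principal C A $ i $ k * x $ k) = (\<Sum>k\<in>C. A $ i $ k * x $ k)"
    by (rule sum.mono_neutral_cong_right) (use True in \<open>auto simp: principal_def\<close>)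
  then show ?thesis using True by (simp add: matrix_vector_mult_def)
next
  case False
  have "(\<Sum>k\<in>UNIV. principal C A $ i $ k * x $ k) = (\<Sum>k\<in>UNIV. if k = i then x $ k else 0)"
    by (rule sum.cong) (use False in \<open>auto simp: principal_def\<close>)
  then show ?thesis using False by (simp add: matrix_vector_mult_def)
qed

lemma posdef_symmetric: "posdef A \<Longrightarrow> A $ i $ j = A $ j $ i"
  by (auto simp: posdef_def transpose_def vec_eq_iff)

lemma posdef_inner_commute:
  assumes "posdef A" shows "x \<bullet> (A *v y) = (A *v x) \<bullet> y"
  using assms by (metis dot_lmul_matrix posdef_def transpose_matrix_vector)

lemma posdef_pos: "posdef A \<Longrightarrow> x \<noteq> 0 \<Longrightarrow> 0 < x \<bullet> (A *v x)"
  by (simp add: posdef_def)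

lemma invertible_matrix_inv:
  fixes A :: "real^'n^'n"
  assumes "invertible A"
  shows "A ** matrix_inv A = mat 1" "matrix_inv A ** A = mat 1"
  using assms unfolding invertible_def matrix_inv_def
  by (metis (mono_tags, lifting) someI_ex)+

lemma posdef_invertible: "posdef A \<Longrightarrow> invertible A"
  by (metis inner_zero_right invertible_left_inverse less_irrefl matrix_left_invertible_ker
      posdef_pos)

lemma posdef_matrix_inv_mult:
  assumes "posdef A"
  shows "matrix_inv A *v (A *v x) = x" "A *v (matrix_inv A *v x) = x"
  using invertible_matrix_inv[OF posdef_invertible[OF assms]]
  by (simp_all add: matrix_vector_mul_assoc)

lemma posdef_matrix_inv:
  fixes A :: "real^'n^'n"
  assumes "posdef A" shows "posdef (matrix_inv A)"
proof -
  have i: "A ** matrix_inv A = mat 1" "matrix_inv A ** A = mat 1"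
    using invertible_matrix_inv[OF posdef_invertible[OF assms]] by auto
  have "transpose A = A" using assms by (simp add: posdef_def)
  then have "transpose (matrix_inv A) ** A = mat 1"
    using i(1) by (metis matrix_transpose_mul transpose_mat)
  then have "transpose (matrix_inv A) = matrix_inv A"
    using i by (metis matrix_mul_assoc matrix_mul_lid matrix_mul_rid)
  moreover have "0 < x \<bullet> (matrix_inv A *v x)" if "x \<noteq> 0" for x
  proof -
    let ?y = "matrix_inv A *v x"
    have x: "x = A *v ?y" using posdef_matrix_inv_mult[OF assms] by simp
    then have "?y \<noteq> 0" using that by force
    then have "0 < ?y \<bullet> (A *v ?y)" by (rule posdef_pos[OF assms])
    then show ?thesis using x by (simp add: inner_commute)
  qed
  ultimately show ?thesis by (simp add: posdef_def)
qed

lemma posdef_principalI: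
  fixes A :: "real^'n^'n"
  assumes "posdef A" shows "posdef (principal C A)"
  unfolding posdef_principal
proof (intro conjI ballI allI impI)
  show "A $ i $ j = A $ j $ i" for i j using assms by (rule posdef_symmetric)
  fix x :: "'n \<Rightarrow> real" assume x: "\<exists>i\<in>C. x i \<noteq> 0"
  define y :: "real^'n" where "y = (\<chi> i. if i \<in> C then x i else 0)"
  have "y \<noteq> 0" using x by (auto simp: y_def vec_eq_iff)
  then have "0 < y \<bullet> (A *v y)" by (rule posdef_pos[OF assms])
  also have "y \<bullet> (A *v y) = (\<Sum>i\<in>UNIV. y $ i * (\<Sum>k\<in>C. A $ i $ k * y $ k))"
    using matrix_vector_component_supported[of C y A] by (simp add: inner_vec_sum y_def)
  also have "\<dots> = (\<Sum>i\<in>C. y $ i * (\<Sum>k\<in>C. A $ i $ k * y $ k))"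
    by (rule sum.mono_neutral_right) (auto simp: y_def)
  also have "\<dots> = (\<Sum>i\<in>C. \<Sum>j\<in>C. x i * A $ i $ j * x j)"
    by (simp add: y_def sum_distrib_left mult.assoc)
  finally show "0 < (\<Sum>i\<in>C. \<Sum>j\<in>C. x i * A $ i $ j * x j)" .
qed

lemma posdef_principal_mono:
  fixes A :: "real^'n^'n"
  assumes "posdef (principal C A)" "B \<subseteq> C" shows "posdef (principal B A)"
proof -
  have "principal B (principal C A) = principal B A"
    using assms(2) by (auto simp: principal_def vec_eq_iff)
  then show ?thesis using posdef_principalI[OF assms(1), of B] by simp
qed

lemma posdef_det_nonzero: "posdef (A :: real^'n^'n) \<Longrightarrow> det A \<noteq> 0"
  using posdef_invertible invertible_det_nz by blast

text \<open>
  Eliminating one vertex: replacing column \<open>j\<close> of $A_{B\cup\{j\}}$ by the combination of its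
  columns with coefficients \<open>l\<close> does not change the determinant and leaves a single nonzero
  entry in that column.
\<close>

lemma det_principal_insert:
  fixes A :: "real^'n^'n"
  assumes j: "j \<notin> B" and l: "l $ j = 1" "\<And>i. i \<notin> insert j B \<Longrightarrow> l $ i = 0"
    and z: "\<And>i. i \<in> B \<Longrightarrow> (A *v l) $ i = 0" and nz: "det (principal B A) \<noteq> 0"
  shows "det (principal (insert j B) A) = (A *v l) $ j * det (principal B A)"
proof -
  let ?M = "principal (insert j B) A" and ?Q = "transpose (principal B A)" and ?v = "(A *v l) $ j"
  define N :: "real^'n^'n" where "N = (\<chi> i b. if b = j then (?M *v l) $ i else ?M $ i $ b)"
  have Ml: "(?M *v l) $ i = (if i = j then ?v else 0)" for i
  proof -
    have "(\<Sum>k\<in>insert j B. A $ i $ k * l $ k) = (A *v l) $ i"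
      by (rule matrix_vector_component_supported[symmetric]) (use l in auto)
    then show ?thesis using z l by (simp only: principal_mult_vector) auto
  qed
  have "det N = det ?M"
    unfolding N_def by (subst cramer_lemma) (simp add: l)
  define y :: "real^'n" where "y = (\<chi> i. if i = j then ?v else ?M $ j $ i)"
  have nzQ: "det ?Q \<noteq> 0" using nz by (simp add: det_transpose)
  then obtain x where x: "?Q *v x = y"
    using cramer by blast
  have PM: "b \<noteq> j \<Longrightarrow> i \<noteq> j \<Longrightarrow> ?M $ b $ i = principal B A $ b $ i"
      "b \<noteq> j \<Longrightarrow> principal B A $ b $ j = 0" for b i
    using j by (auto simp: principal_def)
  have "transpose N = (\<chi> i b. if b = j then y $ i else ?Q $ i $ b)"
    unfolding N_def transpose_def y_def by (simp add: vec_eq_iff Ml PM)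
  then have "det N = x $ j * det ?Q"
    using cramer_lemma[of j ?Q x] unfolding x by (metis det_transpose)
  moreover have "x $ j = ?v"
  proof -
    have "(?Q *v x) $ j = (\<Sum>k\<in>UNIV. if k = j then x $ k else 0)"
      unfolding matrix_vector_mult_def
      by (simp only: vec_lambda_beta, rule sum.cong) (use j in \<open>auto simp: transpose_def principal_def\<close>)
    then show ?thesis using x by (simp add: y_def)
  qed
  ultimately show ?thesis using \<open>det N = det ?M\<close> by (simp add: det_transpose)
qed

text \<open>
  The solution of $A_{N \cup \{j\}} x = e_j$, normalized at \<open>j\<close>, is the residual of the
  \<open>j\<close>-th coordinate after regression on \<open>N\<close> under the covariance matrix \<open>A\<close>. Only the
  block of \<open>A\<close> on \<open>N \<union> {j}\<close> has to be positive definite, so this applies to incomplete matrices too.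
\<close>

lemma posdef_principal_regression:
  fixes A :: "real^'n^'n"
  assumes pd: "posdef (principal (insert j N) A)" and j: "j \<notin> N"
  obtains l where "l $ j = 1" "\<And>i. i \<notin> insert j N \<Longrightarrow> l $ i = 0"
    "\<And>i. i \<in> N \<Longrightarrow> (A *v l) $ i = 0" "0 < (A *v l) $ j"
proof -
  let ?P = "principal (insert j N) A"
  define x where "x = matrix_inv ?P *v axis j 1"
  have Px: "?P *v x = axis j 1"
    unfolding x_def by (rule posdef_matrix_inv_mult[OF pd])
  have x0: "x $ i = 0" if "i \<notin> insert j N" for i
    using Px that principal_mult_vector[of "insert j N" A x i] by (auto simp: axis_def)
  have Ax: "(A *v x) $ i = (if i = j then 1 else 0)" if "i \<in> insert j N" for i
  proof -
    have "(A *v x) $ i = (\<Sum>k\<in>insert j N. A $ i $ k * x $ k)"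
      by (rule matrix_vector_component_supported) (use x0 in auto)
    also have "\<dots> = (?P *v x) $ i" using that by (simp only: principal_mult_vector if_True)
    finally show ?thesis using Px by (auto simp: axis_def)
  qed
  have "x \<noteq> 0" using Px by (auto simp: axis_eq_0_iff)
  then have "0 < x \<bullet> (?P *v x)" by (rule posdef_pos[OF pd])
  then have xj: "0 < x $ j" unfolding Px by (simp add: inner_axis)
  show ?thesis
    by (rule that[of "x /\<^sub>R x $ j"]) (use xj x0 Ax j in \<open>auto simp: matrix_vector_mult_scaleR\<close>)
qed

section \<open>Transitive perfect DAGs\<close>

locale transitive_perfect_dag =
  fixes D :: "('n::finite \<times> 'n) set" and E :: "'n set set"
  assumes version: "dag_version D E" and perfect: "perfect_dag D" and transitive: "trans D"
begin

lemma arrow_irrefl: "(i, i) \<notin> D"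
  using version by (auto simp: dag_version_def acyclic_def)

lemma arrow_trans: "(i, j) \<in> D \<Longrightarrow> (j, k) \<in> D \<Longrightarrow> (i, k) \<in> D"
  using transitive by (rule transD)

lemma arrow_asym: "(i, j) \<in> D \<Longrightarrow> (j, i) \<notin> D"
  using arrow_irrefl arrow_trans by blast

lemma wf_arrow: "wf D"
  using version by (simp add: dag_version_def finite_acyclic_wf)

lemma edge_iff: "{i, j} \<in> E \<longleftrightarrow> i = j \<or> (i, j) \<in> D \<or> (j, i) \<in> D"
proof -
  have "E = skeleton D" using version by (simp add: dag_version_def)
  then show ?thesis by (auto simp: skeleton_def doubleton_eq_iff)
qed

lemma pa_eq: "pa D j = {i. (i, j) \<in> D}"
  using arrow_irrefl by (auto simp: pa_def)

lemma nd_eq: "nd D j = {i. i \<noteq> j \<and> (j, i) \<notin> D}"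
  using transitive by (simp add: nd_def trancl_id)

lemma parents_adjacent: "(i, k) \<in> D \<Longrightarrow> (j, k) \<in> D \<Longrightarrow> {i, j} \<in> E"
  using perfect version by (auto simp: perfect_dag_def dag_version_def complete_set_def pa_eq)

lemma complete_closed_pa: "complete_set E (insert j (pa D j))"
  by (auto simp: complete_set_def pa_eq edge_iff dest: parents_adjacent[unfolded edge_iff])

text \<open>
  A vertex \<open>j\<close> of a maximal complete set is adjacent to all other members, and so are its
  parents: to the members that precede \<open>j\<close> by perfectness, to the others by transitivity.
\<close>

lemma clique_ancestral:
  assumes C: "clique E C" and "j \<in> C" "(i, j) \<in> D" shows "i \<in> C"
proof -
  have c: "{a, b} \<in> E" if "a \<in> C" "b \<in> C" for a b
    using C that by (auto simp: clique_def complete_set_def)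
  have "{i, k} \<in> E" if "k \<in> C" for k
    using c[OF \<open>j \<in> C\<close> that] assms(3) that
    by (auto simp: edge_iff dest: arrow_trans parents_adjacent[unfolded edge_iff])
  then have "complete_set E (insert i C)"
    using c by (auto simp: complete_set_def insert_commute edge_iff)
  then have "insert i C = C" using C by (auto simp: clique_def)
  then show ?thesis by auto
qed

text \<open>
  The column of the Cholesky-type factorization belonging to vertex \<open>j\<close>: \<open>\<Omega> *v w\<close> has coefficient 1
  at \<open>j\<close> and lives on the closed parent set, and its covariances \<open>w\<close> with the coordinates
  of a Gaussian vector with precision \<open>\<Omega>\<close> vanish outside \<open>j\<close> and its children. Thus
  \<open>\<Omega> *v w\<close> is the residual of \<open>j\<close> after regression on the non-descendants, and this
  regression involves the parents only.
\<close>

definition residual :: "real^'n^'n \<Rightarrow> 'n \<Rightarrow> real^'n \<Rightarrow> bool" where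
  "residual \<Omega> j w \<longleftrightarrow> (\<forall>i. i \<noteq> j \<and> (j, i) \<notin> D \<longrightarrow> w $ i = 0) \<and>
     (\<forall>i. i \<noteq> j \<and> (i, j) \<notin> D \<longrightarrow> (\<Omega> *v w) $ i = 0) \<and> (\<Omega> *v w) $ j = 1"

lemma residual_inner:
  assumes "residual \<Omega> i v" "residual \<Omega> j w" "(j, i) \<notin> D"
  shows "(\<Omega> *v v) \<bullet> w = (if i = j then w $ j else 0)"
proof -
  have *: "(\<Omega> *v v) $ k * w $ k = (if k = i \<and> i = j then w $ j else 0)" for k
  proof (cases "(k = i \<or> (k, i) \<in> D) \<and> (k = j \<or> (j, k) \<in> D)")
    case True
    then have "k = i \<and> k = j" using assms(3) arrow_trans[of j k i] by blast
    then show ?thesis using assms(1) by (auto simp: residual_def)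
  next
    case False
    then have "(\<Omega> *v v) $ k = 0 \<or> w $ k = 0" using assms(1,2) by (auto simp: residual_def)
    then show ?thesis using False by auto
  qed
  show ?thesis by (auto simp: inner_vec_sum *)
qed

text \<open>
  The residuals of different vertices are uncorrelated. If \<open>(j, i) \<notin> D\<close>, the closed parent set of \<open>i\<close>
  and the closed child set of \<open>j\<close> can meet only in \<open>i = j\<close>; by symmetry of \<open>\<Omega>\<close> and acyclicity this
  case is enough.
\<close>

lemma residual_orthogonal:
  assumes "posdef \<Omega>" "residual \<Omega> i v" "residual \<Omega> j w"
  shows "(\<Omega> *v v) \<bullet> w = (if i = j then w $ j else 0)"
proof (cases "(j, i) \<in> D")
  case False
  then show ?thesis using assms residual_inner by blast
next
  case True
  then have "(i, j) \<notin> D" "i \<noteq> j" using arrow_asym by auto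
  then have "(\<Omega> *v w) \<bullet> v = 0" using residual_inner[OF assms(3,2)] by simp
  then show ?thesis using \<open>i \<noteq> j\<close> posdef_inner_commute[OF assms(1), of v w] by (simp add: inner_commute)
qed

lemma residual_pos:
  assumes "posdef \<Omega>" "residual \<Omega> j w" shows "0 < w $ j"
proof -
  have "w \<noteq> 0" using assms(2) by (auto simp: residual_def)
  then have "0 < w \<bullet> (\<Omega> *v w)" by (rule posdef_pos[OF assms(1)])
  then show ?thesis using residual_inner[OF assms(2,2) arrow_irrefl] by (simp add: inner_commute)
qed

lemma cond_var_residual:
  assumes pd: "posdef \<Omega>" and w: "residual \<Omega> j w"
  shows "cond_var D (matrix_inv \<Omega>) j = w $ j"
proof -
  let ?S = "matrix_inv \<Omega>" and ?P = "pa D j" and ?l = "\<Omega> *v w"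
  let ?Q = "principal ?P ?S"
  have Sl: "?S *v ?l = w" by (rule posdef_matrix_inv_mult[OF pd])
  have l: "?l $ j = 1" "\<And>i. i \<notin> insert j ?P \<Longrightarrow> ?l $ i = 0" using w by (auto simp: residual_def pa_eq)
  have jP: "j \<notin> ?P" by (simp add: pa_def)
  have exp: "w $ k = ?S $ k $ j + (\<Sum>i\<in>?P. ?S $ k $ i * ?l $ i)" for k
    using matrix_vector_component_supported[of "insert j ?P" ?l ?S k] l jP unfolding Sl by simp
  have wP: "w $ k = 0" if "k \<in> ?P" for k
  proof -
    have "k \<noteq> j \<and> (j, k) \<notin> D" using that arrow_asym[of k j] arrow_irrefl[of j] by (auto simp: pa_eq)
    then show ?thesis using w by (simp add: residual_def)
  qed
  define y :: "real^'n" where "y = (\<chi> i. if i \<in> ?P then - ?l $ i else 0)"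
  define s :: "real^'n" where "s = (\<chi> k. if k \<in> ?P then ?S $ k $ j else 0)"
  have "?Q *v y = s"
    using exp wP by (auto simp: vec_eq_iff principal_mult_vector y_def s_def sum_negf) fastforce
  then have "matrix_inv ?Q *v s = y"
    using posdef_matrix_inv_mult(1)[OF posdef_principalI[OF posdef_matrix_inv[OF pd]]] by metis
  then have *: "(\<Sum>k\<in>?P. matrix_inv ?Q $ i $ k * ?S $ k $ j) = - ?l $ i" if "i \<in> ?P" for i
    using matrix_vector_component_supported[of ?P s "matrix_inv ?Q" i] that by (simp add: s_def y_def)
  have "(\<Sum>i\<in>?P. \<Sum>k\<in>?P. ?S $ j $ i * matrix_inv ?Q $ i $ k * ?S $ k $ j)
      = (\<Sum>i\<in>?P. ?S $ j $ i * - ?l $ i)"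
    by (rule sum.cong) (simp_all add: * sum_distrib_left[symmetric] mult.assoc)
  then show ?thesis unfolding cond_var_def using exp[of j] by (simp add: sum_negf)
qed

text \<open>
  Orthogonality says that the matrix with rows \<open>\<Omega> *v w j\<close> has the inverse with
  columns \<open>w j / w j $ j\<close>; multiplying \<open>\<Omega>\<close> by both gives the factorization $L^T D^{-1} L$.
\<close>

lemma residual_expansion:
  assumes pd: "posdef \<Omega>" and w: "\<And>j. residual \<Omega> j (w j)"
  shows "\<Omega> $ a $ b = (\<Sum>j\<in>UNIV. (\<Omega> *v w j) $ a * (\<Omega> *v w j) $ b / w j $ j)"
proof -
  define L :: "real^'n^'n" where "L = (\<chi> j a. (\<Omega> *v w j) $ a)"
  define R :: "real^'n^'n" where "R = (\<chi> a j. w j $ a / w j $ j)"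
  have "(L ** R) $ i $ j = (\<Omega> *v w i) \<bullet> w j / w j $ j" for i j
    by (simp add: matrix_matrix_mult_def L_def R_def inner_vec_sum sum_divide_distrib)
  then have "L ** R = mat 1"
    using residual_pos[OF pd w] by (auto simp: vec_eq_iff residual_orthogonal[OF pd w w] mat_def less_le)
  then have "R ** L = mat 1" by (rule matrix_left_right_inverse1)
  then have "\<Omega> = (\<Omega> ** R) ** L" by (metis matrix_mul_assoc matrix_mul_rid)
  moreover have "(\<Omega> ** R) $ a $ j = (\<Omega> *v w j) $ a / w j $ j" for a j
    by (simp add: matrix_matrix_mult_def R_def matrix_vector_mult_def sum_divide_distrib)
  moreover have "((\<Omega> ** R) ** L) $ a $ b = (\<Sum>j\<in>UNIV. (\<Omega> ** R) $ a $ j * L $ j $ b)"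
    by (simp add: matrix_matrix_mult_def)
  ultimately show ?thesis by (simp add: L_def)
qed

text \<open>
  A nonzero term of the expansion at \<open>(a, b)\<close> has both \<open>a\<close> and \<open>b\<close> in one closed parent set, which is
  complete by perfectness.
\<close>

lemma residual_imp_P_cone:
  assumes pd: "posdef \<Omega>" and w: "\<And>j. residual \<Omega> j (w j)"
  shows "\<Omega> \<in> P_cone E"
proof -
  have "\<Omega> $ a $ b = 0" if "{a, b} \<notin> E" for a b
  proof -
    have "(\<Omega> *v w j) $ a * (\<Omega> *v w j) $ b = 0" for j
      using w[of j] that complete_closed_pa[of j]
      by (auto simp: residual_def complete_set_def pa_eq edge_iff) metis
    then have "(\<Sum>j\<in>UNIV. (\<Omega> *v w j) $ a * (\<Omega> *v w j) $ b / w j $ j) = 0"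
      by (intro sum.neutral) (metis div_0)
    then show ?thesis by (subst residual_expansion[OF pd w])
  qed
  then show ?thesis using pd by (auto simp: P_cone_def)
qed

text \<open>
  On the cone this is the vector \<open>w\<close> of a residual at \<open>j\<close>, scaled to have the entry 1 at \<open>j\<close>. Cramer's rule
  makes it a rational function of the entries of \<open>\<Omega>\<close> in the columns of \<open>j\<close> and its children, which gives
  its measurability and shows which entries it depends on.
\<close>

definition elim_dir :: "'n \<Rightarrow> real^'n^'n \<Rightarrow> real^'n" where
  "elim_dir j \<Omega> = (\<chi> k. if k = j then 1 else
     det (\<chi> a b. if b = k then (if (j, a) \<in> D then - \<Omega> $ a $ j else 0)
                 else principal {i. (j, i) \<in> D} \<Omega> $ a $ b) / det (principal {i. (j, i) \<in> D} \<Omega>))"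

lemma elim_dir:
  assumes "det (principal {i. (j, i) \<in> D} \<Omega>) \<noteq> 0"
  shows "elim_dir j \<Omega> $ j = 1" "\<And>i. i \<noteq> j \<Longrightarrow> (j, i) \<notin> D \<Longrightarrow> elim_dir j \<Omega> $ i = 0"
    "\<And>i. (j, i) \<in> D \<Longrightarrow> (\<Omega> *v elim_dir j \<Omega>) $ i = 0"
proof -
  let ?C = "{i. (j, i) \<in> D}" and ?u = "elim_dir j \<Omega>"
  let ?P = "principal ?C \<Omega>"
  define y :: "real^'n" where "y = (\<chi> a. if (j, a) \<in> D then - \<Omega> $ a $ j else 0)"
  define x :: "real^'n" where "x = (\<chi> k. det (\<chi> a b. if b = k then y $ a else ?P $ a $ b) / det ?P)"
  have "?P *v x = y" using cramer[OF assms, of x y] by (simp add: x_def)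
  then have Px: "(?P *v x) $ a = y $ a" for a by simp
  show 1: "?u $ j = 1" by (simp add: elim_dir_def)
  have ux: "?u $ k = x $ k" if "k \<noteq> j" for k using that unfolding elim_dir_def x_def y_def by (simp cong: if_cong)
  show 2: "?u $ i = 0" if "i \<noteq> j" "(j, i) \<notin> D" for i
    using that Px[of i] by (simp add: principal_mult_vector y_def ux)
  show "(\<Omega> *v ?u) $ i = 0" if "(j, i) \<in> D" for i
  proof -
    have "(\<Omega> *v ?u) $ i = (\<Sum>k\<in>insert j ?C. \<Omega> $ i $ k * ?u $ k)"
      by (rule matrix_vector_component_supported) (use 2 in auto)
    also have "\<dots> = \<Omega> $ i $ j + (\<Sum>k\<in>?C. \<Omega> $ i $ k * ?u $ k)"
      by (simp add: 1 arrow_irrefl)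
    also have "(\<Sum>k\<in>?C. \<Omega> $ i $ k * ?u $ k) = (\<Sum>k\<in>?C. \<Omega> $ i $ k * x $ k)"
    proof (rule sum.cong)
      fix k assume "k \<in> ?C"
      then have "k \<noteq> j" using arrow_irrefl by blast
      then show "\<Omega> $ i $ k * ?u $ k = \<Omega> $ i $ k * x $ k" using ux by simp
    qed simp
    also have "\<dots> = - \<Omega> $ i $ j" using Px[of i] that by (simp add: principal_mult_vector y_def)
    finally show ?thesis by simp
  qed
qed

text \<open>
  The reciprocal of the conditional variance of \<open>j\<close> given its parents, for \<open>\<Omega>\<close> in the cone.
\<close>

definition cond_prec :: "'n \<Rightarrow> real^'n^'n \<Rightarrow> real" where
  "cond_prec j \<Omega> = (\<Omega> *v elim_dir j \<Omega>) $ j"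

lemma P_cone_elim_dir:
  assumes "\<Omega> \<in> P_cone E"
  shows "elim_dir j \<Omega> $ j = 1" "\<And>i. i \<noteq> j \<Longrightarrow> (j, i) \<notin> D \<Longrightarrow> elim_dir j \<Omega> $ i = 0"
    "\<And>i. i \<noteq> j \<Longrightarrow> (i, j) \<notin> D \<Longrightarrow> (\<Omega> *v elim_dir j \<Omega>) $ i = 0"
    "0 < cond_prec j \<Omega>" "residual \<Omega> j (elim_dir j \<Omega> /\<^sub>R cond_prec j \<Omega>)"
proof -
  have pd: "posdef \<Omega>" and z: "\<And>a b. {a, b} \<notin> E \<Longrightarrow> \<Omega> $ a $ b = 0" using assms by (auto simp: P_cone_def)
  let ?u = "elim_dir j \<Omega>"
  note u = elim_dir[OF posdef_det_nonzero[OF posdef_principalI[OF pd]]]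
  show u1: "?u $ j = 1" and u2: "\<And>i. i \<noteq> j \<Longrightarrow> (j, i) \<notin> D \<Longrightarrow> ?u $ i = 0" using u by auto
  show u3: "(\<Omega> *v ?u) $ i = 0" if i: "i \<noteq> j" "(i, j) \<notin> D" for i
  proof (cases "(j, i) \<in> D")
    case True
    then show ?thesis by (rule u)
  next
    case False
    \<comment> \<open>transitivity and perfectness forbid an edge between a child of \<open>j\<close> and a vertex not adjacent to \<open>j\<close>\<close>
    have "\<Omega> $ i $ k = 0" if "k = j \<or> (j, k) \<in> D" for k
    proof (rule z, rule notI)
      assume "{i, k} \<in> E"
      then have "k \<noteq> j" "(j, k) \<in> D" "i = k \<or> (i, k) \<in> D \<or> (k, i) \<in> D"
        using that i False by (auto simp: edge_iff)
      then have "{i, j} \<in> E" using False arrow_trans[of j k i] parents_adjacent[of i k j] by blast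
      then show False using i False by (simp add: edge_iff)
    qed
    then show ?thesis
      by (subst matrix_vector_component_supported[of "insert j {k. (j, k) \<in> D}"]) (auto simp: u2)
  qed
  have "?u \<noteq> 0" using u1 by auto
  then have "0 < ?u \<bullet> (\<Omega> *v ?u)" by (rule posdef_pos[OF pd])
  also have "?u \<bullet> (\<Omega> *v ?u) = (\<Sum>i\<in>{j}. ?u $ i * (\<Omega> *v ?u) $ i)"
    unfolding inner_vec_sum
    by (rule sum.mono_neutral_right) (use u u3 arrow_asym in fastforce)+
  finally show p: "0 < cond_prec j \<Omega>" by (simp add: u1 cond_prec_def)
  show "residual \<Omega> j (?u /\<^sub>R cond_prec j \<Omega>)"
    using u2 u3 p by (auto simp: residual_def matrix_vector_mult_scaleR) (simp add: cond_prec_def)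
qed

lemma cond_var_cond_prec:
  assumes "\<Omega> \<in> P_cone E" shows "cond_var D (matrix_inv \<Omega>) j = 1 / cond_prec j \<Omega>"
proof -
  have "posdef \<Omega>" using assms by (simp add: P_cone_def)
  then have "cond_var D (matrix_inv \<Omega>) j = (elim_dir j \<Omega> /\<^sub>R cond_prec j \<Omega>) $ j"
    using P_cone_elim_dir(5)[OF assms] by (rule cond_var_residual)
  then show ?thesis using P_cone_elim_dir(1)[OF assms] by (simp add: divide_inverse)
qed

text \<open>
  A nonempty parent-closed set contains a vertex without children in the set; it can be removed last.
\<close>

lemma ancestral_finite_induct [consumes 1, case_names empty insert]:
  assumes anc: "\<forall>j\<in>A. \<forall>i. (i, j) \<in> D \<longrightarrow> i \<in> A"
    and "P {}"
    and step: "\<And>j B. \<forall>k\<in>B. \<forall>i. (i, k) \<in> D \<longrightarrow> i \<in> B \<Longrightarrow> j \<notin> B \<Longrightarrow> pa D j \<subseteq> B \<Longrightarrow>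
      B \<subseteq> nd D j \<Longrightarrow> P B \<Longrightarrow> P (insert j B)"
  shows "P A"
  using finite[of A] anc
proof (induction A rule: finite_psubset_induct)
  case (psubset A)
  show ?case
  proof (cases "A = {}")
    case True
    then show ?thesis using \<open>P {}\<close> by simp
  next
    case False
    have "wf (D\<inverse>)" using version by (simp add: dag_version_def finite_acyclic_wf_converse)
    then obtain j where j: "j \<in> A" "\<And>k. (j, k) \<in> D \<Longrightarrow> k \<notin> A"
      using False by (metis wfE_min converse_iff ex_in_conv)
    let ?B = "A - {j}"
    have 1: "\<forall>k\<in>?B. \<forall>i. (i, k) \<in> D \<longrightarrow> i \<in> ?B" using psubset.prems j by auto
    moreover have "?B \<subset> A" using j by auto
    ultimately have "P ?B" using psubset.IH by blast
    moreover have "pa D j \<subseteq> ?B" using psubset.prems j by (auto simp: pa_def)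
    moreover have "?B \<subseteq> nd D j" using j by (auto simp: nd_eq)
    ultimately have "P (insert j ?B)" by (intro step[OF 1]) simp_all
    then show ?thesis using j by (simp add: insert_absorb)
  qed
qed

text \<open>
  Along an ancestral set the vertices can be eliminated one by one, children before parents;
  each elimination splits off one conditional variance.
\<close>

lemma det_ancestral:
  assumes \<Omega>: "\<Omega> \<in> P_cone E" and anc: "\<forall>j\<in>A. \<forall>i. (i, j) \<in> D \<longrightarrow> i \<in> A"
  shows "det (principal A (matrix_inv \<Omega>)) = (\<Prod>j\<in>A. cond_var D (matrix_inv \<Omega>) j)"
  using anc
proof (induction A rule: ancestral_finite_induct)
  case empty
  have "principal {} (matrix_inv \<Omega>) = mat 1" by (simp add: principal_def mat_def)
  then show ?case by simp
next
  case (insert j B)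
  let ?S = "matrix_inv \<Omega>"
  have pd: "posdef \<Omega>" using \<Omega> by (simp add: P_cone_def)
  define w where "w = elim_dir j \<Omega> /\<^sub>R cond_prec j \<Omega>"
  have w: "residual \<Omega> j w" unfolding w_def by (rule P_cone_elim_dir(5)[OF \<Omega>])
  let ?l = "\<Omega> *v w"
  have Sl: "?S *v ?l = w" by (rule posdef_matrix_inv_mult[OF pd])
  have "det (principal (insert j B) ?S) = (?S *v ?l) $ j * det (principal B ?S)"
  proof (rule det_principal_insert)
    show "?l $ j = 1" "\<And>i. i \<notin> insert j B \<Longrightarrow> ?l $ i = 0" "\<And>i. i \<in> B \<Longrightarrow> (?S *v ?l) $ i = 0"
      unfolding Sl using w insert.hyps by (auto simp: residual_def pa_eq nd_eq)
    show "det (principal B ?S) \<noteq> 0"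
      by (intro posdef_det_nonzero posdef_principalI posdef_matrix_inv pd)
  qed (use insert in simp)
  also have "(?S *v ?l) $ j = cond_var D ?S j" unfolding Sl cond_var_residual[OF pd w] ..
  finally show ?case using insert.IH \<open>j \<notin> B\<close> by simp
qed

end

section \<open>Conditional laws of Gaussian vectors\<close>

lemma measurable_vec_component [measurable]: "(\<lambda>x :: real^'n. x $ i) \<in> borel_measurable borel"
  by (intro borel_measurable_continuous_onI continuous_intros)

lemma measurable_matrix_vector_mult [measurable]: "(\<lambda>x :: real^'n. (A :: real^'n^'m) *v x) \<in> borel_measurable borel"
  by (intro borel_measurable_continuous_onI linear_continuous_on matrix_vector_mul_bounded_linear)

lemma measurable_axis [measurable]: "(axis j :: real \<Rightarrow> real^'n) \<in> borel_measurable borel"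
proof -
  have "axis j = (\<lambda>u :: real. u *\<^sub>R axis j 1 :: real^'n)" by (auto simp: axis_def vec_eq_iff)
  moreover have "(\<lambda>u :: real. u *\<^sub>R axis j 1 :: real^'n) \<in> borel_measurable borel" by measurable
  ultimately show ?thesis by metis
qed

text \<open>
  The segment from the identity to \<open>A\<close> stays within the positive definite matrices, hence the
  determinant does not change sign along it.
\<close>

lemma posdef_det_pos:
  fixes A :: "real^'n^'n"
  assumes "posdef A" shows "0 < det A"
proof (rule ccontr)
  assume neg: "\<not> 0 < det A"
  define f where "f t = det (\<chi> i j. (1 - t) * (mat 1 :: real^'n^'n) $ i $ j + t * A $ i $ j)" for t :: real
  have "continuous_on {0..1} f"
    unfolding f_def det_def by (auto intro!: continuous_intros)
  moreover have "f 0 = 1" "f 1 = det A" by (simp_all add: f_def)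
  ultimately obtain t where t: "0 \<le> t" "t \<le> 1" "f t = 0"
    using IVT2'[of f 1 0 0] neg by (auto simp: not_less)
  let ?M = "(\<chi> i j. (1 - t) * (mat 1 :: real^'n^'n) $ i $ j + t * A $ i $ j) :: real^'n^'n"
  have Mx: "?M *v x = (1 - t) *\<^sub>R x + t *\<^sub>R (A *v x)" for x
  proof -
    have "?M = (1 - t) *\<^sub>R mat 1 + t *\<^sub>R A" by (simp add: vec_eq_iff)
    then show ?thesis by (simp add: matrix_vector_mult_add_rdistrib scaleR_matrix_vector_assoc[symmetric])
  qed
  have "posdef ?M"
    unfolding posdef_def
  proof (intro conjI allI impI)
    show "transpose ?M = ?M"
      using posdef_symmetric[OF assms] by (simp add: vec_eq_iff transpose_def mat_def)
    fix x :: "real^'n" assume x: "x \<noteq> 0"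
    have 1: "0 < x \<bullet> x" using x by simp
    have 2: "0 < x \<bullet> (A *v x)" by (rule posdef_pos[OF assms x])
    have "0 < (1 - t) * (x \<bullet> x) + t * (x \<bullet> (A *v x))"
    proof (cases "t = 0")
      case False
      then show ?thesis using 1 2 t by (intro add_nonneg_pos) auto
    qed (use 1 in simp)
    then show "0 < x \<bullet> (?M *v x)" by (simp add: Mx inner_add_right)
  qed
  then have "f t \<noteq> 0" unfolding f_def by (rule posdef_det_nonzero)
  then show False using t by simp
qed

lemma sets_gaussian [measurable_cong, simp]: "sets (gaussian \<Omega>) = sets borel"
  by (simp add: gaussian_def)

lemma space_gaussian [simp]: "space (gaussian \<Omega>) = UNIV"
  by (simp add: gaussian_def)

text \<open>
  The quadratic form attains a positive minimum on the compact unit sphere.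
\<close>

lemma posdef_lower_bound:
  fixes \<Omega> :: "real^'n^'n"
  assumes pd: "posdef \<Omega>" shows "\<exists>m>0. \<forall>x. m * (x \<bullet> x) \<le> x \<bullet> (\<Omega> *v x)"
proof -
  obtain z where z: "z \<in> sphere 0 1" "\<And>x. x \<in> sphere 0 1 \<Longrightarrow> z \<bullet> (\<Omega> *v z) \<le> x \<bullet> (\<Omega> *v x)"
  proof -
    have "continuous_on (sphere 0 1) (\<lambda>x. x \<bullet> (\<Omega> *v x))"
      by (intro continuous_intros linear_continuous_on matrix_vector_mul_bounded_linear)
    moreover have "sphere (0 :: real^'n) 1 \<noteq> {}" by simp
    ultimately show ?thesis using continuous_attains_inf[OF compact_sphere] that by blast
  qed
  define m where "m = z \<bullet> (\<Omega> *v z)"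
  have m: "0 < m" using posdef_pos[OF pd, of z] z(1) by (fastforce simp: m_def)
  have lower: "m * (x \<bullet> x) \<le> x \<bullet> (\<Omega> *v x)" for x
  proof (cases "x = 0")
    case False
    have "m \<le> (x /\<^sub>R norm x) \<bullet> (\<Omega> *v (x /\<^sub>R norm x))"
      unfolding m_def using False by (intro z) simp
    also have "\<dots> = (x \<bullet> (\<Omega> *v x)) / (x \<bullet> x)"
      by (simp add: matrix_vector_mult_scaleR dot_square_norm power2_eq_square divide_inverse)
    finally show ?thesis using False by (simp add: field_simps)
  qed simp
  then show ?thesis using m by blast
qed

lemma finite_measure_gaussian:
  fixes \<Omega> :: "real^'n^'n"
  assumes pd: "posdef \<Omega>" shows "finite_measure (gaussian \<Omega>)"
proof
  let ?c = "sqrt (det \<Omega> / (2 * pi) ^ CARD('n))"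
  obtain m where m: "0 < m" and lower: "\<And>x. m * (x \<bullet> x) \<le> x \<bullet> (\<Omega> *v x)"
    using posdef_lower_bound[OF pd] by blast
  have "emeasure (gaussian \<Omega>) (space (gaussian \<Omega>)) = (\<integral>\<^sup>+x. ennreal (?c * exp (- (x \<bullet> (\<Omega> *v x)) / 2)) \<partial>lborel)"
    by (simp add: gaussian_def emeasure_density)
  also have "\<dots> \<le> (\<integral>\<^sup>+x. ennreal ?c * ennreal (exp (- (m / 2) * (x \<bullet> x))) \<partial>(lborel :: (real^'n) measure))"
  proof (rule nn_integral_mono)
    fix x :: "real^'n"
    show "ennreal (?c * exp (- (x \<bullet> (\<Omega> *v x)) / 2)) \<le> ennreal ?c * ennreal (exp (- (m / 2) * (x \<bullet> x)))"
      using lower[of x] posdef_det_pos[OF pd]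
      by (subst ennreal_mult[symmetric]) (auto intro!: ennreal_leI mult_left_mono)
  qed
  also have "\<dots> = ennreal ?c * (\<integral>\<^sup>+x. ennreal (exp (- (m / 2) * (x \<bullet> x))) \<partial>(lborel :: (real^'n) measure))"
    by (rule nn_integral_cmult) measurable
  also have "(\<integral>\<^sup>+x. ennreal (exp (- (m / 2) * (x \<bullet> x))) \<partial>(lborel :: (real^'n) measure))
      = (\<integral>\<^sup>+x. (\<Prod>b\<in>Basis. ennreal (exp (- (m / 2) * (x \<bullet> b)\<^sup>2))) \<partial>(lborel :: (real^'n) measure))"
  proof (rule nn_integral_cong)
    fix x :: "real^'n"
    have "exp (- (m / 2) * (x \<bullet> x)) = (\<Prod>b\<in>Basis. exp (- (m / 2) * (x \<bullet> b)\<^sup>2))"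
      by (subst euclidean_inner) (simp add: exp_sum[symmetric] sum_distrib_left sum_negf power2_eq_square)
    then show "ennreal (exp (- (m / 2) * (x \<bullet> x))) = (\<Prod>b\<in>Basis. ennreal (exp (- (m / 2) * (x \<bullet> b)\<^sup>2)))"
      by (simp add: prod_ennreal)
  qed
  also have "\<dots> = (\<Prod>b\<in>(Basis :: (real^'n) set). \<integral>\<^sup>+x. ennreal (exp (- (m / 2) * x\<^sup>2)) \<partial>lborel)"
    by (rule nn_integral_lborel_prod) auto
  finally have bound: "emeasure (gaussian \<Omega>) (space (gaussian \<Omega>)) \<le> ennreal ?c *
      (\<Prod>b\<in>(Basis :: (real^'n) set). \<integral>\<^sup>+x. ennreal (exp (- (m / 2) * x\<^sup>2)) \<partial>lborel)" .
  have "(\<integral>\<^sup>+x. ennreal (exp (- (m / 2) * x\<^sup>2)) \<partial>lborel) < \<infinity>"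
  proof -
    define s where "s = 1 / sqrt m"
    have s: "0 < s" "s\<^sup>2 = 1 / m" using m by (auto simp: s_def power_divide)
    have "exp (- (m / 2) * x\<^sup>2) = sqrt (2 * pi * s\<^sup>2) * normal_density 0 s x" for x
      using s m by (simp add: normal_density_def)
    moreover have "integrable lborel (\<lambda>x. sqrt (2 * pi * s\<^sup>2) * normal_density 0 s x)"
      using s by (intro integrable_mult_right integrable_normal_density)
    ultimately have "integrable lborel (\<lambda>x. exp (- (m / 2) * x\<^sup>2))" by simp
    then show ?thesis by (simp add: integrable_iff_bounded)
  qed
  then have "ennreal ?c * (\<Prod>b\<in>(Basis :: (real^'n) set). \<integral>\<^sup>+x. ennreal (exp (- (m / 2) * x\<^sup>2)) \<partial>lborel) < \<infinity>"
    by (simp add: ennreal_mult_less_top power_less_top_ennreal)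
  then show "emeasure (gaussian \<Omega>) (space (gaussian \<Omega>)) \<noteq> \<infinity>"
    using bound by auto
qed

lemma nn_integral_normal_density:
  assumes "0 < \<sigma>" shows "(\<integral>\<^sup>+s. ennreal (normal_density m \<sigma> s) \<partial>lborel) = 1"
proof -
  interpret prob_space "density lborel (normal_density m \<sigma>)"
    by (rule prob_space_normal_density[OF assms])
  show ?thesis using emeasure_space_1 by (simp add: emeasure_density)
qed

lemma nn_integral_lborel_translate:
  fixes f :: "'a::euclidean_space \<Rightarrow> ennreal"
  assumes [measurable]: "f \<in> borel_measurable borel"
  shows "(\<integral>\<^sup>+x. f (x + c) \<partial>lborel) = (\<integral>\<^sup>+x. f x \<partial>lborel)"
proof -
  have "(\<integral>\<^sup>+x. f x \<partial>lborel) = (\<integral>\<^sup>+x. f x \<partial>distr lborel borel ((+) c))"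
    by (simp add: lborel_distr_plus)
  also have "\<dots> = (\<integral>\<^sup>+x. f (c + x) \<partial>lborel)" by (rule nn_integral_distr) auto
  finally show ?thesis by (simp add: add.commute)
qed

text \<open>
  Averaging the translation invariance of Lebesgue measure along \<open>a\<close> against a normal density
  disintegrates an integral along the lines parallel to \<open>a\<close>, without any change of variables.
\<close>

lemma nn_integral_average_along:
  fixes f :: "'a::euclidean_space \<Rightarrow> ennreal"
  assumes [measurable]: "f \<in> borel_measurable borel" and la: "l \<bullet> a = 1" and \<sigma>: "0 < \<sigma>"
  shows "(\<integral>\<^sup>+x. f x \<partial>lborel) =
    (\<integral>\<^sup>+x. ennreal (normal_density 0 \<sigma> (l \<bullet> x)) * (\<integral>\<^sup>+s. f (x + s *\<^sub>R a) \<partial>lborel) \<partial>lborel)"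
proof -
  let ?r = "\<lambda>t. ennreal (normal_density 0 \<sigma> t)"
  have "(\<integral>\<^sup>+x. ?r (l \<bullet> x) * (\<integral>\<^sup>+s. f (x + s *\<^sub>R a) \<partial>lborel) \<partial>lborel)
      = (\<integral>\<^sup>+x. \<integral>\<^sup>+s. ?r (l \<bullet> x) * f (x + s *\<^sub>R a) \<partial>lborel \<partial>lborel)"
    by (intro nn_integral_cong nn_integral_cmult[symmetric]) measurable
  also have "\<dots> = (\<integral>\<^sup>+s. \<integral>\<^sup>+x. ?r (l \<bullet> x) * f (x + s *\<^sub>R a) \<partial>lborel \<partial>lborel)"
    by (rule lborel_pair.Fubini'[symmetric]) measurable
  also have "\<dots> = (\<integral>\<^sup>+s. \<integral>\<^sup>+x. ?r (l \<bullet> x - s) * f x \<partial>lborel \<partial>lborel)"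
  proof (rule nn_integral_cong)
    fix s :: real
    have "(\<integral>\<^sup>+x. ?r (l \<bullet> x) * f (x + s *\<^sub>R a) \<partial>lborel)
        = (\<integral>\<^sup>+x. ?r (l \<bullet> (x + s *\<^sub>R a) - s) * f (x + s *\<^sub>R a) \<partial>lborel)"
      by (simp add: inner_add_right la)
    also have "\<dots> = (\<integral>\<^sup>+x. ?r (l \<bullet> x - s) * f x \<partial>lborel)"
      by (rule nn_integral_lborel_translate) measurable
    finally show "(\<integral>\<^sup>+x. ?r (l \<bullet> x) * f (x + s *\<^sub>R a) \<partial>lborel) = (\<integral>\<^sup>+x. ?r (l \<bullet> x - s) * f x \<partial>lborel)" .
  qed
  also have "\<dots> = (\<integral>\<^sup>+x. \<integral>\<^sup>+s. ?r (l \<bullet> x - s) * f x \<partial>lborel \<partial>lborel)"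
    by (rule lborel_pair.Fubini') measurable
  also have "\<dots> = (\<integral>\<^sup>+x. f x \<partial>lborel)"
  proof (rule nn_integral_cong)
    fix x :: 'a
    have "(\<integral>\<^sup>+s. ?r (l \<bullet> x - s) * f x \<partial>lborel) = (\<integral>\<^sup>+s. ?r (l \<bullet> x + (-1) * s) \<partial>lborel) * f x"
      by (simp add: nn_integral_multc)
    also have "(\<integral>\<^sup>+s. ?r (l \<bullet> x + (-1) * s) \<partial>lborel) = 1"
      using nn_integral_real_affine[of ?r "-1" "l \<bullet> x"] nn_integral_normal_density[OF \<sigma>] by simp
    finally show "(\<integral>\<^sup>+s. ?r (l \<bullet> x - s) * f x \<partial>lborel) = f x" by simp
  qed
  finally show ?thesis by simp
qed

definition normal_prob :: "real \<Rightarrow> real set \<Rightarrow> real" where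
  "normal_prob v A = measure (density lborel (\<lambda>u. ennreal (normal_density 0 (sqrt v) u))) A"

lemma normal_prob_bounds: "0 < v \<Longrightarrow> 0 \<le> normal_prob v A \<and> normal_prob v A \<le> 1"
  using prob_space.prob_le_1[OF prob_space_normal_density[of "sqrt v" 0]]
  by (simp add: normal_prob_def)

lemma ennreal_normal_prob:
  assumes "0 < v" and [measurable]: "A \<in> sets borel"
  shows "ennreal (normal_prob v A) = (\<integral>\<^sup>+u. indicator A u * ennreal (normal_density 0 (sqrt v) u) \<partial>lborel)"
proof -
  interpret prob_space "density lborel (\<lambda>u. ennreal (normal_density 0 (sqrt v) u))"
    using assms(1) by (intro prob_space_normal_density) simp
  show ?thesis
    by (simp add: normal_prob_def emeasure_eq_measure[symmetric] emeasure_density mult.commute)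
qed

lemma normal_prob_halfline_strict_mono:
  assumes v: "0 < v" and "c < d"
  shows "normal_prob v {u. 0 < c + u} < normal_prob v {u. 0 < d + u}"
proof -
  let ?N = "density lborel (\<lambda>u. ennreal (normal_density 0 (sqrt v) u))"
  interpret prob_space ?N
    using v by (intro prob_space_normal_density) simp
  let ?I = "{- d<..- c}"
  have "emeasure ?N ?I \<noteq> 0"
  proof
    assume "emeasure ?N ?I = 0"
    then have "(\<integral>\<^sup>+u. ennreal (normal_density 0 (sqrt v) u) * indicator ?I u \<partial>lborel) = 0"
      by (simp add: emeasure_density)
    then have "AE u in lborel. ennreal (normal_density 0 (sqrt v) u) * indicator ?I u = 0"
      by (subst (asm) nn_integral_0_iff_AE) auto
    then have "AE u in lborel. u \<notin> ?I"
      using normal_density_pos[of "sqrt v"] v by (auto simp: indicator_def ennreal_eq_0_iff not_le[symmetric] elim!: eventually_mono)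
    then have "emeasure lborel ?I = 0" by (subst (asm) AE_iff_measurable[OF _ refl]) (auto simp: Collect_conj_eq[symmetric] greaterThanAtMost_def greaterThan_def atMost_def Int_def)
    then show False using \<open>c < d\<close> by simp
  qed
  then have "0 < measure ?N ?I" by (simp add: emeasure_eq_measure zero_less_measure_iff)
  moreover have "{u. 0 < d + u} = {u. 0 < c + u} \<union> ?I" using \<open>c < d\<close> by auto
  moreover have "measure ?N ({u. 0 < c + u} \<union> ?I) = measure ?N {u. 0 < c + u} + measure ?N ?I"
    by (rule finite_measure_Union) auto
  ultimately show ?thesis by (simp add: normal_prob_def)
qed

text \<open>
  If \<open>w\<close> are the covariances with the linear form \<open>l = \<Omega> *v w\<close>, then the quadratic form of \<open>\<Omega>\<close>
  splits as $(l\cdot x)^2 / (l \cdot w)$ plus a part constant along \<open>w\<close>. Hence, given everything that is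
  constant along \<open>w\<close>, the form \<open>l\<close> is centered normal with variance $l \cdot w$, and the \<open>j\<close>-th
  coordinate is \<open>l\<close> plus a term constant along \<open>w\<close>. Disintegrating Lebesgue measure along \<open>w\<close> turns this
  into an identity of integrals.
\<close>

lemma gaussian_regression:
  fixes \<Omega> :: "real^'n^'n"
  assumes pd: "posdef \<Omega>" and v: "0 < v" "w $ j = v" "(\<Omega> *v w) \<bullet> w = v"
    and [measurable]: "S \<in> sets borel" "T \<in> sets borel"
    and S: "\<And>x y. x $ j = y $ j \<Longrightarrow> x \<in> S \<longleftrightarrow> y \<in> S"
    and T: "\<And>x s. x + s *\<^sub>R w \<in> T \<longleftrightarrow> x \<in> T"
  shows "emeasure (gaussian \<Omega>) (S \<inter> T) =
    (\<integral>\<^sup>+x. ennreal (normal_prob v {u. axis j (x $ j - (\<Omega> *v w) \<bullet> x + u) \<in> S}) * indicator T x \<partial>gaussian \<Omega>)"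
proof -
  define l where "l = \<Omega> *v w"
  define a where "a = w /\<^sub>R v"
  define K where "K = sqrt (det \<Omega> / (2 * pi) ^ CARD('n))"
  define Q where "Q x = x \<bullet> (\<Omega> *v x) - (l \<bullet> x)\<^sup>2 / v" for x
  let ?r = "\<lambda>t. ennreal (normal_density 0 (sqrt v) t)"
  let ?h = "\<lambda>c. normal_prob v {u. axis j (c + u) \<in> S}"
  \<comment> \<open>the factor of the density that is constant along \<open>w\<close>, with the constant that normalizes the other factor\<close>
  define e where "e x = ennreal (K * sqrt (2 * pi * v) * exp (- Q x / 2))" for x
  have [measurable]: "Q \<in> borel_measurable borel" "e \<in> borel_measurable borel"
    unfolding Q_def e_def by measurable
  have K: "0 \<le> K" using posdef_det_pos[OF pd] by (simp add: K_def)
  have la: "l \<bullet> a = 1" and aj: "a $ j = 1" using v by (simp_all add: l_def a_def)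
  have \<Omega>a: "\<Omega> *v a = l /\<^sub>R v" by (simp add: a_def l_def matrix_vector_mult_scaleR)
  have lx: "l \<bullet> (x + s *\<^sub>R a) = l \<bullet> x + s" for x s by (simp add: inner_add_right la)
  have Qa: "Q (x + s *\<^sub>R a) = Q x" for x s
  proof -
    have "(x + s *\<^sub>R a) \<bullet> (\<Omega> *v (x + s *\<^sub>R a))
        = x \<bullet> (\<Omega> *v x) + s * (x \<bullet> (\<Omega> *v a)) + s * (a \<bullet> (\<Omega> *v x)) + s * s * (a \<bullet> (\<Omega> *v a))"
      by (simp add: matrix_vector_right_distrib matrix_vector_mult_scaleR inner_add_left inner_add_right algebra_simps)
    also have "a \<bullet> (\<Omega> *v x) = (\<Omega> *v a) \<bullet> x" by (rule posdef_inner_commute[OF pd])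
    finally show ?thesis using v(1) la
      by (simp add: Q_def lx \<Omega>a inner_commute power2_eq_square field_simps)
  qed
  have ea: "e (x + s *\<^sub>R a) = e x" for x s by (simp add: e_def Qa)
  have Ta: "indicator T (x + s *\<^sub>R a) = (indicator T x :: ennreal)" for x s
    using T[of x "s / v"] by (simp add: indicator_def a_def divide_inverse)
  have dens: "ennreal (K * exp (- (x \<bullet> (\<Omega> *v x)) / 2)) = ?r (l \<bullet> x) * e x" for x
  proof -
    have "exp (- (x \<bullet> (\<Omega> *v x)) / 2) = exp (- (l \<bullet> x)\<^sup>2 / (2 * v)) * exp (- Q x / 2)"
      using v(1) by (simp add: exp_add[symmetric] Q_def field_simps)
    then have "K * exp (- (x \<bullet> (\<Omega> *v x)) / 2)
        = normal_density 0 (sqrt v) (l \<bullet> x) * (K * sqrt (2 * pi * v) * exp (- Q x / 2))"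
      using v(1) by (simp add: normal_density_def)
    then show ?thesis using K v(1) by (simp add: e_def ennreal_mult[symmetric])
  qed
  have line: "(\<integral>\<^sup>+s. indicator S (x + s *\<^sub>R a) * ?r (l \<bullet> x + s) \<partial>lborel) = ennreal (?h (x $ j - l \<bullet> x))" for x
  proof -
    have "(\<integral>\<^sup>+s. indicator S (x + s *\<^sub>R a) * ?r (l \<bullet> x + s) \<partial>lborel)
        = (\<integral>\<^sup>+s. indicator S (x + (l \<bullet> x + s - l \<bullet> x) *\<^sub>R a) * ?r (l \<bullet> x + s) \<partial>lborel)" by simp
    also have "\<dots> = (\<integral>\<^sup>+u. indicator S (x + (u - l \<bullet> x) *\<^sub>R a) * ?r u \<partial>lborel)"
      using nn_integral_real_affine[of "\<lambda>u. indicator S (x + (u - l \<bullet> x) *\<^sub>R a) * ?r u" 1 "l \<bullet> x"] by simp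
    also have "\<dots> = (\<integral>\<^sup>+u. indicator {u. axis j (x $ j - l \<bullet> x + u) \<in> S} u * ?r u \<partial>lborel)"
    proof (rule nn_integral_cong)
      fix u
      have "x + (u - l \<bullet> x) *\<^sub>R a \<in> S \<longleftrightarrow> axis j (x $ j - l \<bullet> x + u) \<in> S"
        by (rule S) (simp add: aj axis_def)
      then show "indicator S (x + (u - l \<bullet> x) *\<^sub>R a) * ?r u =
          indicator {u. axis j (x $ j - l \<bullet> x + u) \<in> S} u * ?r u" by (simp add: indicator_def)
    qed
    also have "\<dots> = ennreal (?h (x $ j - l \<bullet> x))"
      by (rule ennreal_normal_prob[OF v(1), symmetric]) measurable
    finally show ?thesis .
  qed
  have hm [measurable]: "(\<lambda>x. ennreal (?h (x $ j - l \<bullet> x))) \<in> borel_measurable borel"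
    unfolding line[symmetric] by measurable
  have "emeasure (gaussian \<Omega>) (S \<inter> T)
      = (\<integral>\<^sup>+x. indicator S x * indicator T x * (?r (l \<bullet> x) * e x) \<partial>lborel)"
    unfolding gaussian_def K_def[symmetric]
    by (subst emeasure_density, measurable) (simp only: dens indicator_inter_arith mult_ac)
  also have "\<dots> = (\<integral>\<^sup>+x. ?r (l \<bullet> x) * (\<integral>\<^sup>+s. indicator S (x + s *\<^sub>R a) * indicator T (x + s *\<^sub>R a) *
      (?r (l \<bullet> (x + s *\<^sub>R a)) * e (x + s *\<^sub>R a)) \<partial>lborel) \<partial>lborel)"
    by (rule nn_integral_average_along[OF _ la]) (use v in auto)
  also have "\<dots> = (\<integral>\<^sup>+x. ?r (l \<bullet> x) * (\<integral>\<^sup>+s. (indicator T x * e x) * (indicator S (x + s *\<^sub>R a) *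
      ?r (l \<bullet> x + s)) \<partial>lborel) \<partial>lborel)"
    by (simp only: lx ea Ta mult_ac)
  also have "\<dots> = (\<integral>\<^sup>+x. ?r (l \<bullet> x) * ((indicator T x * e x) * ennreal (?h (x $ j - l \<bullet> x))) \<partial>lborel)"
    by (simp add: nn_integral_cmult line)
  also have "\<dots> = (\<integral>\<^sup>+x. (?r (l \<bullet> x) * e x) * (ennreal (?h (x $ j - l \<bullet> x)) * indicator T x) \<partial>lborel)"
    by (simp only: mult_ac)
  also have "\<dots> = (\<integral>\<^sup>+x. ennreal (?h (x $ j - l \<bullet> x)) * indicator T x \<partial>gaussian \<Omega>)"
    unfolding gaussian_def K_def[symmetric]
    by (subst nn_integral_density, measurable) (simp only: dens)
  finally show ?thesis by (simp add: l_def)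
qed

section \<open>The directed local Markov property\<close>

lemma measurable_coord: "(\<lambda>x :: real^'n. \<lambda>i\<in>A. x $ i) \<in> measurable borel (\<Pi>\<^sub>M i\<in>A. borel)"
  by measurable

lemma space_coord_algebra [simp]: "space (coord_algebra A) = UNIV"
  by (simp add: coord_algebra_def)

lemma sets_coord_algebra: "sets (coord_algebra A :: (real^'n) measure) \<subseteq> sets borel"
proof -
  have "id \<in> measurable borel (coord_algebra A :: (real^'n) measure)"
    unfolding coord_algebra_def by (rule measurable_vimage_algebra2) (auto intro: measurable_coord)
  then show ?thesis by (auto dest: measurable_sets)
qed

lemma measurable_coord_component:
  "i \<in> A \<Longrightarrow> (\<lambda>x :: real^'n. x $ i) \<in> borel_measurable (coord_algebra A)"
proof -
  assume i: "i \<in> A"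
  have "(\<lambda>x :: real^'n. \<lambda>i\<in>A. x $ i) \<in> measurable (coord_algebra A) (\<Pi>\<^sub>M i\<in>A. borel)"
    unfolding coord_algebra_def by (rule measurable_vimage_algebra1) (auto simp: space_PiM)
  then have "(\<lambda>x :: real^'n. (\<lambda>i\<in>A. x $ i) i) \<in> measurable (coord_algebra A) borel"
    using i by measurable
  then show ?thesis using i by simp
qed

lemma sets_coord_algebra_mono:
  assumes "A \<subseteq> B" shows "sets (coord_algebra A) \<subseteq> sets (coord_algebra B :: (real^'n) measure)"
proof -
  have "(\<lambda>x :: real^'n. \<lambda>i\<in>A. x $ i) \<in> measurable (coord_algebra B) (\<Pi>\<^sub>M i\<in>A. borel)"
    by (rule measurable_restrict, rule measurable_coord_component) (use assms in auto)
  then have "id \<in> measurable (coord_algebra B) (coord_algebra A :: (real^'n) measure)"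
    by (subst (2) coord_algebra_def, intro measurable_vimage_algebra2) auto
  then show ?thesis by (auto dest: measurable_sets)
qed

lemma coord_algebra_invariant:
  assumes "S \<in> sets (coord_algebra A)" "\<And>i. i \<in> A \<Longrightarrow> x $ i = y $ i"
  shows "x \<in> S \<longleftrightarrow> y \<in> S"
proof -
  have "(\<lambda>i\<in>A. x $ i) = (\<lambda>i\<in>A. y $ i)" using assms(2) by auto
  moreover obtain X where "S = (\<lambda>x. \<lambda>i\<in>A. x $ i) -` X \<inter> UNIV"
    using assms(1) unfolding coord_algebra_def by (subst (asm) sets_vimage_algebra2) (auto simp: space_PiM)
  ultimately show ?thesis by simp
qed

lemma coord_measurable_invariant:
  assumes "f \<in> borel_measurable (coord_algebra A)" "\<And>i. i \<in> A \<Longrightarrow> x $ i = y $ i"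
  shows "(f x :: real) = f y"
proof -
  have "f -` {f x} \<inter> space (coord_algebra A) \<in> sets (coord_algebra A)"
    using assms(1) by (rule measurable_sets) simp
  then show ?thesis using coord_algebra_invariant[OF _ assms(2), of "f -` {f x}"] by auto
qed

lemma coord_subalgebra: "subalgebra (gaussian \<Omega>) (coord_algebra A)"
  using sets_coord_algebra by (auto simp: subalgebra_def)

lemma sigma_finite_coord_subalgebra:
  assumes "posdef \<Omega>" shows "sigma_finite_subalgebra (gaussian \<Omega>) (coord_algebra A)"
proof -
  interpret finite_measure "gaussian \<Omega>" by (rule finite_measure_gaussian[OF assms])
  interpret finite_measure_subalgebra "gaussian \<Omega>" "coord_algebra A"
    by standard (rule coord_subalgebra)
  show ?thesis by (rule sigma_finite_subalgebra_axioms)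
qed

text \<open>
  For a Gaussian vector with precision matrix \<open>\<Omega>\<close>, the form \<open>\<Omega> *v w\<close> is the \<open>j\<close>-th coordinate minus its
  regression on the coordinates in \<open>N\<close>: its covariances with the coordinates are the entries of \<open>w\<close>.
\<close>

definition regression :: "real^'n^'n \<Rightarrow> 'n \<Rightarrow> 'n set \<Rightarrow> real^'n \<Rightarrow> bool" where
  "regression \<Omega> j N w \<longleftrightarrow> j \<notin> N \<and> (\<Omega> *v w) $ j = 1 \<and> (\<forall>i. i \<notin> insert j N \<longrightarrow> (\<Omega> *v w) $ i = 0) \<and>
     (\<forall>i\<in>N. w $ i = 0)"

lemma regression_exists:
  fixes \<Omega> :: "real^'n^'n"
  assumes pd: "posdef \<Omega>" and j: "j \<notin> N" shows "\<exists>w. regression \<Omega> j N w"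
proof -
  obtain l where "l $ j = 1" "\<And>i. i \<notin> insert j N \<Longrightarrow> l $ i = 0" "\<And>i. i \<in> N \<Longrightarrow> (matrix_inv \<Omega> *v l) $ i = 0"
    using posdef_principal_regression[OF posdef_principalI[OF posdef_matrix_inv[OF pd]] j] by metis
  then have "regression \<Omega> j N (matrix_inv \<Omega> *v l)"
    using j by (simp add: regression_def posdef_matrix_inv_mult(2)[OF pd])
  then show ?thesis ..
qed

lemma regression_variance:
  assumes pd: "posdef \<Omega>" and w: "regression \<Omega> j N w"
  shows "(\<Omega> *v w) \<bullet> w = w $ j" "0 < w $ j"
proof -
  have "(\<Omega> *v w) \<bullet> w = (\<Sum>i\<in>{j}. (\<Omega> *v w) $ i * w $ i)"
    unfolding inner_vec_sum by (rule sum.mono_neutral_right) (use w in \<open>auto simp: regression_def\<close>)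
  then show *: "(\<Omega> *v w) \<bullet> w = w $ j" using w by (simp add: regression_def)
  have "w \<noteq> 0" using w by (auto simp: regression_def)
  then show "0 < w $ j" using posdef_pos[OF pd, of w] * by (simp add: inner_commute)
qed

text \<open>
  The conditional probability of an event \<open>S\<close> about the \<open>j\<close>-th coordinate given the coordinates in \<open>N\<close>:
  \<open>x $ j - (\<Omega> *v w) \<bullet> x\<close> is the value of the regression function, and \<open>axis j\<close> turns a value of the
  \<open>j\<close>-th coordinate into a point at which membership in \<open>S\<close> can be tested.
\<close>

definition regression_prob :: "real^'n^'n \<Rightarrow> 'n \<Rightarrow> real^'n \<Rightarrow> (real^'n) set \<Rightarrow> real^'n \<Rightarrow> real" where
  "regression_prob \<Omega> j w S x = normal_prob (w $ j) {u. axis j (x $ j - (\<Omega> *v w) \<bullet> x + u) \<in> S}"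

lemma regression_prob_measurable:
  fixes \<Omega> :: "real^'n^'n"
  assumes pd: "posdef \<Omega>" and w: "regression \<Omega> j N w" and S[measurable]: "S \<in> sets borel"
  shows "regression_prob \<Omega> j w S \<in> borel_measurable (coord_algebra N)"
proof -
  let ?l = "\<Omega> *v w"
  have v: "0 < w $ j" by (rule regression_variance[OF pd w])
  define f where "f c = normal_prob (w $ j) {u. axis j (c + u) \<in> S}" for c
  have "(\<lambda>c. ennreal (f c)) = (\<lambda>c. \<integral>\<^sup>+u. indicator {u. axis j (c + u) \<in> S} u *
      ennreal (normal_density 0 (sqrt (w $ j)) u) \<partial>lborel)"
    unfolding f_def by (intro ext ennreal_normal_prob v) measurable
  also have "\<dots> = (\<lambda>c. \<integral>\<^sup>+u. indicator S (axis j (c + u)) *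
      ennreal (normal_density 0 (sqrt (w $ j)) u) \<partial>lborel)"
    by (simp add: indicator_def)
  also have "\<dots> \<in> borel_measurable borel" by measurable
  finally have "(\<lambda>c. enn2real (ennreal (f c))) \<in> borel_measurable borel" by measurable
  moreover have "(\<lambda>c. enn2real (ennreal (f c))) = f"
    using normal_prob_bounds[OF v] by (auto simp: f_def)
  ultimately have fm: "f \<in> borel_measurable borel" by simp
  have "x $ j - ?l \<bullet> x = - (\<Sum>i\<in>N. ?l $ i * x $ i)" for x
  proof -
    have "?l \<bullet> x = (\<Sum>i\<in>insert j N. ?l $ i * x $ i)"
      unfolding inner_vec_sum by (rule sum.mono_neutral_right) (use w in \<open>auto simp: regression_def\<close>)
    then show ?thesis using w by (simp add: regression_def)
  qed
  then have "regression_prob \<Omega> j w S = f \<circ> (\<lambda>x. - (\<Sum>i\<in>N. ?l $ i * x $ i))"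
    by (simp add: fun_eq_iff regression_prob_def f_def)
  moreover have "(\<lambda>x. - (\<Sum>i\<in>N. ?l $ i * x $ i)) \<in> borel_measurable (coord_algebra N)"
    by (intro borel_measurable_uminus borel_measurable_sum borel_measurable_times
        borel_measurable_const measurable_coord_component)
  ultimately show ?thesis by (simp only: measurable_comp[OF _ fm])
qed

lemma regression_prob_bounds:
  assumes "posdef \<Omega>" "regression \<Omega> j N w"
  shows "0 \<le> regression_prob \<Omega> j w S x" "regression_prob \<Omega> j w S x \<le> 1"
  using normal_prob_bounds[OF regression_variance(2)[OF assms]] by (auto simp: regression_prob_def)

lemma measure_gaussian_regression:
  fixes \<Omega> :: "real^'n^'n"
  assumes pd: "posdef \<Omega>" and w: "regression \<Omega> j N w"
    and S: "S \<in> sets (coord_algebra {j})" and T: "T \<in> sets (coord_algebra N)"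
  shows "measure (gaussian \<Omega>) (S \<inter> T) =
      (\<integral>x. regression_prob \<Omega> j w S x * indicator T x \<partial>gaussian \<Omega>)"
    "integrable (gaussian \<Omega>) (regression_prob \<Omega> j w S)"
proof -
  let ?g = "regression_prob \<Omega> j w S"
  interpret finite_measure "gaussian \<Omega>" by (rule finite_measure_gaussian[OF pd])
  note v = regression_variance[OF pd w]
  note b = regression_prob_bounds[OF pd w]
  have [measurable]: "S \<in> sets borel" "T \<in> sets borel"
    using S T sets_coord_algebra by auto
  have [measurable]: "?g \<in> borel_measurable borel"
    using measurable_from_subalg[OF coord_subalgebra regression_prob_measurable[OF pd w]] by simp
  show i: "integrable (gaussian \<Omega>) ?g"
    by (rule integrable_const_bound[where B = 1]) (use b in auto)
  have "emeasure (gaussian \<Omega>) (S \<inter> T) = (\<integral>\<^sup>+x. ennreal (?g x) * indicator T x \<partial>gaussian \<Omega>)"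
    unfolding regression_prob_def
  proof (rule gaussian_regression[OF pd v(2) refl v(1)])
    show "x \<in> S \<longleftrightarrow> y \<in> S" if "x $ j = y $ j" for x y
      by (rule coord_algebra_invariant[OF S]) (use that in auto)
    show "x + s *\<^sub>R w \<in> T \<longleftrightarrow> x \<in> T" for x s
      by (rule coord_algebra_invariant[OF T]) (use w in \<open>auto simp: regression_def\<close>)
  qed measurable
  also have "\<dots> = (\<integral>\<^sup>+x. ennreal (?g x * indicator T x) \<partial>gaussian \<Omega>)"
    by (intro nn_integral_cong) (auto simp: indicator_def)
  also have "\<dots> = ennreal (\<integral>x. ?g x * indicator T x \<partial>gaussian \<Omega>)"
    using b by (intro nn_integral_eq_integral integrable_real_mult_indicator i) auto
  finally show "measure (gaussian \<Omega>) (S \<inter> T) = (\<integral>x. ?g x * indicator T x \<partial>gaussian \<Omega>)"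
    using b by (simp add: emeasure_eq_measure)
qed

text \<open>
  The regression function involves only the coordinates in \<open>P\<close>, so the conditional probability
  given those in \<open>N\<close> is already measurable with respect to those in \<open>P\<close>, and conditioning on \<open>P\<close>
  commutes with multiplication by it.
\<close>

lemma cond_indepI_regression:
  fixes \<Omega> :: "real^'n^'n"
  assumes pd: "posdef \<Omega>" and w: "regression \<Omega> j N w"
    and P: "P \<subseteq> N" "\<And>i. i \<notin> insert j P \<Longrightarrow> (\<Omega> *v w) $ i = 0"
  shows "cond_indep (gaussian \<Omega>) {j} N P"
  unfolding cond_indep_def
proof (intro ballI)
  fix S T assume S: "S \<in> sets (coord_algebra {j})" and T: "T \<in> sets (coord_algebra N)"
  let ?M = "gaussian \<Omega>" and ?F = "coord_algebra P"
  let ?g = "regression_prob \<Omega> j w S"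
  interpret finite_measure ?M by (rule finite_measure_gaussian[OF pd])
  interpret sigma_finite_subalgebra ?M ?F by (rule sigma_finite_coord_subalgebra[OF pd])
  have wP: "regression \<Omega> j P w" using w P by (auto simp: regression_def)
  have Sb [measurable]: "S \<in> sets borel" and [measurable]: "T \<in> sets borel"
    using S T sets_coord_algebra by auto
  have gF [measurable]: "?g \<in> borel_measurable ?F" by (rule regression_prob_measurable[OF pd wP Sb])
  have gM [measurable]: "?g \<in> borel_measurable borel"
    using measurable_from_subalg[OF subalg gF] by simp
  have gi: "integrable ?M ?g" by (rule measure_gaussian_regression(2)[OF pd w S T])
  have key: "measure ?M (S \<inter> T') = (\<integral>x. ?g x * indicator T' x \<partial>?M)" if "T' \<in> sets (coord_algebra N)" for T'
    by (rule measure_gaussian_regression(1)[OF pd w S that])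
  have F: "A \<in> sets (coord_algebra N)" "A \<in> sets borel" if "A \<in> sets ?F" for A
    using that sets_coord_algebra_mono[OF P(1)] sets_coord_algebra by auto
  have int: "integrable ?M (indicator A :: _ \<Rightarrow> real)" if "A \<in> sets borel" for A
    using that by (intro integrable_indicator_iff[THEN iffD2] conjI) (auto simp: less_top[symmetric])
  have 1: "AE x in ?M. real_cond_exp ?M ?F (indicator S) x = ?g x"
  proof (rule real_cond_exp_charact)
    fix A assume A: "A \<in> sets ?F"
    have "(\<integral>x\<in>A. indicator S x \<partial>?M) = measure ?M (S \<inter> A)"
      using F[OF A] by (simp add: set_lebesgue_integral_def indicator_inter_arith[symmetric] Int_commute)
    then show "(\<integral>x\<in>A. indicator S x \<partial>?M) = (\<integral>x\<in>A. ?g x \<partial>?M)"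
      using key[OF F(1)[OF A]] by (simp add: set_lebesgue_integral_def mult.commute)
  qed (use gi int in auto)
  let ?t = "real_cond_exp ?M ?F (indicator T)"
  have tb: "integrable ?M ?t" by (rule real_cond_exp_int) (simp add: int)
  have gt: "integrable ?M (\<lambda>x. ?g x * ?t x)"
    by (rule real_cond_exp_intg(1)) (auto intro!: integrable_real_mult_indicator gi)
  have 2: "AE x in ?M. real_cond_exp ?M ?F (indicator (S \<inter> T)) x = ?g x * ?t x"
  proof (rule real_cond_exp_charact)
    fix A assume A: "A \<in> sets ?F"
    note [measurable] = A F[OF A]
    have "(\<integral>x\<in>A. indicator (S \<inter> T) x \<partial>?M) = measure ?M (S \<inter> (T \<inter> A))"
      by (simp add: set_lebesgue_integral_def indicator_inter_arith[symmetric] Int_ac)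
    also have "\<dots> = (\<integral>x. ?g x * indicator (T \<inter> A) x \<partial>?M)"
      by (rule key) (use T F(1)[OF A] in auto)
    also have "\<dots> = (\<integral>x. (?g x * indicator A x) * indicator T x \<partial>?M)"
      by (simp add: indicator_inter_arith mult_ac)
    also have "\<dots> = (\<integral>x. (?g x * indicator A x) * ?t x \<partial>?M)"
      by (rule real_cond_exp_intg(2)[symmetric]) (auto intro!: integrable_real_mult_indicator gi)
    finally show "(\<integral>x\<in>A. indicator (S \<inter> T) x \<partial>?M) = (\<integral>x\<in>A. ?g x * ?t x \<partial>?M)"
      by (simp add: set_lebesgue_integral_def mult_ac)
  qed (use gt int in auto)
  show "AE x in ?M. real_cond_exp ?M ?F (indicator (S \<inter> T)) x =
      real_cond_exp ?M ?F (indicator S) x * real_cond_exp ?M ?F (indicator T) x"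
    using 1 2 by eventually_elim simp
qed

text \<open>
  Conversely, under conditional independence the conditional probability of a positive \<open>j\<close>-th
  coordinate is a function of the coordinates in \<open>P\<close>; being also a strictly monotone function of the
  regression function, it forces the regression coefficients outside \<open>P\<close> to vanish.
\<close>

lemma cond_indepD_regression:
  fixes \<Omega> :: "real^'n^'n"
  assumes pd: "posdef \<Omega>" and w: "regression \<Omega> j N w" and P: "P \<subseteq> N"
    and ci: "cond_indep (gaussian \<Omega>) {j} N P" and k: "k \<in> N - P"
  shows "(\<Omega> *v w) $ k = 0"
proof -
  let ?M = "gaussian \<Omega>" and ?l = "\<Omega> *v w"
  define S :: "(real^'n) set" where "S = {x. 0 < x $ j}"
  let ?g = "regression_prob \<Omega> j w S"
  interpret finite_measure ?M by (rule finite_measure_gaussian[OF pd])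
  interpret P: sigma_finite_subalgebra ?M "coord_algebra P" by (rule sigma_finite_coord_subalgebra[OF pd])
  interpret N: sigma_finite_subalgebra ?M "coord_algebra N" by (rule sigma_finite_coord_subalgebra[OF pd])
  let ?q = "real_cond_exp ?M (coord_algebra P) (indicator S)"
  have S: "S \<in> sets (coord_algebra {j})"
    using borel_measurable_less[OF borel_measurable_const[of 0] measurable_coord_component[of j "{j}"]]
    unfolding S_def by simp
  have Sb [measurable]: "S \<in> sets borel" using S sets_coord_algebra by auto
  have int: "integrable ?M (indicator A :: _ \<Rightarrow> real)" if "A \<in> sets borel" for A
    using that by (intro integrable_indicator_iff[THEN iffD2] conjI) (auto simp: less_top[symmetric])
  have qP [measurable]: "?q \<in> borel_measurable (coord_algebra P)" by simp
  have qN: "?q \<in> borel_measurable (coord_algebra N)"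
    using qP sets_coord_algebra_mono[OF P] by (intro measurable_from_subalg[OF _ qP]) (simp add: subalgebra_def)
  have qi: "integrable ?M ?q" by (rule P.real_cond_exp_int) (simp add: int)
  have gN: "?g \<in> borel_measurable (coord_algebra N)" by (rule regression_prob_measurable[OF pd w Sb])
  have gi: "integrable ?M ?g" by (rule measure_gaussian_regression(2)[OF pd w S, of "{}"]) simp
  have 1: "AE x in ?M. real_cond_exp ?M (coord_algebra N) (indicator S) x = ?g x"
  proof (rule N.real_cond_exp_charact)
    fix T assume T: "T \<in> sets (coord_algebra N)"
    then have [measurable]: "T \<in> sets borel" using sets_coord_algebra by auto
    have "(\<integral>x\<in>T. indicator S x \<partial>?M) = measure ?M (S \<inter> T)"
      by (simp add: set_lebesgue_integral_def indicator_inter_arith[symmetric] Int_commute)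
    then show "(\<integral>x\<in>T. indicator S x \<partial>?M) = (\<integral>x\<in>T. ?g x \<partial>?M)"
      using measure_gaussian_regression(1)[OF pd w S T] by (simp add: set_lebesgue_integral_def mult.commute)
  qed (use gi gN int in auto)
  have 2: "AE x in ?M. real_cond_exp ?M (coord_algebra N) (indicator S) x = ?q x"
  proof (rule N.real_cond_exp_charact)
    fix T assume T: "T \<in> sets (coord_algebra N)"
    then have [measurable]: "T \<in> sets borel" using sets_coord_algebra by auto
    let ?t = "real_cond_exp ?M (coord_algebra P) (indicator T)"
    have "(\<integral>x\<in>T. indicator S x \<partial>?M) = (\<integral>x. indicator (S \<inter> T) x \<partial>?M)"
      by (auto simp: set_lebesgue_integral_def indicator_def intro!: Bochner_Integration.integral_cong)
    also have "\<dots> = (\<integral>x. real_cond_exp ?M (coord_algebra P) (indicator (S \<inter> T)) x \<partial>?M)"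
      by (rule P.real_cond_exp_int(2)[symmetric]) (simp add: int)
    also have "\<dots> = (\<integral>x. ?q x * ?t x \<partial>?M)"
      using ci S T by (intro integral_cong_AE) (auto simp: cond_indep_def)
    also have "\<dots> = (\<integral>x. ?q x * indicator T x \<partial>?M)"
      by (rule P.real_cond_exp_intg(2)) (auto intro!: integrable_real_mult_indicator qi)
    finally show "(\<integral>x\<in>T. indicator S x \<partial>?M) = (\<integral>x\<in>T. ?q x \<partial>?M)"
      by (simp add: set_lebesgue_integral_def mult.commute)
  qed (use qi qN int in auto)
  have "AE x in ?M. ?g x = ?q x" using 1 2 by eventually_elim simp
  then have "AE x in lborel. 0 < ennreal (sqrt (det \<Omega> / (2 * pi) ^ CARD('n)) *
      exp (- (x \<bullet> (\<Omega> *v x)) / 2)) \<longrightarrow> ?g x = ?q x"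
    unfolding gaussian_def by (subst (asm) AE_density) auto
  \<comment> \<open>the Gaussian density is positive, so its null sets are those of Lebesgue measure\<close>
  then have ae: "AE x in lborel. ?g x = ?q x"
    using posdef_det_pos[OF pd] by simp
  have "AE x in distr lborel borel ((+) (axis k 1)). ?g x = ?q x"
    unfolding lborel_distr_plus by (rule ae)
  then have ae': "AE x in lborel. ?g (axis k 1 + x) = ?q (axis k 1 + x)"
    by (rule AE_distrD[rotated]) simp
  have q: "?q (axis k 1 + x) = ?q x" for x
    by (rule coord_measurable_invariant[OF qP]) (use k in \<open>auto simp: axis_def\<close>)
  have "AE x in lborel. ?g (axis k 1 + x) = ?g x"
    using ae ae' unfolding q by eventually_elim simp
  moreover have nontrivial: "\<not> (AE x in (lborel :: (real^'n) measure). False)"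
    using AE_iff_measurable[of UNIV "lborel :: (real^'n) measure" "\<lambda>_. False"] by simp
  ultimately obtain x where x: "?g (axis k 1 + x) = ?g x"
    by (meson eventually_mono)
  have "k \<noteq> j" using w k by (auto simp: regression_def)
  define c where "c = x $ j - ?l \<bullet> x"
  have 3: "(axis k 1 + x) $ j - ?l \<bullet> (axis k 1 + x) = c - ?l $ k"
    using \<open>k \<noteq> j\<close> by (simp add: c_def inner_add_right inner_axis) (simp add: axis_def)
  have g: "?g y = normal_prob (w $ j) {u. 0 < (y $ j - ?l \<bullet> y) + u}" for y
    by (simp add: regression_prob_def S_def axis_def)
  have "normal_prob (w $ j) {u. 0 < (c - ?l $ k) + u} = normal_prob (w $ j) {u. 0 < c + u}"
    using x by (simp only: g 3) (simp only: c_def)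
  then show ?thesis
    using normal_prob_halfline_strict_mono[OF regression_variance(2)[OF pd w], of "c - ?l $ k" c]
      normal_prob_halfline_strict_mono[OF regression_variance(2)[OF pd w], of c "c - ?l $ k"]
    by (cases "?l $ k" "0 :: real" rule: linorder_cases) auto
qed

context transitive_perfect_dag
begin

lemma P_dag_eq_P_cone: "P_dag D = P_cone E"
proof
  show "P_cone E \<subseteq> P_dag D"
  proof
    fix \<Omega> assume \<Omega>: "\<Omega> \<in> P_cone E"
    then have pd: "posdef \<Omega>" by (simp add: P_cone_def)
    have "cond_indep (gaussian \<Omega>) {j} (nd D j) (pa D j)" for j
    proof (rule cond_indepI_regression[OF pd])
      let ?w = "elim_dir j \<Omega> /\<^sub>R cond_prec j \<Omega>"
      have w: "residual \<Omega> j ?w" by (rule P_cone_elim_dir(5)[OF \<Omega>])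
      show sub: "pa D j \<subseteq> nd D j" using arrow_asym arrow_irrefl by (auto simp: pa_eq nd_eq)
      show "(\<Omega> *v ?w) $ i = 0" if "i \<notin> insert j (pa D j)" for i
        using w that by (auto simp: residual_def pa_eq)
      then show "regression \<Omega> j (nd D j) ?w"
        using w sub by (auto simp: residual_def regression_def nd_eq)
    qed
    then show "\<Omega> \<in> P_dag D" using pd by (simp add: P_dag_def local_markov_def)
  qed
  show "P_dag D \<subseteq> P_cone E"
  proof
    fix \<Omega> assume "\<Omega> \<in> P_dag D"
    then have pd: "posdef \<Omega>" and ci: "\<And>j. cond_indep (gaussian \<Omega>) {j} (nd D j) (pa D j)"
      by (auto simp: P_dag_def local_markov_def)
    have "\<exists>w. residual \<Omega> j w" for j
    proof -
      obtain w where w: "regression \<Omega> j (nd D j) w"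
        using regression_exists[OF pd, of j "nd D j"] by (auto simp: nd_eq)
      have sub: "pa D j \<subseteq> nd D j" using arrow_asym arrow_irrefl by (auto simp: pa_eq nd_eq)
      have "(\<Omega> *v w) $ i = 0" if "i \<noteq> j" "(i, j) \<notin> D" for i
        using cond_indepD_regression[OF pd w sub ci, of i] w that
        by (cases "i \<in> nd D j") (auto simp: pa_eq regression_def)
      then have "residual \<Omega> j w" using w by (auto simp: residual_def regression_def nd_eq)
      then show ?thesis ..
    qed
    then obtain w where "\<And>j. residual \<Omega> j (w j)" by metis
    then show "\<Omega> \<in> P_cone E" by (rule residual_imp_P_cone[OF pd])
  qed
qed

end

section \<open>The completion of an incomplete matrix\<close>

context transitive_perfect_dag
begin

lemma complete_subset_clique:
  assumes "complete_set E A" shows "\<exists>C. clique E C \<and> A \<subseteq> C"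
proof -
  let ?X = "{B. complete_set E B \<and> A \<subseteq> B}"
  have "?X \<noteq> {}" using assms by blast
  then obtain C where C: "C \<in> ?X" "\<And>B. B \<in> ?X \<Longrightarrow> C \<subseteq> B \<Longrightarrow> C = B"
    using finite_has_maximal[of ?X] by (metis finite)
  have "clique E C" using C by (auto simp: clique_def)
  then show ?thesis using C by blast
qed

lemma Q_cone_posdef_family:
  assumes "\<Gamma> \<in> Q_cone E" shows "posdef (principal (insert j (pa D j)) \<Gamma>)"
proof -
  obtain C where "clique E C" "insert j (pa D j) \<subseteq> C"
    using complete_subset_clique[OF complete_closed_pa] by blast
  then show ?thesis using assms by (auto simp: Q_cone_def intro: posdef_principal_mono)
qed

text \<open>
  \<open>j\<close> and its parents form a complete set, so the regression of \<open>j\<close> on its parents involves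
  only entries prescribed by \<open>\<Gamma>\<close>. These regressions and their residual variances are the factors of a
  matrix in the cone, and its inverse agrees with \<open>\<Gamma>\<close> on the edges, by induction along the DAG.
\<close>

lemma completion_exists:
  assumes \<Gamma>: "\<Gamma> \<in> Q_cone E"
  shows "\<exists>\<Omega>\<in>P_cone E. restrict_to E (matrix_inv \<Omega>) = \<Gamma>"
proof -
  have \<Gamma>sym: "\<Gamma> $ i $ k = \<Gamma> $ k $ i" for i k
    using \<Gamma> by (auto simp: Q_cone_def transpose_def vec_eq_iff)
  have "\<exists>l. l $ j = 1 \<and> (\<forall>i. i \<notin> insert j (pa D j) \<longrightarrow> l $ i = 0) \<and>
      (\<forall>i\<in>pa D j. (\<Gamma> *v l) $ i = 0) \<and> 0 < (\<Gamma> *v l) $ j" for j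
    using posdef_principal_regression[OF Q_cone_posdef_family[OF \<Gamma>, of j]] by (auto simp: pa_def) metis
  then obtain l where l: "\<And>j. l j $ j = 1" "\<And>i j. i \<noteq> j \<Longrightarrow> (i, j) \<notin> D \<Longrightarrow> l j $ i = 0"
    "\<And>i j. (i, j) \<in> D \<Longrightarrow> (\<Gamma> *v l j) $ i = 0" "\<And>j. 0 < (\<Gamma> *v l j) $ j"
    unfolding pa_eq by (metis (mono_tags, lifting) insert_iff mem_Collect_eq)
  define v where "v j = (\<Gamma> *v l j) $ j" for j
  have v: "0 < v j" for j using l(4) by (simp add: v_def)
  have lin: "l j \<bullet> x = x $ j + (\<Sum>k\<in>pa D j. l j $ k * x $ k)" for j x
  proof -
    have "l j \<bullet> x = (\<Sum>k\<in>insert j (pa D j). l j $ k * x $ k)"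
      unfolding inner_vec_sum by (rule sum.mono_neutral_right) (use l(2) in \<open>auto simp: pa_eq\<close>)
    then show ?thesis using l(1) by (simp add: pa_def)
  qed
  have inj: "x = 0" if "\<And>j. l j \<bullet> x = 0" for x
  proof -
    have "x $ j = 0" for j
      using wf_arrow
    proof (induction j rule: wf_induct_rule)
      case (less j)
      then have "(\<Sum>k\<in>pa D j. l j $ k * x $ k) = 0" by (intro sum.neutral) (auto simp: pa_eq)
      then show ?case using lin[of j x] that[of j] by simp
    qed
    then show ?thesis by (simp add: vec_eq_iff)
  qed
  define \<Omega> :: "real^'n^'n" where "\<Omega> = (\<chi> a b. \<Sum>j\<in>UNIV. l j $ a * l j $ b / v j)"
  have \<Omega>x: "(\<Omega> *v x) $ a = (\<Sum>j\<in>UNIV. ((l j \<bullet> x) / v j) * l j $ a)" for x a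
  proof -
    have "(\<Omega> *v x) $ a = (\<Sum>b\<in>UNIV. \<Sum>j\<in>UNIV. l j $ a * l j $ b / v j * x $ b)"
      by (simp add: matrix_vector_mult_def \<Omega>_def sum_distrib_right)
    also have "\<dots> = (\<Sum>j\<in>UNIV. \<Sum>b\<in>UNIV. l j $ a * l j $ b / v j * x $ b)" by (rule sum.swap)
    finally show ?thesis
      by (simp add: inner_vec_sum sum_divide_distrib sum_distrib_left sum_distrib_right mult_ac)
  qed
  have quad: "x \<bullet> (\<Omega> *v x) = (\<Sum>j\<in>UNIV. (l j \<bullet> x)\<^sup>2 / v j)" for x
  proof -
    have "x \<bullet> (\<Omega> *v x) = (\<Sum>a\<in>UNIV. \<Sum>j\<in>UNIV. x $ a * (((l j \<bullet> x) / v j) * l j $ a))"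
      by (simp add: inner_vec_sum[of x "\<Omega> *v x"] \<Omega>x sum_distrib_left)
    also have "\<dots> = (\<Sum>j\<in>UNIV. \<Sum>a\<in>UNIV. x $ a * (((l j \<bullet> x) / v j) * l j $ a))" by (rule sum.swap)
    also have "\<dots> = (\<Sum>j\<in>UNIV. (l j \<bullet> x) / v j * (\<Sum>a\<in>UNIV. l j $ a * x $ a))"
      by (simp add: sum_distrib_left mult_ac)
    finally show ?thesis by (simp add: inner_vec_sum[symmetric] power2_eq_square)
  qed
  have pd: "posdef \<Omega>"
    unfolding posdef_def
  proof (intro conjI allI impI)
    show "transpose \<Omega> = \<Omega>" by (simp add: transpose_def \<Omega>_def vec_eq_iff mult.commute)
    fix x :: "real^'n" assume "x \<noteq> 0"
    then obtain j where j: "l j \<bullet> x \<noteq> 0" using inj by blast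
    show "0 < x \<bullet> (\<Omega> *v x)"
      unfolding quad by (rule sum_pos2[of _ j]) (use j v in \<open>auto simp: less_imp_le\<close>)
  qed
  define S where "S = matrix_inv \<Omega>"
  have Ssym: "S $ i $ k = S $ k $ i" for i k
    unfolding S_def by (rule posdef_symmetric[OF posdef_matrix_inv[OF pd]])
  have orth: "l i \<bullet> (S *v l j) = (if i = j then v j else 0)" for i j
  proof -
    define L :: "real^'n^'n" where "L = (\<chi> i a. l i $ a)"
    \<comment> \<open>coefficients of a vanishing combination of the linearly independent vectors \<open>l i\<close>\<close>
    define c :: "real^'n" where "c = (\<chi> i. (l i \<bullet> (S *v l j)) / v i - (if i = j then 1 else 0))"
    have "(L *v x) $ i = l i \<bullet> x" for x i by (simp add: L_def matrix_vector_mult_def inner_vec_sum)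
    then have "\<forall>x. L *v x = 0 \<longrightarrow> x = 0" using inj by (auto simp: vec_eq_iff)
    then have "invertible L" by (simp add: invertible_left_inverse matrix_left_invertible_ker)
    then have "invertible (transpose L)" by (simp add: transpose_invertible)
    then have ker: "transpose L *v c = 0 \<Longrightarrow> c = 0"
      using matrix_left_invertible_ker invertible_left_inverse by blast
    have "(transpose L *v c) $ a = (\<Omega> *v (S *v l j)) $ a - l j $ a" for a
    proof -
      have "(transpose L *v c) $ a = (\<Sum>i\<in>UNIV. l i $ a * c $ i)"
        by (simp add: matrix_vector_mult_def transpose_def L_def)
      also have "\<dots> = (\<Sum>i\<in>UNIV. ((l i \<bullet> (S *v l j)) / v i) * l i $ a - (if i = j then l j $ a else 0))"
        by (rule sum.cong) (auto simp: c_def algebra_simps)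
      finally show ?thesis by (simp add: \<Omega>x sum_subtractf)
    qed
    then have "transpose L *v c = 0"
      using posdef_matrix_inv_mult(2)[OF pd] by (simp add: S_def vec_eq_iff)
    then have "c $ i = 0" using ker by simp
    then show ?thesis using v[of i] by (auto simp: c_def split: if_splits)
  qed
  have off: "(S *v l j) $ i = 0" if "i \<noteq> j" "(j, i) \<notin> D" for i j
    using wf_arrow that
  proof (induction i rule: wf_induct_rule)
    case (less i)
    have "(S *v l j) $ k = 0" if "k \<in> pa D i" for k
      using that less.prems less.IH arrow_trans by (auto simp: pa_eq)
    then have "(\<Sum>k\<in>pa D i. l i $ k * (S *v l j) $ k) = 0" by (intro sum.neutral) auto
    then show ?case using lin[of i "S *v l j"] orth[of i j] less.prems by simp
  qed
  have res: "residual \<Omega> j (S *v l j)" for j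
    unfolding residual_def S_def posdef_matrix_inv_mult(2)[OF pd]
    using off l by (simp add: S_def)
  have diag: "(S *v l j) $ j = v j" for j
  proof -
    have "(\<Sum>k\<in>pa D j. l j $ k * (S *v l j) $ k) = 0"
    proof (intro sum.neutral ballI)
      fix k assume "k \<in> pa D j"
      then have "k \<noteq> j" "(j, k) \<notin> D" using arrow_asym[of k j] arrow_irrefl[of j] by (auto simp: pa_eq)
      then show "l j $ k * (S *v l j) $ k = 0" using off by simp
    qed
    then show ?thesis using lin[of j "S *v l j"] orth[of j j] by simp
  qed
  have "\<forall>i. i = j \<or> (i, j) \<in> D \<longrightarrow> S $ i $ j = \<Gamma> $ i $ j" for j
    using wf_arrow
  proof (induction j rule: wf_induct_rule)
    case (less j)
    have exp: "(A *v l j) $ i = A $ i $ j + (\<Sum>k\<in>pa D j. A $ i $ k * l j $ k)" for A :: "real^'n^'n" and i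
    proof -
      have "(A *v l j) $ i = (\<Sum>k\<in>insert j (pa D j). A $ i $ k * l j $ k)"
        by (rule matrix_vector_component_supported) (use l(2) in \<open>auto simp: pa_eq\<close>)
      then show ?thesis using l(1) by (simp add: pa_def)
    qed
    have eq: "(S *v l j) $ i = (\<Gamma> *v l j) $ i" if "i = j \<or> (i, j) \<in> D" for i
      using that diag[of j] off[of i j] l(3)[of i j] arrow_asym[of i j] by (cases "i = j") (auto simp: v_def)
    have 1: "S $ i $ j = \<Gamma> $ i $ j" if i: "(i, j) \<in> D" for i
    proof -
      have "S $ i $ k = \<Gamma> $ i $ k" if "k \<in> pa D j" for k
        using parents_adjacent[OF i, of k] that i less.IH[of k] less.IH[of i] Ssym[of i k] \<Gamma>sym[of i k]
        by (auto simp: pa_eq edge_iff)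
      then show ?thesis using exp[of S i] exp[of \<Gamma> i] eq[of i] i by simp
    qed
    have "S $ j $ k = \<Gamma> $ j $ k" if "k \<in> pa D j" for k
      using 1[of k] that Ssym[of j k] \<Gamma>sym[of j k] by (simp add: pa_eq)
    then have "S $ j $ j = \<Gamma> $ j $ j" using exp[of S j] exp[of \<Gamma> j] eq[of j] by simp
    then show ?case using 1 by auto
  qed
  then have "S $ i $ j = \<Gamma> $ i $ j" if "{i, j} \<in> E" for i j
    using that Ssym[of i j] \<Gamma>sym[of i j] by (auto simp: edge_iff)
  moreover have "\<Gamma> $ i $ j = 0" if "{i, j} \<notin> E" for i j
  proof -
    have "restrict_to E \<Gamma> $ i $ j = 0" using that by (simp add: restrict_to_def)
    then show ?thesis using \<Gamma> by (simp add: Q_cone_def)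
  qed
  ultimately have "restrict_to E S = \<Gamma>" by (simp add: restrict_to_def vec_eq_iff)
  then show ?thesis using residual_imp_P_cone[OF pd res] by (auto simp: S_def)
qed

text \<open>
  The entries on the edges determine the residual of each vertex after regression on its
  parents and the variance of that residual, and these determine the whole matrix by its expansion.
\<close>

lemma P_cone_unique_inverse:
  assumes \<Omega>: "\<Omega> \<in> P_cone E" "\<Omega>' \<in> P_cone E"
    and eq: "restrict_to E (matrix_inv \<Omega>) = restrict_to E (matrix_inv \<Omega>')"
  shows "\<Omega> = \<Omega>'"
proof -
  let ?S = "matrix_inv \<Omega>" and ?S' = "matrix_inv \<Omega>'"
  have pd: "posdef \<Omega>" "posdef \<Omega>'" using \<Omega> by (auto simp: P_cone_def)
  have eqS: "?S $ i $ k = ?S' $ i $ k" if "{i, k} \<in> E" for i k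
  proof -
    have "restrict_to E ?S $ i $ k = restrict_to E ?S' $ i $ k" using eq by simp
    then show ?thesis using that by (simp add: restrict_to_def)
  qed
  define w where "w j = elim_dir j \<Omega> /\<^sub>R cond_prec j \<Omega>" for j
  define w' where "w' j = elim_dir j \<Omega>' /\<^sub>R cond_prec j \<Omega>'" for j
  have w: "residual \<Omega> j (w j)" "residual \<Omega>' j (w' j)" for j
    unfolding w_def w'_def using P_cone_elim_dir(5) \<Omega> by auto
  have "\<Omega> *v w j = \<Omega>' *v w' j \<and> w j $ j = w' j $ j" for j
  proof -
    let ?l = "\<Omega> *v w j" and ?l' = "\<Omega>' *v w' j"
    let ?A = "insert j (pa D j)"
    have Sl: "?S *v ?l = w j" "?S' *v ?l' = w' j"
      using pd by (auto simp: posdef_matrix_inv_mult)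
    have l: "?l $ i = 0" "?l' $ i = 0" if "i \<notin> ?A" for i
      using that w[of j] by (auto simp: residual_def pa_eq)
    have S'l: "(?S' *v ?l) $ i = w j $ i" if "i \<in> ?A" for i
    proof -
      have "(?S' *v ?l) $ i = (\<Sum>k\<in>?A. ?S' $ i $ k * ?l $ k)"
        by (rule matrix_vector_component_supported) (use l in auto)
      also have "\<dots> = (\<Sum>k\<in>?A. ?S $ i $ k * ?l $ k)"
        using complete_closed_pa[of j] that eqS by (intro sum.cong) (auto simp: complete_set_def)
      also have "\<dots> = (?S *v ?l) $ i"
        by (rule matrix_vector_component_supported[symmetric]) (use l in auto)
      finally show ?thesis by (simp add: Sl)
    qed
    have wP: "w j $ i = 0" "w' j $ i = 0" if "i \<in> pa D j" for i
    proof -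
      have "i \<noteq> j" "(j, i) \<notin> D" using that arrow_asym arrow_irrefl by (auto simp: pa_eq)
      then show "w j $ i = 0" "w' j $ i = 0" using w[of j] by (auto simp: residual_def)
    qed
    let ?d = "?l - ?l'"
    have "?d $ j = 0" using w[of j] by (simp add: residual_def)
    have "?d \<bullet> (?S' *v ?d) = (\<Sum>i\<in>pa D j. ?d $ i * (?S' *v ?d) $ i)"
      unfolding inner_vec_sum
    proof (rule sum.mono_neutral_right)
      have "?d $ i = 0" if "i \<notin> pa D j" for i
        using l[of i] that \<open>?d $ j = 0\<close> by (cases "i = j") auto
      then show "\<forall>i\<in>UNIV - pa D j. ?d $ i * (?S' *v ?d) $ i = 0" by (metis DiffD2 mult_zero_left)
    qed auto
    also have "\<dots> = 0"
      using S'l wP by (intro sum.neutral) (simp add: matrix_vector_mult_diff_distrib Sl)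
    finally have "?d = 0"
      using posdef_pos[OF posdef_matrix_inv[OF pd(2)], of ?d] by fastforce
    then have "?l = ?l'" by simp
    then show ?thesis using S'l[of j] Sl(2) by simp
  qed
  then have "\<Omega> $ a $ b = \<Omega>' $ a $ b" for a b
    unfolding residual_expansion[OF pd(1) w(1)] residual_expansion[OF pd(2) w(2)] by simp
  then show ?thesis by (simp add: vec_eq_iff)
qed

lemma posdef_completion:
  assumes "\<Gamma> \<in> Q_cone E" shows "posdef (completion E \<Gamma>)"
proof -
  obtain \<Omega> where \<Omega>: "\<Omega> \<in> P_cone E" "restrict_to E (matrix_inv \<Omega>) = \<Gamma>"
    using completion_exists[OF assms] by blast
  have "completion E \<Gamma> = matrix_inv \<Omega>"
    unfolding completion_def
  proof (rule the_equality)
    show "matrix_inv \<Omega> \<in> PD_cone E \<and> restrict_to E (matrix_inv \<Omega>) = \<Gamma>"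
      using \<Omega> by (simp add: PD_cone_def)
    fix S assume "S \<in> PD_cone E \<and> restrict_to E S = \<Gamma>"
    then show "S = matrix_inv \<Omega>" using \<Omega> P_cone_unique_inverse by (auto simp: PD_cone_def)
  qed
  then show ?thesis using \<Omega> by (simp add: posdef_matrix_inv P_cone_def)
qed

section \<open>Determinants of cliques and separators\<close>

text \<open>
  Cliques and separators are ancestral, so both kinds of determinants are products of
  conditional variances; the variance of \<open>j\<close> occurs in those of the sets that contain \<open>j\<close>.
\<close>

definition H_exponent :: "'n set list \<Rightarrow> (nat \<Rightarrow> real) \<Rightarrow> (nat \<Rightarrow> real) \<Rightarrow> 'n \<Rightarrow> real" where
  "H_exponent Cs \<alpha> \<beta> j = (\<Sum>i | i < length Cs \<and> j \<in> Cs ! i. \<alpha> i) -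
     (\<Sum>i | i \<in> {1..<length Cs} \<and> j \<in> separator Cs i. \<beta> i)"

lemma H_fun_cond_var:
  assumes \<Omega>: "\<Omega> \<in> P_cone E" and Cs: "perfect_order E Cs"
  shows "H_fun Cs \<alpha> \<beta> (restrict_to E (matrix_inv \<Omega>)) =
    (\<Prod>j\<in>UNIV. cond_var D (matrix_inv \<Omega>) j powr H_exponent Cs \<alpha> \<beta> j)"
proof -
  let ?S = "matrix_inv \<Omega>" and ?R = "restrict_to E (matrix_inv \<Omega>)" and ?r = "length Cs"
  let ?d = "cond_var D ?S"
  have d: "0 < ?d j" for j
    using P_cone_elim_dir(4)[OF \<Omega>] by (simp add: cond_var_cond_prec[OF \<Omega>])
  have clique: "clique E (Cs ! i)" if "i < ?r" for i
    using Cs that by (auto simp: perfect_order_def)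
  have det: "det (principal A ?R) powr e = (\<Prod>j\<in>UNIV. ?d j powr (if j \<in> A then e else 0))"
    if A: "complete_set E A" "\<forall>j\<in>A. \<forall>i. (i, j) \<in> D \<longrightarrow> i \<in> A" for A e
  proof -
    have "principal A ?R = principal A ?S"
      using A(1) by (auto simp: principal_def restrict_to_def complete_set_def vec_eq_iff)
    then have "det (principal A ?R) powr e = (\<Prod>j\<in>A. ?d j powr e)"
      using d by (simp add: det_ancestral[OF \<Omega> A(2)] prod_powr_distrib less_imp_le)
    also have "\<dots> = (\<Prod>j\<in>UNIV. ?d j powr (if j \<in> A then e else 0))"
      by (rule prod.mono_neutral_cong_left) (use d in \<open>auto simp: less_imp_neq[symmetric]\<close>)
    finally show ?thesis .
  qed
  have C: "det (principal (Cs ! i) ?R) powr e = (\<Prod>j\<in>UNIV. ?d j powr (if j \<in> Cs ! i then e else 0))"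
    if "i < ?r" for i e
    using clique[OF that] clique_ancestral by (intro det) (auto simp: clique_def)
  have S: "det (principal (separator Cs i) ?R) powr e =
      (\<Prod>j\<in>UNIV. ?d j powr (if j \<in> separator Cs i then e else 0))" if i: "i < ?r" for i e
  proof (rule det)
    show "complete_set E (separator Cs i)"
      using clique[OF i] by (auto simp: clique_def complete_set_def separator_def)
    show "\<forall>j\<in>separator Cs i. \<forall>k. (k, j) \<in> D \<longrightarrow> k \<in> separator Cs i"
    proof (intro ballI allI impI)
      fix j k assume j: "j \<in> separator Cs i" and k: "(k, j) \<in> D"
      then obtain m where "m < i" "j \<in> Cs ! m" "j \<in> Cs ! i" by (auto simp: separator_def)
      then have "k \<in> Cs ! m" "k \<in> Cs ! i" using clique_ancestral[OF clique _ k] i by auto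
      then show "k \<in> separator Cs i" using \<open>m < i\<close> by (auto simp: separator_def)
    qed
  qed
  have swap: "(\<Prod>i\<in>I. \<Prod>j\<in>UNIV. ?d j powr (if j \<in> A i then e i else 0)) =
      (\<Prod>j\<in>UNIV. ?d j powr (\<Sum>i | i \<in> I \<and> j \<in> A i. e i))" if "finite I" for I :: "nat set" and A e
  proof -
    have "(\<Prod>i\<in>I. ?d j powr (if j \<in> A i then e i else 0)) = ?d j powr (\<Sum>i | i \<in> I \<and> j \<in> A i. e i)" for j
      using d[of j] that by (subst powr_sum[symmetric]) (auto simp: sum.inter_filter)
    then show ?thesis by (subst prod.swap) simp
  qed
  have "H_fun Cs \<alpha> \<beta> ?R = (\<Prod>i\<in>{..<?r}. \<Prod>j\<in>UNIV. ?d j powr (if j \<in> Cs ! i then \<alpha> i else 0)) /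
      (\<Prod>i\<in>{1..<?r}. \<Prod>j\<in>UNIV. ?d j powr (if j \<in> separator Cs i then \<beta> i else 0))"
    unfolding H_fun_def by (intro arg_cong2[of _ _ _ _ "(/)"] prod.cong) (auto simp: C S)
  also have "\<dots> = (\<Prod>j\<in>UNIV. ?d j powr H_exponent Cs \<alpha> \<beta> j)"
    by (simp only: swap finite_lessThan finite_atLeastLessThan prod_dividef[symmetric] powr_diff
        H_exponent_def lessThan_iff)
  finally show ?thesis .
qed

end

section \<open>Measurability\<close>

lemma measurable_vecI:
  fixes f :: "'b \<Rightarrow> ('a::euclidean_space)^'n"
  assumes "\<And>i. (\<lambda>x. f x $ i) \<in> borel_measurable M"
  shows "f \<in> borel_measurable M"
proof (subst borel_measurable_euclidean_space, rule ballI)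
  fix b :: "'a^'n" assume "b \<in> Basis"
  then obtain i u where b: "b = axis i u" "u \<in> Basis" by (auto simp: Basis_vec_def)
  show "(\<lambda>x. f x \<bullet> b) \<in> borel_measurable M"
    unfolding b(1) inner_axis by (intro borel_measurable_inner assms) simp
qed

lemma measurable_matrix_component [measurable]:
  "(\<lambda>A :: real^'n^'m. A $ i $ j) \<in> borel_measurable borel"
  by (intro borel_measurable_continuous_onI continuous_intros)

lemma measurable_det:
  fixes f :: "'b \<Rightarrow> real^'n^'n"
  assumes [measurable]: "\<And>i j. (\<lambda>x. f x $ i $ j) \<in> borel_measurable M"
  shows "(\<lambda>x. det (f x)) \<in> borel_measurable M"
  unfolding det_def by measurable

lemma closed_quadratic_bound: "closed {A :: real^'n^'n. \<forall>x. c * (x \<bullet> x) \<le> x \<bullet> (A *v x)}"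
proof -
  have "continuous_on UNIV (\<lambda>A :: real^'n^'n. x \<bullet> (A *v x))" for x
    unfolding inner_vec_def matrix_vector_mult_def by (auto intro!: continuous_intros)
  then show ?thesis by (intro closed_Collect_all closed_Collect_le continuous_on_const) auto
qed

text \<open>
  By compactness a positive definite form has a lower bound $|x|^2 / (n + 1)$ for some natural \<open>n\<close>; for
  each \<open>n\<close> such a bound is a closed condition.
\<close>

lemma P_cone_borel [measurable]:
  fixes E :: "'n::finite set set"
  shows "P_cone E \<in> sets borel"
proof -
  have *: "(\<forall>x :: real^'n. x \<noteq> 0 \<longrightarrow> 0 < x \<bullet> (A *v x)) \<longleftrightarrow> (\<exists>n::nat. \<forall>x. inverse (real (Suc n)) * (x \<bullet> x) \<le> x \<bullet> (A *v x))"
    if "transpose A = A" for A :: "real^'n^'n"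
  proof
    assume "\<forall>x :: real^'n. x \<noteq> 0 \<longrightarrow> 0 < x \<bullet> (A *v x)"
    then have "posdef A" using that by (simp add: posdef_def)
    then obtain m where m: "0 < m" "\<And>x. m * (x \<bullet> x) \<le> x \<bullet> (A *v x)" using posdef_lower_bound by blast
    obtain n where n: "inverse (real (Suc n)) < m" using reals_Archimedean[OF m(1)] by blast
    have "inverse (real (Suc n)) * (x \<bullet> x) \<le> x \<bullet> (A *v x)" for x
      using m(2)[of x] n mult_right_mono[of "inverse (real (Suc n))" m "x \<bullet> x"] by simp
    then show "\<exists>n::nat. \<forall>x. inverse (real (Suc n)) * (x \<bullet> x) \<le> x \<bullet> (A *v x)" by blast
  next
    assume "\<exists>n::nat. \<forall>x. inverse (real (Suc n)) * (x \<bullet> x) \<le> x \<bullet> (A *v x)"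
    then obtain n :: nat where n: "\<And>x. inverse (real (Suc n)) * (x \<bullet> x) \<le> x \<bullet> (A *v x)" by blast
    show "\<forall>x :: real^'n. x \<noteq> 0 \<longrightarrow> 0 < x \<bullet> (A *v x)"
    proof (intro allI impI)
      fix x :: "real^'n" assume "x \<noteq> 0"
      then have "0 < inverse (real (Suc n)) * (x \<bullet> x)" by simp
      then show "0 < x \<bullet> (A *v x)" using n[of x] by linarith
    qed
  qed
  have "P_cone E = (\<Union>n::nat. {A. \<forall>x. inverse (real (Suc n)) * (x \<bullet> x) \<le> x \<bullet> (A *v x)}) \<inter>
      {A. \<forall>i j. A $ i $ j = A $ j $ i} \<inter> {A. \<forall>i j. {i, j} \<notin> E \<longrightarrow> A $ i $ j = 0}" (is "_ = ?R")
  proof (rule set_eqI)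
    fix A :: "real^'n^'n"
    have "transpose A = A \<longleftrightarrow> (\<forall>i j. A $ i $ j = A $ j $ i)"
      by (auto simp: transpose_def vec_eq_iff)
    then show "A \<in> P_cone E \<longleftrightarrow> A \<in> ?R" using *[of A] by (auto simp: P_cone_def posdef_def)
  qed
  moreover have "?R \<in> sets borel"
  proof (intro sets.Int sets.countable_UN image_subsetI borel_closed closed_quadratic_bound)
    show "closed {A :: real^'n^'n. \<forall>i j. A $ i $ j = A $ j $ i}"
      by (intro closed_Collect_all closed_Collect_eq continuous_intros)
    show "closed {A :: real^'n^'n. \<forall>i j. {i, j} \<notin> E \<longrightarrow> A $ i $ j = 0}"
      by (intro closed_Collect_all closed_Collect_imp open_Collect_const closed_Collect_eq continuous_intros)
  qed
  ultimately show ?thesis by simp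
qed

definition sym_matrix :: "'n::finite set set \<Rightarrow> ('n set \<Rightarrow> real) \<Rightarrow> real^'n^'n" where
  "sym_matrix E \<theta> = (\<chi> i j. if {i, j} \<in> E then \<theta> {i, j} else 0)"

abbreviation edge_measure :: "'n::finite set set \<Rightarrow> ('n set \<Rightarrow> real) measure" where
  "edge_measure E \<equiv> \<Pi>\<^sub>M e\<in>E. lborel"

lemma lebesgue_sym_eq: "lebesgue_sym E = distr (edge_measure E) borel (sym_matrix E)"
  by (simp add: lebesgue_sym_def sym_matrix_def[abs_def])

lemma measurable_sym_matrix [measurable]: "sym_matrix E \<in> borel_measurable (edge_measure E)"
proof (rule measurable_vecI, rule measurable_vecI)
  fix i j
  show "(\<lambda>\<theta>. sym_matrix E \<theta> $ i $ j) \<in> borel_measurable (edge_measure E)"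
    by (cases "{i, j} \<in> E") (auto simp: sym_matrix_def)
qed

section \<open>An affine change of variables for product Lebesgue measure\<close>

lemma nn_integral_PiM_affine_single:
  fixes f :: "('i \<Rightarrow> real) \<Rightarrow> ennreal"
  assumes I: "finite I" "e \<in> I" and c: "0 < c"
    and f[measurable]: "f \<in> borel_measurable (\<Pi>\<^sub>M i\<in>I. lborel)"
    and r[measurable]: "r \<in> borel_measurable (\<Pi>\<^sub>M i\<in>I. lborel)"
    and indep: "\<And>\<theta> t. r (\<theta>(e := t)) = r \<theta>"
  shows "(\<integral>\<^sup>+\<theta>. f \<theta> \<partial>(\<Pi>\<^sub>M i\<in>I. lborel)) =
    ennreal c * (\<integral>\<^sup>+\<theta>. f (\<theta>(e := c * \<theta> e + r \<theta>)) \<partial>(\<Pi>\<^sub>M i\<in>I. lborel))"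
proof -
  interpret product_sigma_finite "\<lambda>_ :: 'i. lborel :: real measure" by standard
  define I' where "I' = I - {e}"
  have I': "finite I'" "e \<notin> I'" "I = insert e I'" using I by (auto simp: I'_def)
  let ?P = "\<Pi>\<^sub>M i\<in>I'. (lborel :: real measure)"
  have upd [measurable]: "(\<lambda>\<theta>. \<theta>(e := c * \<theta> e + r \<theta>)) \<in> measurable (\<Pi>\<^sub>M i\<in>I. lborel) (\<Pi>\<^sub>M i\<in>I. lborel)"
    using I by (intro measurable_fun_upd[where J = I]) auto
  have "(\<integral>\<^sup>+\<theta>. f \<theta> \<partial>(\<Pi>\<^sub>M i\<in>I. lborel)) = (\<integral>\<^sup>+x. \<integral>\<^sup>+y. f (x(e := y)) \<partial>lborel \<partial>?P)"
    unfolding I'(3) by (rule product_nn_integral_insert[OF I'(1,2)]) (use f I'(3) in simp)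
  also have "\<dots> = (\<integral>\<^sup>+x. ennreal c * (\<integral>\<^sup>+y. f (x(e := c * y + r x)) \<partial>lborel) \<partial>?P)"
  proof (rule nn_integral_cong)
    fix x assume "x \<in> space ?P"
    then have "(\<lambda>y. x(e := y)) \<in> measurable lborel (\<Pi>\<^sub>M i\<in>I. lborel)"
      unfolding I'(3) by (rule measurable_component_update) (rule I')
    then have "(\<lambda>y. f (x(e := y))) \<in> borel_measurable lborel"
      by (rule measurable_compose) (rule f)
    then show "(\<integral>\<^sup>+y. f (x(e := y)) \<partial>lborel) = ennreal c * (\<integral>\<^sup>+y. f (x(e := c * y + r x)) \<partial>lborel)"
      using nn_integral_real_affine[of "\<lambda>y. f (x(e := y))" c "r x"] c by (simp add: add.commute)
  qed
  also have "\<dots> = (\<integral>\<^sup>+x. \<integral>\<^sup>+y. ennreal c * f ((x(e := y))(e := c * (x(e := y)) e + r (x(e := y)))) \<partial>lborel \<partial>?P)"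
  proof (rule nn_integral_cong)
    fix x assume "x \<in> space ?P"
    then have m: "(\<lambda>y. x(e := y)) \<in> measurable lborel (\<Pi>\<^sub>M i\<in>I. lborel)"
      unfolding I'(3) by (rule measurable_component_update) (rule I')
    have "(\<lambda>y. x(e := c * y + r x)) = (\<lambda>y. x(e := y)) \<circ> (\<lambda>y. c * y + r x)" by auto
    moreover have "(\<lambda>y. c * y + r x) \<in> measurable lborel lborel" by simp
    ultimately have "(\<lambda>y. x(e := c * y + r x)) \<in> measurable lborel (\<Pi>\<^sub>M i\<in>I. lborel)"
      using measurable_comp m by metis
    then have "(\<lambda>y. f (x(e := c * y + r x))) \<in> borel_measurable lborel"
      by (rule measurable_compose) (rule f)
    then show "ennreal c * (\<integral>\<^sup>+y. f (x(e := c * y + r x)) \<partial>lborel) =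
        (\<integral>\<^sup>+y. ennreal c * f ((x(e := y))(e := c * (x(e := y)) e + r (x(e := y)))) \<partial>lborel)"
      by (simp add: indep nn_integral_cmult)
  qed
  also have "\<dots> = (\<integral>\<^sup>+\<theta>. ennreal c * f (\<theta>(e := c * \<theta> e + r \<theta>)) \<partial>(\<Pi>\<^sub>M i\<in>I. lborel))"
  proof -
    have "(\<lambda>\<theta>. ennreal c * f (\<theta>(e := c * \<theta> e + r \<theta>))) \<in> borel_measurable (\<Pi>\<^sub>M i\<in>I. lborel)"
      by (intro borel_measurable_times_ennreal measurable_compose[OF upd f] borel_measurable_const)
    then show ?thesis unfolding I'(3) by (rule product_nn_integral_insert[OF I'(1,2), symmetric])
  qed
  also have "\<dots> = ennreal c * (\<integral>\<^sup>+\<theta>. f (\<theta>(e := c * \<theta> e + r \<theta>)) \<partial>(\<Pi>\<^sub>M i\<in>I. lborel))"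
    by (rule nn_integral_cmult) (rule measurable_compose[OF upd f])
  finally show ?thesis .
qed

definition affine_on :: "'i set \<Rightarrow> ('i \<Rightarrow> real) \<Rightarrow> ('i \<Rightarrow> ('i \<Rightarrow> real) \<Rightarrow> real) \<Rightarrow> ('i \<Rightarrow> real) \<Rightarrow> 'i \<Rightarrow> real" where
  "affine_on J c r \<theta> = (\<lambda>i. if i \<in> J then c i * \<theta> i + r i \<theta> else \<theta> i)"

lemma measurable_affine_on:
  assumes "J \<subseteq> I" "\<And>i. i \<in> J \<Longrightarrow> r i \<in> borel_measurable (\<Pi>\<^sub>M i\<in>I. lborel)"
  shows "affine_on J c r \<in> measurable (\<Pi>\<^sub>M i\<in>I. lborel) (\<Pi>\<^sub>M i\<in>I. (lborel :: real measure))"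
proof (rule measurable_PiM_single')
  fix i assume i: "i \<in> I"
  show "(\<lambda>\<theta>. affine_on J c r \<theta> i) \<in> measurable (\<Pi>\<^sub>M i\<in>I. lborel) lborel"
  proof (cases "i \<in> J")
    case True
    note [measurable] = assms(2)[OF True]
    show ?thesis using True i by (simp add: affine_on_def)
  next
    case False
    then show ?thesis using i by (simp add: affine_on_def)
  qed
next
  show "affine_on J c r \<in> space (\<Pi>\<^sub>M i\<in>I. lborel) \<rightarrow> (\<Pi>\<^sub>E i\<in>I. space (lborel :: real measure))"
    using assms(1) by (auto simp: affine_on_def space_PiM PiE_iff extensional_def)
qed

text \<open>
  The shifts do not depend on any of the coordinates in \<open>J\<close>, so the map is a composition
  of one-coordinate affine maps and its Jacobian is the product of the slopes.
\<close>

lemma nn_integral_PiM_affine: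
  fixes f :: "('i \<Rightarrow> real) \<Rightarrow> ennreal"
  assumes I: "finite I" "J \<subseteq> I" and c: "\<And>e. e \<in> J \<Longrightarrow> 0 < c e"
    and f: "f \<in> borel_measurable (\<Pi>\<^sub>M i\<in>I. lborel)"
    and r: "\<And>e. e \<in> J \<Longrightarrow> r e \<in> borel_measurable (\<Pi>\<^sub>M i\<in>I. lborel)"
    and indep: "\<And>e e' \<theta> t. e \<in> J \<Longrightarrow> e' \<in> J \<Longrightarrow> r e (\<theta>(e' := t)) = r e \<theta>"
  shows "(\<integral>\<^sup>+\<theta>. f \<theta> \<partial>(\<Pi>\<^sub>M i\<in>I. lborel)) =
    (\<Prod>e\<in>J. ennreal (c e)) * (\<integral>\<^sup>+\<theta>. f (affine_on J c r \<theta>) \<partial>(\<Pi>\<^sub>M i\<in>I. lborel))"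
proof -
  have "finite J" using I finite_subset by blast
  then show ?thesis using I(2) c r indep
  proof (induction J rule: finite_induct)
    case empty
    then show ?case by (simp add: affine_on_def)
  next
    case (insert e J)
    have eq: "affine_on J c r (\<theta>(e := c e * \<theta> e + r e \<theta>)) = affine_on (insert e J) c r \<theta>" for \<theta>
    proof (rule ext)
      fix i
      have "r i (\<theta>(e := c e * \<theta> e + r e \<theta>)) = r i \<theta>" if "i \<in> J"
        by (rule insert.prems(4)) (use that in auto)
      then show "affine_on J c r (\<theta>(e := c e * \<theta> e + r e \<theta>)) i = affine_on (insert e J) c r \<theta> i"
        using insert.hyps(2) by (simp add: affine_on_def)
    qed
    have m: "affine_on J c r \<in> measurable (\<Pi>\<^sub>M i\<in>I. lborel) (\<Pi>\<^sub>M i\<in>I. lborel)"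
      by (rule measurable_affine_on) (use insert.prems in auto)
    have "(\<integral>\<^sup>+\<theta>. f \<theta> \<partial>(\<Pi>\<^sub>M i\<in>I. lborel)) =
        (\<Prod>e\<in>J. ennreal (c e)) * (\<integral>\<^sup>+\<theta>. f (affine_on J c r \<theta>) \<partial>(\<Pi>\<^sub>M i\<in>I. lborel))"
      by (rule insert.IH) (use insert.prems in auto)
    also have "(\<integral>\<^sup>+\<theta>. f (affine_on J c r \<theta>) \<partial>(\<Pi>\<^sub>M i\<in>I. lborel)) =
        ennreal (c e) * (\<integral>\<^sup>+\<theta>. f (affine_on J c r (\<theta>(e := c e * \<theta> e + r e \<theta>))) \<partial>(\<Pi>\<^sub>M i\<in>I. lborel))"
    proof (rule nn_integral_PiM_affine_single)
      show "r e (\<theta>(e := t)) = r e \<theta>" for \<theta> t by (rule insert.prems(4)) auto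
    qed (use I insert.prems(1-3) measurable_compose[OF m f] in auto)
    finally show ?case unfolding eq by (simp only: prod.insert[OF insert.hyps] mult_ac)
  qed
qed

text \<open>The cone contains all matrices whose entries on the edges are close to those of the identity.\<close>

lemma P_cone_positive_measure:
  fixes E :: "'n::finite set set"
  assumes loops: "\<And>i. {i} \<in> E"
  shows "\<not> (AE \<theta> in edge_measure E. sym_matrix E \<theta> \<notin> P_cone E)"
proof
  assume ae: "AE \<theta> in edge_measure E. sym_matrix E \<theta> \<notin> P_cone E"
  interpret product_sigma_finite "\<lambda>_ :: 'n set. lborel :: real measure" by standard
  \<comment> \<open>a perturbation of all entries by at most \<open>d\<close> changes the quadratic form by at most half of \<open>x \<bullet> x\<close>\<close>
  define d :: real where "d = 1 / (2 * (real CARD('n))\<^sup>2)"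
  have d: "0 < d" by (simp add: d_def)
  define m :: "'n set \<Rightarrow> real" where "m e = (if card e = 1 then 1 else 0)" for e
  let ?B = "\<Pi>\<^sub>E e\<in>E. {m e - d<..<m e + d}"
  have "sym_matrix E \<theta> \<in> P_cone E" if \<theta>: "\<theta> \<in> ?B" for \<theta>
  proof -
    let ?A = "sym_matrix E \<theta>"
    have close: "\<bar>?A $ i $ j - (mat 1 :: real^'n^'n) $ i $ j\<bar> \<le> d" for i j
    proof (cases "{i, j} \<in> E")
      case True
      then have "m {i, j} - d < \<theta> {i, j} \<and> \<theta> {i, j} < m {i, j} + d" using \<theta> by (auto simp: PiE_iff)
      moreover have "m {i, j} = (mat 1 :: real^'n^'n) $ i $ j" by (simp add: m_def mat_def card_insert_if)
      ultimately show ?thesis using True by (simp add: sym_matrix_def abs_le_iff)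
    next
      case False
      then have "i \<noteq> j" using loops by auto
      then show ?thesis using False d by (simp add: sym_matrix_def mat_def)
    qed
    have "0 < x \<bullet> (?A *v x)" if "x \<noteq> 0" for x
    proof -
      let ?R = "?A - mat 1"
      have xx: "0 < x \<bullet> x" using that by simp
      have "\<bar>x \<bullet> (?R *v x)\<bar> \<le> (\<Sum>i\<in>UNIV. \<Sum>j\<in>UNIV. \<bar>x $ i * (?R $ i $ j * x $ j)\<bar>)"
        unfolding inner_vec_sum matrix_vector_mult_def vec_lambda_beta sum_distrib_left
        by (intro order.trans[OF sum_abs] sum_mono sum_abs)
      also have "\<dots> \<le> (\<Sum>i\<in>(UNIV::'n set). \<Sum>j\<in>(UNIV::'n set). d * (x \<bullet> x))"
      proof (intro sum_mono)
        fix i j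
        have "\<bar>x $ i * (?R $ i $ j * x $ j)\<bar> = \<bar>?R $ i $ j\<bar> * (\<bar>x $ i\<bar> * \<bar>x $ j\<bar>)"
          by (simp add: abs_mult mult_ac)
        also have "\<dots> \<le> d * (norm x * norm x)"
          using close[of i j] d by (intro mult_mono component_le_norm_cart) auto
        finally show "\<bar>x $ i * (?R $ i $ j * x $ j)\<bar> \<le> d * (x \<bullet> x)"
          by (simp add: dot_square_norm power2_eq_square)
      qed
      also have "\<dots> = (x \<bullet> x) / 2" by (simp add: d_def power2_eq_square)
      finally have "\<bar>x \<bullet> (?R *v x)\<bar> < x \<bullet> x" using xx by linarith
      moreover have "?A *v x = x + ?R *v x" by (simp add: matrix_vector_mult_diff_rdistrib)
      ultimately show ?thesis by (simp add: inner_add_right)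
    qed
    moreover have "transpose ?A = ?A"
      by (simp add: transpose_def sym_matrix_def vec_eq_iff insert_commute)
    ultimately show ?thesis by (simp add: P_cone_def posdef_def) (simp add: sym_matrix_def)
  qed
  then have "AE \<theta> in edge_measure E. \<theta> \<notin> ?B" using ae by (auto elim!: eventually_mono)
  moreover have B: "?B \<in> sets (edge_measure E)" by (rule sets_PiM_I_finite) auto
  moreover have "{\<theta> \<in> space (edge_measure E). \<not> \<theta> \<notin> ?B} = ?B"
    using sets.sets_into_space[OF B] by auto
  ultimately have "emeasure (edge_measure E) ?B = 0"
    using AE_iff_measurable[OF B, of "\<lambda>\<theta>. \<theta> \<notin> ?B"] by simp
  moreover have "emeasure (edge_measure E) ?B = (\<Prod>e\<in>E. emeasure lborel {m e - d<..<m e + d})"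
    by (rule emeasure_PiM) auto
  ultimately show False using d by (simp add: prod_zero_iff)
qed

context transitive_perfect_dag
begin

lemma measurable_elim_dir [measurable]:
  "(\<lambda>\<Omega>. elim_dir j \<Omega> $ k) \<in> borel_measurable borel"
proof -
  have "(\<lambda>\<Omega>. principal {i. (j, i) \<in> D} \<Omega> $ a $ b) \<in> borel_measurable borel" for a b
    unfolding principal_def by (cases "(j, a) \<in> D \<and> (j, b) \<in> D"; simp)
  note [measurable] = this
  have "(\<lambda>\<Omega>. det (\<chi> a b. if b = k then (if (j, a) \<in> D then - \<Omega> $ a $ j else 0)
                 else principal {i. (j, i) \<in> D} \<Omega> $ a $ b)) \<in> borel_measurable borel"
    by (rule measurable_det) (auto split: if_split)
  moreover have "(\<lambda>\<Omega>. det (principal {i. (j, i) \<in> D} \<Omega>)) \<in> borel_measurable borel"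
    by (rule measurable_det) measurable
  ultimately show ?thesis unfolding elim_dir_def by (cases "k = j") auto
qed

lemma measurable_elim_image [measurable]:
  "(\<lambda>\<Omega>. (\<Omega> *v elim_dir j \<Omega>) $ k) \<in> borel_measurable borel"
  unfolding matrix_vector_mult_def vec_lambda_beta by measurable

lemma measurable_cond_prec [measurable]: "cond_prec j \<in> borel_measurable borel"
  unfolding cond_prec_def[abs_def] by measurable

section \<open>Rescaling one conditional precision\<close>

text \<open>
  For \<open>\<Omega>\<close> in the cone, the congruence by the linear map that multiplies \<open>u\<close> by \<open>\<tau>\<close> and fixes the vectors
  with vanishing \<open>j\<close>-th coordinate, where \<open>u\<close> is the elimination direction of \<open>j\<close>. It
  multiplies the conditional precision of \<open>j\<close> by \<open>\<tau>\<^sup>2\<close>, keeps all others, and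
  moves only the entries of \<open>\<Omega>\<close> between \<open>j\<close> and \<open>j\<close> or a parent of \<open>j\<close>: \<open>\<Omega> *v u\<close> vanishes
  elsewhere. As the conditional precision tends to 0, this is the scale on which the entries between \<open>j\<close>
  and its parents may vary without making the trace in the exponential large.
\<close>

definition rescale :: "'n \<Rightarrow> real \<Rightarrow> real^'n^'n \<Rightarrow> real^'n^'n" where
  "rescale j \<tau> \<Omega> = (\<chi> a b. \<Omega> $ a $ b + (\<tau> - 1) * ((if b = j then (\<Omega> *v elim_dir j \<Omega>) $ a else 0) +
     (if a = j then (\<Omega> *v elim_dir j \<Omega>) $ b else 0)) + (if a = j \<and> b = j then (\<tau> - 1)\<^sup>2 * cond_prec j \<Omega> else 0))"

text \<open>
  The residual vectors of the rescaled matrix are the preimages of those of \<open>\<Omega>\<close> under the linear map, the one at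
  \<open>j\<close> divided by \<open>\<tau>\<close> once more for normalization. They have the required supports because the residuals
  at the other vertices are orthogonal to \<open>u\<close>.
\<close>

lemma rescale:
  assumes \<Omega>: "\<Omega> \<in> P_cone E" and \<tau>: "0 < \<tau>"
  shows "rescale j \<tau> \<Omega> \<in> P_cone E" "cond_prec j (rescale j \<tau> \<Omega>) = \<tau>\<^sup>2 * cond_prec j \<Omega>"
    "\<And>k. k \<noteq> j \<Longrightarrow> cond_prec k (rescale j \<tau> \<Omega>) = cond_prec k \<Omega>"
proof -
  define u where "u = elim_dir j \<Omega>"
  define n where "n = \<Omega> *v u"
  define p where "p = cond_prec j \<Omega>"
  let ?R = "rescale j \<tau> \<Omega>" and ?s = "\<tau> - 1"
  have pd: "posdef \<Omega>" using \<Omega> by (simp add: P_cone_def)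
  note el = P_cone_elim_dir[OF \<Omega>, where j = j, folded u_def p_def, folded n_def]
  have p: "0 < p" and uj: "u $ j = 1" using el by auto
  have nj: "n $ j = p" by (simp add: n_def p_def cond_prec_def u_def)
  have un: "u \<bullet> n = p"
    using residual_orthogonal[OF pd el(5,5)] p uj
    by (simp add: matrix_vector_mult_scaleR n_def[symmetric] inner_commute field_simps)
  define w where "w k = elim_dir k \<Omega> /\<^sub>R cond_prec k \<Omega>" for k
  have w: "residual \<Omega> k (w k)" for k unfolding w_def by (rule P_cone_elim_dir(5)[OF \<Omega>])
  have uw: "u \<bullet> (\<Omega> *v w k) = 0" if "k \<noteq> j" for k
    using residual_orthogonal[OF pd w el(5), of k] that p by (simp add: inner_commute)
  \<comment> \<open>\<open>z\<close> is the image of \<open>x\<close> under the linear map; the right-hand side applies \<open>\<Omega>\<close> and then the transposed map\<close>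
  have act: "?R *v x = \<Omega> *v z + (?s * (u \<bullet> (\<Omega> *v z))) *\<^sub>R axis j 1" if z: "z = x + (?s * x $ j) *\<^sub>R u" for x z
  proof -
    have nz: "u \<bullet> (\<Omega> *v z) = n \<bullet> x + ?s * x $ j * p"
      using posdef_inner_commute[OF pd, of u z] un
      by (simp add: n_def[symmetric] z inner_add_right inner_commute)
    have Rx: "(?R *v x) $ a = (\<Omega> *v x) $ a + ?s * (x $ j * n $ a) +
        (if a = j then ?s * (n \<bullet> x) + ?s\<^sup>2 * p * x $ j else 0)" for a
    proof -
      have "(?R *v x) $ a = (\<Sum>b\<in>UNIV. \<Omega> $ a $ b * x $ b + (if b = j then ?s * n $ a * x $ b else 0) +
          (if a = j then ?s * (n $ b * x $ b) else 0) + (if b = j then (if a = j then ?s\<^sup>2 * p * x $ b else 0) else 0))"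
        unfolding matrix_vector_mult_def vec_lambda_beta
        by (rule sum.cong) (auto simp: rescale_def u_def[symmetric] n_def[symmetric] p_def[symmetric] algebra_simps)
      then show ?thesis
        by (simp add: sum.distrib matrix_vector_mult_def inner_vec_sum sum_distrib_left algebra_simps)
    qed
    have "\<Omega> *v z = \<Omega> *v x + (?s * x $ j) *\<^sub>R n"
      by (simp add: z n_def matrix_vector_right_distrib matrix_vector_mult_scaleR)
    then have "(\<Omega> *v z) $ a = (\<Omega> *v x) $ a + ?s * x $ j * n $ a" for a by simp
    then have "(?R *v x) $ a = (\<Omega> *v z + (?s * (u \<bullet> (\<Omega> *v z))) *\<^sub>R axis j 1) $ a" for a
      unfolding nz by (cases "a = j") (simp_all add: Rx axis_def power2_eq_square distrib_left mult_ac)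
    then show ?thesis by (simp add: vec_eq_iff)
  qed
  have pdR: "posdef ?R"
    unfolding posdef_def
  proof (intro conjI allI impI)
    show "transpose ?R = ?R"
      using posdef_symmetric[OF pd] by (auto simp: rescale_def transpose_def vec_eq_iff add.commute)
    fix x :: "real^'n" assume x: "x \<noteq> 0"
    define z where "z = x + (?s * x $ j) *\<^sub>R u"
    have "z \<noteq> 0"
    proof
      assume z0: "z = 0"
      then have "z $ j = 0" by simp
      then have "x $ j = 0" using uj \<tau> by (simp add: z_def algebra_simps)
      then show False using z0 x by (simp add: z_def)
    qed
    then have "0 < z \<bullet> (\<Omega> *v z)" by (rule posdef_pos[OF pd])
    also have "z \<bullet> (\<Omega> *v z) = x \<bullet> (?R *v x)"
      by (simp add: act[OF z_def] z_def inner_add_left inner_add_right inner_axis inner_commute algebra_simps)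
    finally show "0 < x \<bullet> (?R *v x)" .
  qed
  have res: "residual ?R k (w k + ((1 / \<tau> - 1) * w k $ j) *\<^sub>R u)"
    and val: "(w k + ((1 / \<tau> - 1) * w k $ j) *\<^sub>R u) $ k = w k $ k" if k: "k \<noteq> j" for k
  proof -
    let ?x = "w k + ((1 / \<tau> - 1) * w k $ j) *\<^sub>R u"
    have "?x + (?s * ?x $ j) *\<^sub>R u = w k"
      using uj \<tau> by (simp add: vec_eq_iff field_simps)
    then have Rx: "?R *v ?x = \<Omega> *v w k" using act[of "w k" ?x] uw[OF k] by simp
    have wj: "(k, j) \<in> D" if "w k $ j \<noteq> 0" using that k w[of k] by (auto simp: residual_def)
    have ui: "i = j \<or> (j, i) \<in> D" if "u $ i \<noteq> 0" for i using that el(2) by blast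
    have "w k $ j * u $ i = 0" if "i = k \<or> (k, i) \<notin> D" for i
      using wj ui[of i] that arrow_trans[of k j i] arrow_asym[of k j] k by auto
    then show "residual ?R k ?x" "?x $ k = w k $ k"
      using w[of k] unfolding residual_def Rx by auto
  qed
  have resj: "residual ?R j (w j /\<^sub>R \<tau>\<^sup>2)"
  proof -
    have wj: "w j = u /\<^sub>R p" by (simp add: w_def u_def p_def)
    have "?R *v u = \<tau> *\<^sub>R n + (?s * (\<tau> * p)) *\<^sub>R axis j 1"
    proof -
      have z: "\<tau> *\<^sub>R u = u + (?s * u $ j) *\<^sub>R u" using uj by (simp add: algebra_simps)
      show ?thesis using act[OF z] un by (simp add: matrix_vector_mult_scaleR n_def[symmetric])
    qed
    then have "(?R *v u) $ i = \<tau> * n $ i + (if i = j then ?s * (\<tau> * p) else 0)" for i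
      by (simp add: axis_def)
    then show ?thesis
      using el(2,3) nj p \<tau>
      by (auto simp: residual_def wj matrix_vector_mult_scaleR power2_eq_square field_simps)
  qed
  define w' where "w' k = (if k = j then w j /\<^sub>R \<tau>\<^sup>2 else w k + ((1 / \<tau> - 1) * w k $ j) *\<^sub>R u)" for k
  have w': "residual ?R k (w' k)" for k using res resj by (simp add: w'_def)
  show R: "?R \<in> P_cone E" by (rule residual_imp_P_cone[OF pdR w'])
  have 1: "cond_prec k ?R = 1 / w' k $ k" for k
    using cond_var_cond_prec[OF R, of k] cond_var_residual[OF pdR w'[of k]] by (simp add: field_simps)
  have 2: "cond_prec k \<Omega> = 1 / w k $ k" for k
    using P_cone_elim_dir(1)[OF \<Omega>, of k] by (simp add: w_def inverse_eq_divide)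
  show "cond_prec j ?R = \<tau>\<^sup>2 * cond_prec j \<Omega>" by (simp add: 1 2 w'_def divide_inverse)
  show "cond_prec k ?R = cond_prec k \<Omega>" if "k \<noteq> j" for k
    using val[OF that] that by (simp add: 1 2 w'_def)
qed

lemma elim_dir_cong:
  assumes "\<And>a b. (j, a) \<in> D \<Longrightarrow> b = j \<or> (j, b) \<in> D \<Longrightarrow> \<Omega> $ a $ b = \<Omega>' $ a $ b"
  shows "elim_dir j \<Omega> = elim_dir j \<Omega>'"
proof -
  have P: "principal {i. (j, i) \<in> D} \<Omega> = principal {i. (j, i) \<in> D} \<Omega>'"
    using assms by (auto simp: principal_def vec_eq_iff)
  have Q: "(if (j, a) \<in> D then - \<Omega> $ a $ j else 0) = (if (j, a) \<in> D then - \<Omega>' $ a $ j else 0)" for a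
    using assms by simp
  show ?thesis unfolding elim_dir_def P Q ..
qed

text \<open>
  In the coordinates of the entries on the edges, rescaling is affine in the entries
  that it moves, with coefficients that depend on the other entries only.
\<close>

definition other_end :: "'n \<Rightarrow> 'n set \<Rightarrow> 'n" where
  "other_end j e = (if e = {j} then j else the_elem (e - {j}))"

text \<open>
  With \<open>u\<close> the elimination direction of \<open>j\<close> and \<open>i\<close> the other end of \<open>e\<close>, the component \<open>i\<close> of \<open>\<Omega> *v u\<close> is
  the entry of \<open>\<Omega>\<close> at \<open>e\<close> minus this shift, and it is the component that gets multiplied.
\<close>

definition rescale_shift :: "'n \<Rightarrow> 'n set \<Rightarrow> ('n set \<Rightarrow> real) \<Rightarrow> real" where
  "rescale_shift j e \<theta> =
     - (\<Sum>k | (j, k) \<in> D. sym_matrix E \<theta> $ (other_end j e) $ k * elim_dir j (sym_matrix E \<theta>) $ k)"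

definition family_edges :: "'n \<Rightarrow> 'n set set" where
  "family_edges j = insert {j} ((\<lambda>i. {i, j}) ` pa D j)"

definition rescale_factor :: "'n \<Rightarrow> real \<Rightarrow> 'n set \<Rightarrow> real" where
  "rescale_factor j \<tau> e = (if e = {j} then \<tau>\<^sup>2 else \<tau>)"

definition rescale_coords :: "'n \<Rightarrow> real \<Rightarrow> ('n set \<Rightarrow> real) \<Rightarrow> 'n set \<Rightarrow> real" where
  "rescale_coords j \<tau> = affine_on (family_edges j) (rescale_factor j \<tau>)
     (\<lambda>e \<theta>. (1 - rescale_factor j \<tau> e) * rescale_shift j e \<theta>)"

lemma family_edges_subset: "family_edges j \<subseteq> E"
  by (auto simp: family_edges_def pa_eq edge_iff[of j j, simplified] edge_iff)

text \<open>
  The Jacobian: \<open>\<tau>\<close> for each parent and \<open>\<tau>\<^sup>2\<close> for the diagonal entry.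
\<close>

lemma prod_rescale_factor:
  assumes "0 < \<tau>"
  shows "(\<Prod>e\<in>family_edges j. ennreal (rescale_factor j \<tau> e)) = ennreal (\<tau> ^ (card (pa D j) + 2))"
proof -
  have inj: "inj_on (\<lambda>i. {i, j}) (pa D j)" by (auto simp: inj_on_def doubleton_eq_iff)
  have nin: "{j} \<notin> (\<lambda>i. {i, j}) ` pa D j" using arrow_irrefl by (auto simp: pa_eq)
  have "(\<Prod>e\<in>family_edges j. rescale_factor j \<tau> e) = \<tau>\<^sup>2 * (\<Prod>i\<in>pa D j. rescale_factor j \<tau> {i, j})"
    using nin by (simp add: family_edges_def prod.reindex[OF inj] rescale_factor_def)
  also have "(\<Prod>i\<in>pa D j. rescale_factor j \<tau> {i, j}) = (\<Prod>i\<in>pa D j. \<tau>)"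
    by (rule prod.cong) (use arrow_irrefl in \<open>auto simp: rescale_factor_def pa_eq\<close>)
  finally have "(\<Prod>e\<in>family_edges j. rescale_factor j \<tau> e) = \<tau> ^ (card (pa D j) + 2)"
    by (simp add: power_add power2_eq_square mult_ac)
  moreover have "0 \<le> rescale_factor j \<tau> e" for e using assms by (simp add: rescale_factor_def)
  ultimately show ?thesis by (simp add: prod_ennreal)
qed

lemma rescale_shift_indep:
  assumes "e \<in> family_edges j" "e' \<in> family_edges j"
  shows "rescale_shift j e (\<theta>(e' := t)) = rescale_shift j e \<theta>"
proof -
  obtain i' where i': "e' = {i', j}" "i' = j \<or> (i', j) \<in> D"
    using assms(2) by (auto simp: family_edges_def pa_eq)
  have eq: "sym_matrix E (\<theta>(e' := t)) $ a $ b = sym_matrix E \<theta> $ a $ b" if "(j, b) \<in> D \<or> (j, a) \<in> D" for a b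
  proof -
    have "{a, b} \<noteq> e'"
      using that i' arrow_asym[of j] arrow_irrefl[of j] by (auto simp: doubleton_eq_iff)
    then show ?thesis by (simp add: sym_matrix_def)
  qed
  have "elim_dir j (sym_matrix E (\<theta>(e' := t))) = elim_dir j (sym_matrix E \<theta>)"
    by (rule elim_dir_cong) (simp add: eq)
  then show ?thesis unfolding rescale_shift_def by (simp add: eq)
qed

lemma measurable_rescale_shift [measurable]:
  "rescale_shift j e \<in> borel_measurable (edge_measure E)"
  unfolding rescale_shift_def[abs_def] by measurable

lemma sym_matrix_rescale_coords:
  assumes \<Omega>: "sym_matrix E \<theta> \<in> P_cone E"
  shows "sym_matrix E (rescale_coords j \<tau> \<theta>) = rescale j \<tau> (sym_matrix E \<theta>)"
proof -
  let ?\<Omega> = "sym_matrix E \<theta>"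
  define u where "u = elim_dir j ?\<Omega>"
  define n where "n = ?\<Omega> *v u"
  note el = P_cone_elim_dir[OF \<Omega>, where j = j, folded u_def, folded n_def]
  have sym: "sym_matrix E \<eta> $ a $ b = sym_matrix E \<eta> $ b $ a" for \<eta> a b
    by (simp add: sym_matrix_def insert_commute)
  have nj: "cond_prec j ?\<Omega> = n $ j" by (simp add: cond_prec_def n_def u_def)
  have n: "n $ i = ?\<Omega> $ i $ j + (\<Sum>k | (j, k) \<in> D. ?\<Omega> $ i $ k * u $ k)" for i
  proof -
    have "n $ i = (\<Sum>k\<in>insert j {k. (j, k) \<in> D}. ?\<Omega> $ i $ k * u $ k)"
      unfolding n_def by (rule matrix_vector_component_supported) (use el(2) in auto)
    then show ?thesis using el(1) arrow_irrefl by simp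
  qed
  have shift: "rescale_shift j e \<theta> = ?\<Omega> $ i $ j - n $ i" if "e = {i, j}" for e i
  proof -
    have "{i, j} - {j} = {i}" if "i \<noteq> j" using that by auto
    then have "other_end j e = i" using that by (auto simp: other_end_def)
    then show ?thesis by (simp add: rescale_shift_def n u_def)
  qed
  have col: "sym_matrix E (rescale_coords j \<tau> \<theta>) $ i $ j = rescale j \<tau> ?\<Omega> $ i $ j" for i
  proof (cases "i = j \<or> (i, j) \<in> D")
    case True
    then have E: "{i, j} \<in> E" and F: "{i, j} \<in> family_edges j"
      using edge_iff by (auto simp: family_edges_def pa_eq)
    have "sym_matrix E (rescale_coords j \<tau> \<theta>) $ i $ j = rescale_factor j \<tau> {i, j} * ?\<Omega> $ i $ j +
        (1 - rescale_factor j \<tau> {i, j}) * (?\<Omega> $ i $ j - n $ i)"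
    proof -
      have "sym_matrix E (rescale_coords j \<tau> \<theta>) $ i $ j = rescale_coords j \<tau> \<theta> {i, j}"
        "?\<Omega> $ i $ j = \<theta> {i, j}" using E by (simp_all add: sym_matrix_def)
      then show ?thesis using F shift[of "{i, j}" i] by (simp add: rescale_coords_def affine_on_def)
    qed
    also have "\<dots> = ?\<Omega> $ i $ j + (rescale_factor j \<tau> {i, j} - 1) * n $ i" by (simp add: algebra_simps)
    also have "\<dots> = rescale j \<tau> ?\<Omega> $ i $ j"
      by (cases "i = j") (simp_all add: rescale_def u_def[symmetric] n_def[symmetric] nj
          rescale_factor_def power2_eq_square algebra_simps doubleton_eq_iff[of i j j j, simplified])
    finally show ?thesis .
  next
    case False
    then have "{i, j} \<notin> family_edges j" by (auto simp: family_edges_def pa_eq doubleton_eq_iff)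
    then have "sym_matrix E (rescale_coords j \<tau> \<theta>) $ i $ j = ?\<Omega> $ i $ j"
      by (simp add: sym_matrix_def rescale_coords_def affine_on_def)
    moreover have "n $ i = 0" using False el(3) by simp
    ultimately show ?thesis using False by (simp add: rescale_def u_def[symmetric] n_def[symmetric])
  qed
  have "sym_matrix E (rescale_coords j \<tau> \<theta>) $ a $ b = rescale j \<tau> ?\<Omega> $ a $ b" for a b
  proof -
    consider "b = j" | "a = j" "b \<noteq> j" | "a \<noteq> j" "b \<noteq> j" by blast
    then show ?thesis
    proof cases
      case 1
      then show ?thesis using col by simp
    next
      case 2
      have "rescale j \<tau> ?\<Omega> $ j $ b = rescale j \<tau> ?\<Omega> $ b $ j"
        using sym[of \<theta> j b] by (simp add: rescale_def add.commute)
      then show ?thesis using col[of b] 2 sym[of "rescale_coords j \<tau> \<theta>" j b] by simp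
    next
      case 3
      then have "{a, b} \<notin> family_edges j" by (auto simp: family_edges_def)
      then show ?thesis using 3
        by (simp add: rescale_def) (simp add: sym_matrix_def rescale_coords_def affine_on_def)
    qed
  qed
  then show ?thesis by (simp add: vec_eq_iff)
qed

lemma nn_integral_rescale:
  assumes f: "f \<in> borel_measurable (edge_measure E)" and \<tau>: "0 < \<tau>"
  shows "(\<integral>\<^sup>+\<theta>. f \<theta> \<partial>edge_measure E) =
    ennreal (\<tau> ^ (card (pa D j) + 2)) * (\<integral>\<^sup>+\<theta>. f (rescale_coords j \<tau> \<theta>) \<partial>edge_measure E)"
  unfolding rescale_coords_def prod_rescale_factor[OF \<tau>, symmetric]
  by (rule nn_integral_PiM_affine)
    (use f \<tau> family_edges_subset in \<open>auto simp: rescale_shift_indep rescale_factor_def\<close>)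

text \<open>
  The bound is uniform in \<open>\<tau>\<close> because the coefficients \<open>\<tau> - 1\<close> and \<open>(\<tau> - 1)\<^sup>2\<close> are at most 1 in absolute value.
\<close>

lemma trace_rescale_le:
  assumes \<tau>: "0 < \<tau>" "\<tau> \<le> 1"
  shows "trace (rescale j \<tau> \<Omega> ** U) \<le> (\<Sum>a\<in>UNIV. \<Sum>b\<in>UNIV. (\<bar>\<Omega> $ a $ b\<bar> +
    (\<bar>(\<Omega> *v elim_dir j \<Omega>) $ a\<bar> + \<bar>(\<Omega> *v elim_dir j \<Omega>) $ b\<bar>) + \<bar>cond_prec j \<Omega>\<bar>) * \<bar>U $ b $ a\<bar>)"
  (is "_ \<le> (\<Sum>a\<in>UNIV. \<Sum>b\<in>UNIV. ?B a b * _)")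
proof -
  let ?n = "\<Omega> *v elim_dir j \<Omega>"
  have s: "\<bar>\<tau> - 1\<bar> \<le> 1" using \<tau> by auto
  then have s2: "\<bar>(\<tau> - 1)\<^sup>2\<bar> \<le> 1" by (simp add: abs_square_le_1)
  have entry: "\<bar>rescale j \<tau> \<Omega> $ a $ b\<bar> \<le> ?B a b" for a b
  proof -
    define x where "x = (if b = j then ?n $ a else 0) + (if a = j then ?n $ b else 0)"
    define y where "y = (if a = j \<and> b = j then cond_prec j \<Omega> else 0)"
    have "rescale j \<tau> \<Omega> $ a $ b = \<Omega> $ a $ b + (\<tau> - 1) * x + (\<tau> - 1)\<^sup>2 * y"
      by (simp add: rescale_def x_def y_def)
    also have "\<bar>\<dots>\<bar> \<le> \<bar>\<Omega> $ a $ b\<bar> + \<bar>(\<tau> - 1) * x\<bar> + \<bar>(\<tau> - 1)\<^sup>2 * y\<bar>"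
      by (intro order.trans[OF abs_triangle_ineq] add_mono abs_triangle_ineq order_refl)
    also have "\<dots> \<le> ?B a b"
    proof (intro add_mono order_refl)
      have "\<bar>(\<tau> - 1) * x\<bar> \<le> \<bar>x\<bar>" using mult_right_mono[OF s, of "\<bar>x\<bar>"] by (simp add: abs_mult)
      also have "\<bar>x\<bar> \<le> \<bar>?n $ a\<bar> + \<bar>?n $ b\<bar>" by (auto simp: x_def)
      finally show "\<bar>(\<tau> - 1) * x\<bar> \<le> \<bar>?n $ a\<bar> + \<bar>?n $ b\<bar>" .
      have "\<bar>(\<tau> - 1)\<^sup>2 * y\<bar> \<le> \<bar>y\<bar>" using mult_right_mono[OF s2, of "\<bar>y\<bar>"] by (simp add: abs_mult)
      also have "\<bar>y\<bar> \<le> \<bar>cond_prec j \<Omega>\<bar>" by (auto simp: y_def)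
      finally show "\<bar>(\<tau> - 1)\<^sup>2 * y\<bar> \<le> \<bar>cond_prec j \<Omega>\<bar>" .
    qed
    finally show ?thesis .
  qed
  have "trace (rescale j \<tau> \<Omega> ** U) = (\<Sum>a\<in>UNIV. \<Sum>b\<in>UNIV. rescale j \<tau> \<Omega> $ a $ b * U $ b $ a)"
    by (simp add: trace_def matrix_matrix_mult_def)
  also have "\<dots> \<le> (\<Sum>a\<in>UNIV. \<Sum>b\<in>UNIV. ?B a b * \<bar>U $ b $ a\<bar>)"
  proof (intro sum_mono)
    fix a b
    have "rescale j \<tau> \<Omega> $ a $ b * U $ b $ a \<le> \<bar>rescale j \<tau> \<Omega> $ a $ b\<bar> * \<bar>U $ b $ a\<bar>"
      by (metis abs_ge_self abs_mult)
    also have "\<dots> \<le> ?B a b * \<bar>U $ b $ a\<bar>" by (rule mult_right_mono[OF entry]) simp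
    finally show "rescale j \<tau> \<Omega> $ a $ b * U $ b $ a \<le> ?B a b * \<bar>U $ b $ a\<bar>" .
  qed
  finally show ?thesis .
qed

section \<open>Divergence of the normalizing constant\<close>

text \<open>
  Cut the cone into the slabs on which the conditional precision of \<open>j\<close> lies between consecutive powers
  of 4. Rescaling with $\tau = 2^{-m}$ carries one slab to the \<open>m\<close>-th next lower one;
  the Jacobian and the power of the conditional variance contribute
  $\tau^{pa_j + 2 - 2 \gamma_j}$, which is at least 1 when the condition on $\gamma_j$ fails, while the
  exponential factor stays above a positive bound that does not depend on \<open>m\<close>. So all lower slabs contribute at least the same
  positive amount.
\<close>

lemma finite_imp_exponent_bound:
  assumes fin: "(\<integral>\<^sup>+\<theta>. ennreal (exp (- trace (sym_matrix E \<theta> ** U)) *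
      (\<Prod>k\<in>UNIV. (1 / cond_prec k (sym_matrix E \<theta>)) powr g k)) *
      indicator (P_cone E) (sym_matrix E \<theta>) \<partial>edge_measure E) < \<infinity>"
  shows "g j < real (card (pa D j)) / 2 + 1"
proof (rule ccontr)
  assume neg: "\<not> ?thesis"
  let ?M = "edge_measure E" and ?X = "sym_matrix E"
  define F where "F \<Omega> = (\<Prod>k\<in>UNIV. (1 / cond_prec k \<Omega>) powr g k)" for \<Omega>
  define f where "f \<Omega> = ennreal (exp (- trace (\<Omega> ** U)) * F \<Omega>) * indicator (P_cone E) \<Omega>" for \<Omega> :: "real^'n^'n"
  define B where "B \<Omega> = (\<Sum>a\<in>UNIV. \<Sum>b\<in>UNIV. (\<bar>\<Omega> $ a $ b\<bar> +
    (\<bar>(\<Omega> *v elim_dir j \<Omega>) $ a\<bar> + \<bar>(\<Omega> *v elim_dir j \<Omega>) $ b\<bar>) + \<bar>cond_prec j \<Omega>\<bar>) * \<bar>U $ b $ a\<bar>)" for \<Omega>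
  define \<kappa> where "\<kappa> \<Omega> = \<lfloor>log 4 (cond_prec j \<Omega>)\<rfloor>" for \<Omega>
  define h where "h q \<Omega> = ennreal (exp (- B \<Omega>) * F \<Omega>) * indicator (P_cone E) \<Omega> * indicator {\<Omega>. \<kappa> \<Omega> = q} \<Omega>" for q \<Omega>
  have [measurable]: "F \<in> borel_measurable borel" unfolding F_def[abs_def] by measurable
  have [measurable]: "B \<in> borel_measurable borel" unfolding B_def[abs_def] by measurable
  have [measurable]: "\<kappa> \<in> measurable borel (count_space UNIV)" unfolding \<kappa>_def[abs_def] by measurable
  have [measurable]: "{\<Omega>. \<kappa> \<Omega> = q} \<in> sets borel" for q
    using measurable_sets[OF \<open>\<kappa> \<in> _\<close>, of "{q}"] by (simp add: vimage_def)
  have [measurable]: "(\<lambda>\<Omega>. trace (\<Omega> ** U)) \<in> borel_measurable borel"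
    unfolding trace_def matrix_matrix_mult_def vec_lambda_beta by measurable
  have [measurable]: "f \<in> borel_measurable borel" unfolding f_def[abs_def] by measurable
  have [measurable]: "h q \<in> borel_measurable borel" for q unfolding h_def[abs_def] by measurable
  have Fpos: "0 < F \<Omega>" if "\<Omega> \<in> P_cone E" for \<Omega>
    unfolding F_def using P_cone_elim_dir(4)[OF that] by (intro prod_pos) (auto simp: powr_gt_zero less_imp_neq[symmetric])
  have slab: "(\<integral>\<^sup>+\<theta>. h q (?X \<theta>) \<partial>?M) \<le> (\<integral>\<^sup>+\<theta>. f (?X \<theta>) * indicator {\<Omega>. \<kappa> \<Omega> = q - int m} (?X \<theta>) \<partial>?M)" for q m
  proof -
    \<comment> \<open>the conditional precision of \<open>j\<close> is multiplied by $\tau^2 = 4^{-m}$, so \<open>\<kappa>\<close> drops by \<open>m\<close>\<close>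
    define \<tau> :: real where "\<tau> = 1 / 2 ^ m"
    have \<tau>: "0 < \<tau>" "\<tau> \<le> 1" by (auto simp: \<tau>_def)
    let ?N = "card (pa D j) + 2"
    have "(\<integral>\<^sup>+\<theta>. h q (?X \<theta>) \<partial>?M) \<le> (\<integral>\<^sup>+\<theta>. ennreal (\<tau> ^ ?N) *
        (f (?X (rescale_coords j \<tau> \<theta>)) * indicator {\<Omega>. \<kappa> \<Omega> = q - int m} (?X (rescale_coords j \<tau> \<theta>))) \<partial>?M)"
    proof (rule nn_integral_mono)
      fix \<theta>
      let ?\<Omega> = "?X \<theta>" and ?\<Omega>' = "?X (rescale_coords j \<tau> \<theta>)"
      show "h q ?\<Omega> \<le> ennreal (\<tau> ^ ?N) * (f ?\<Omega>' * indicator {\<Omega>. \<kappa> \<Omega> = q - int m} ?\<Omega>')"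
      proof (cases "?\<Omega> \<in> P_cone E \<and> \<kappa> ?\<Omega> = q")
        case False
        then show ?thesis by (auto simp: h_def)
      next
        case True
        then have \<Omega>: "?\<Omega> \<in> P_cone E" by simp
        have eq: "?\<Omega>' = rescale j \<tau> ?\<Omega>" by (rule sym_matrix_rescale_coords[OF \<Omega>])
        note R = rescale[OF \<Omega> \<tau>(1), where j = j, folded eq]
        have p: "0 < cond_prec j ?\<Omega>" by (rule P_cone_elim_dir(4)[OF \<Omega>])
        have "log 4 (cond_prec j ?\<Omega>') = log 4 (cond_prec j ?\<Omega>) + log 4 (\<tau>\<^sup>2)"
          using p \<tau> by (simp add: R(2) log_mult)
        also have "\<tau>\<^sup>2 = 4 powr (- real m)"
          by (simp add: \<tau>_def power_divide powr_minus powr_realpow divide_inverse power_mult[symmetric]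
              mult.commute[of m] power_mult power_inverse)
        finally have "log 4 (cond_prec j ?\<Omega>') = log 4 (cond_prec j ?\<Omega>) - of_int (int m)" by simp
        then have \<kappa>': "\<kappa> ?\<Omega>' = q - int m"
          using True unfolding \<kappa>_def by (simp only: floor_diff_of_int)
        have F': "F ?\<Omega>' = \<tau> powr (- 2 * g j) * F ?\<Omega>"
        proof -
          have "F ?\<Omega>' = (1 / cond_prec j ?\<Omega>') powr g j * (\<Prod>k\<in>UNIV - {j}. (1 / cond_prec k ?\<Omega>') powr g k)"
            unfolding F_def by (rule prod.remove) auto
          also have "(\<Prod>k\<in>UNIV - {j}. (1 / cond_prec k ?\<Omega>') powr g k) = (\<Prod>k\<in>UNIV - {j}. (1 / cond_prec k ?\<Omega>) powr g k)"
            by (rule prod.cong) (auto simp: R(3))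
          also have "(1 / cond_prec j ?\<Omega>') powr g j = \<tau> powr (- 2 * g j) * (1 / cond_prec j ?\<Omega>) powr g j"
          proof -
            have "1 / cond_prec j ?\<Omega>' = (1 / \<tau>\<^sup>2) * (1 / cond_prec j ?\<Omega>)" by (simp add: R(2))
            moreover have "(1 / \<tau>\<^sup>2) powr g j = \<tau> powr (- 2 * g j)"
            proof -
              have "1 / \<tau>\<^sup>2 = \<tau> powr (- 2)" using \<tau> by (simp add: powr_minus divide_inverse)
              then show ?thesis by (simp add: powr_powr)
            qed
            moreover have "((1 / \<tau>\<^sup>2) * (1 / cond_prec j ?\<Omega>)) powr g j =
                (1 / \<tau>\<^sup>2) powr g j * (1 / cond_prec j ?\<Omega>) powr g j"
              by (rule powr_mult)
            ultimately show ?thesis by simp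
          qed
          finally show ?thesis unfolding F_def by (simp add: prod.remove[of UNIV j] mult.assoc)
        qed
        have "1 \<le> \<tau> powr (real ?N - 2 * g j)"
        proof -
          have "real ?N - 2 * g j \<le> 0" using neg by (simp add: field_simps)
          then show ?thesis using powr_mono'[of "real ?N - 2 * g j" 0 \<tau>] \<tau> by simp
        qed
        also have "\<tau> powr (real ?N - 2 * g j) = \<tau> ^ ?N * \<tau> powr (- 2 * g j)"
          using powr_add[of \<tau> "real ?N" "- 2 * g j"] powr_realpow[OF \<tau>(1), of ?N] by simp
        finally have one: "1 \<le> \<tau> ^ ?N * \<tau> powr (- 2 * g j)" .
        have "exp (- B ?\<Omega>) * F ?\<Omega> \<le> (\<tau> ^ ?N * \<tau> powr (- 2 * g j)) * (exp (- trace (?\<Omega>' ** U)) * F ?\<Omega>)"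
        proof -
          have "exp (- B ?\<Omega>) \<le> exp (- trace (?\<Omega>' ** U))"
            using trace_rescale_le[OF \<tau>, of j ?\<Omega> U] by (simp add: B_def eq)
          then have "exp (- B ?\<Omega>) * F ?\<Omega> \<le> exp (- trace (?\<Omega>' ** U)) * F ?\<Omega>"
            using Fpos[OF \<Omega>] by (simp add: mult_right_mono)
          also have "\<dots> \<le> (\<tau> ^ ?N * \<tau> powr (- 2 * g j)) * (exp (- trace (?\<Omega>' ** U)) * F ?\<Omega>)"
            using mult_right_mono[OF one, of "exp (- trace (?\<Omega>' ** U)) * F ?\<Omega>"] Fpos[OF \<Omega>] by simp
          finally show ?thesis .
        qed
        also have "\<dots> = \<tau> ^ ?N * (exp (- trace (?\<Omega>' ** U)) * F ?\<Omega>')" by (simp add: F' mult_ac)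
        finally have "ennreal (exp (- B ?\<Omega>) * F ?\<Omega>) \<le> ennreal (\<tau> ^ ?N) * ennreal (exp (- trace (?\<Omega>' ** U)) * F ?\<Omega>')"
          using \<tau> Fpos[OF R(1)] by (subst ennreal_mult[symmetric]) (auto intro: ennreal_leI)
        then show ?thesis using True R(1) \<kappa>' by (simp add: h_def f_def)
      qed
    qed
    also have "\<dots> = ennreal (\<tau> ^ ?N) * (\<integral>\<^sup>+\<theta>. f (?X (rescale_coords j \<tau> \<theta>)) *
        indicator {\<Omega>. \<kappa> \<Omega> = q - int m} (?X (rescale_coords j \<tau> \<theta>)) \<partial>?M)"
    proof (rule nn_integral_cmult)
      have "rescale_coords j \<tau> \<in> measurable ?M ?M"
        unfolding rescale_coords_def
        by (rule measurable_affine_on[OF family_edges_subset]) measurable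
      then show "(\<lambda>\<theta>. f (?X (rescale_coords j \<tau> \<theta>)) *
        indicator {\<Omega>. \<kappa> \<Omega> = q - int m} (?X (rescale_coords j \<tau> \<theta>))) \<in> borel_measurable ?M"
        by measurable
    qed
    also have "\<dots> = (\<integral>\<^sup>+\<theta>. f (?X \<theta>) * indicator {\<Omega>. \<kappa> \<Omega> = q - int m} (?X \<theta>) \<partial>?M)"
      by (rule nn_integral_rescale[symmetric]) (use \<tau> in auto)
    finally show ?thesis .
  qed
  have zero: "(\<integral>\<^sup>+\<theta>. h q (?X \<theta>) \<partial>?M) = 0" for q
  proof (rule ccontr)
    let ?c = "\<integral>\<^sup>+\<theta>. h q (?X \<theta>) \<partial>?M"
    assume c: "?c \<noteq> 0"
    have "(\<Sum>m. ?c) \<le> (\<Sum>m. \<integral>\<^sup>+\<theta>. f (?X \<theta>) * indicator {\<Omega>. \<kappa> \<Omega> = q - int m} (?X \<theta>) \<partial>?M)"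
      by (rule suminf_le) (auto simp: slab)
    also have "\<dots> = (\<integral>\<^sup>+\<theta>. (\<Sum>m. f (?X \<theta>) * indicator {\<Omega>. \<kappa> \<Omega> = q - int m} (?X \<theta>)) \<partial>?M)"
      by (rule nn_integral_suminf[symmetric]) measurable
    also have "\<dots> \<le> (\<integral>\<^sup>+\<theta>. f (?X \<theta>) \<partial>?M)"
    proof (rule nn_integral_mono)
      fix \<theta>
      let ?\<Omega> = "?X \<theta>"
      have "disjoint_family (\<lambda>m. {\<Omega> :: real^'n^'n. \<kappa> \<Omega> = q - int m})"
        by (auto simp: disjoint_family_on_def)
      then have "(\<Sum>m. indicator {\<Omega>. \<kappa> \<Omega> = q - int m} ?\<Omega>) = (indicator (\<Union>m. {\<Omega>. \<kappa> \<Omega> = q - int m}) ?\<Omega> :: ennreal)"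
        by (rule suminf_indicator)
      then have "(\<Sum>m. f ?\<Omega> * indicator {\<Omega>. \<kappa> \<Omega> = q - int m} ?\<Omega>) = f ?\<Omega> * indicator (\<Union>m. {\<Omega>. \<kappa> \<Omega> = q - int m}) ?\<Omega>"
        by simp
      also have "\<dots> \<le> f ?\<Omega>" by (auto simp: indicator_def)
      finally show "(\<Sum>m. f ?\<Omega> * indicator {\<Omega>. \<kappa> \<Omega> = q - int m} ?\<Omega>) \<le> f ?\<Omega>" .
    qed
    also have "\<dots> < \<infinity>" using fin by (simp add: f_def F_def)
    finally have "(\<Sum>m::nat. ?c) < \<infinity>" .
    moreover have "(\<Sum>m::nat. ?c) = \<infinity>"
    proof -
      have "(\<Sum>m::nat. ?c) = (\<integral>\<^sup>+m. ?c \<partial>count_space (UNIV :: nat set))"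
        by (rule nn_integral_count_space_nat[symmetric])
      also have "\<dots> = ?c * \<infinity>" by (subst nn_integral_const) auto
      also have "\<dots> = \<infinity>" using c by (simp add: ennreal_mult_top)
      finally show ?thesis .
    qed
    ultimately show False by simp
  qed
  have "AE \<theta> in ?M. h q (?X \<theta>) = 0" for q
    using zero[of q] by (subst (asm) nn_integral_0_iff_AE) auto
  then have "AE \<theta> in ?M. \<forall>q. h q (?X \<theta>) = 0" by (simp add: AE_all_countable)
  then have "AE \<theta> in ?M. ?X \<theta> \<notin> P_cone E"
  proof (rule eventually_mono)
    fix \<theta> assume *: "\<forall>q. h q (?X \<theta>) = 0"
    show "?X \<theta> \<notin> P_cone E"
    proof
      assume P: "?X \<theta> \<in> P_cone E"
      then have "h (\<kappa> (?X \<theta>)) (?X \<theta>) \<noteq> 0" using Fpos[OF P] by (simp add: h_def)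
      then show False using * by blast
    qed
  qed
  then show False using P_cone_positive_measure[of E] edge_iff by (metis insert_absorb2)
qed

end

section \<open>Type II Wishart distributions as DAG Wishart distributions\<close>

context transitive_perfect_dag
begin

lemma density_prod_cond_var_measurable:
  "(\<lambda>\<Omega>. \<Prod>j\<in>UNIV. cond_var D (matrix_inv \<Omega>) j powr g j) \<in>
     borel_measurable (restrict_space (lebesgue_sym E) (P_cone E))"
proof -
  have "(\<lambda>\<Omega>. \<Prod>j\<in>UNIV. (1 / cond_prec j \<Omega>) powr g j) \<in>
     borel_measurable (restrict_space (lebesgue_sym E) (P_cone E))"
    by (rule measurable_restrict_space1) (simp add: lebesgue_sym_eq cong: measurable_cong_sets)
  then show ?thesis
    by (rule measurable_cong[THEN iffD1, rotated]) (simp add: space_restrict_space cond_var_cond_prec)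
qed

text \<open>
  The exponents contributed by the reference measure and by \<open>H\<close> itself add up.
\<close>

lemma omega_measure_eq:
  fixes \<alpha> \<beta> :: "nat \<Rightarrow> real"
  assumes Cs: "perfect_order E Cs"
  defines "g \<equiv> \<lambda>j. H_exponent Cs (\<lambda>i. (real (card (Cs ! i)) + 1) / 2)
      (\<lambda>i. (real (card (separator Cs i)) + 1) / 2) j + H_exponent Cs \<alpha> \<beta> j"
  shows "omega_measure E Cs \<alpha> \<beta> \<Gamma> = density (restrict_space (lebesgue_sym E) (P_cone E))
    (\<lambda>\<Omega>. ennreal (exp (- trace (\<Omega> ** completion E \<Gamma>)) * (\<Prod>j\<in>UNIV. cond_var D (matrix_inv \<Omega>) j powr g j)))"
proof -
  let ?R = "restrict_space (lebesgue_sym E) (P_cone E)"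
  let ?c = "\<lambda>i. (real (card (Cs ! i)) + 1) / 2" and ?s = "\<lambda>i. (real (card (separator Cs i)) + 1) / 2"
  let ?h = "\<lambda>a b \<Omega>. H_fun Cs a b (restrict_to E (matrix_inv \<Omega>))"
  let ?t = "\<lambda>\<Omega>. exp (- trace (\<Omega> ** completion E \<Gamma>))"
  have sp: "\<Omega> \<in> P_cone E" if "\<Omega> \<in> space ?R" for \<Omega> using that by (simp add: space_restrict_space)
  have h [measurable]: "?h a b \<in> borel_measurable ?R" for a b
    by (rule measurable_cong[THEN iffD2, OF _ density_prod_cond_var_measurable])
      (rule H_fun_cond_var[OF sp Cs])
  have "(\<lambda>\<Omega> :: real^'n^'n. trace (\<Omega> ** completion E \<Gamma>)) \<in> borel_measurable borel"
    unfolding trace_def matrix_matrix_mult_def vec_lambda_beta by measurable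
  then have [measurable]: "(\<lambda>\<Omega>. trace (\<Omega> ** completion E \<Gamma>)) \<in> borel_measurable ?R"
    by (intro measurable_restrict_space1) (simp add: lebesgue_sym_eq cong: measurable_cong_sets)
  have m: "(\<lambda>\<Omega>. ennreal (?t \<Omega> * (\<Prod>j\<in>UNIV. cond_var D (matrix_inv \<Omega>) j powr g j))) \<in> borel_measurable ?R"
    using density_prod_cond_var_measurable by measurable
  have "omega_measure E Cs \<alpha> \<beta> \<Gamma> = density ?R (\<lambda>\<Omega>. ennreal (?h ?c ?s \<Omega>) * ennreal (?t \<Omega> * ?h \<alpha> \<beta> \<Omega>))"
    unfolding omega_measure_def nu_def by (rule density_density_eq) measurable
  also have "\<dots> = density ?R (\<lambda>\<Omega>. ennreal (?t \<Omega> * (\<Prod>j\<in>UNIV. cond_var D (matrix_inv \<Omega>) j powr g j)))"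
  proof (rule density_cong[OF _ m])
    show "(\<lambda>\<Omega>. ennreal (?h ?c ?s \<Omega>) * ennreal (?t \<Omega> * ?h \<alpha> \<beta> \<Omega>)) \<in> borel_measurable ?R" by measurable
    show "AE \<Omega> in ?R. ennreal (?h ?c ?s \<Omega>) * ennreal (?t \<Omega> * ?h \<alpha> \<beta> \<Omega>) =
        ennreal (?t \<Omega> * (\<Prod>j\<in>UNIV. cond_var D (matrix_inv \<Omega>) j powr g j))"
    proof (rule AE_I2)
      fix \<Omega> assume "\<Omega> \<in> space ?R"
      note H = H_fun_cond_var[OF sp[OF this] Cs]
      have "?h ?c ?s \<Omega> * (?t \<Omega> * ?h \<alpha> \<beta> \<Omega>) = ?t \<Omega> * (\<Prod>j\<in>UNIV. cond_var D (matrix_inv \<Omega>) j powr g j)"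
        unfolding H g_def by (simp add: powr_add prod.distrib)
      moreover have "0 \<le> ?h a b \<Omega>" for a b unfolding H by (intro prod_nonneg) simp
      moreover have "ennreal (?h ?c ?s \<Omega>) * ennreal (?t \<Omega> * ?h \<alpha> \<beta> \<Omega>) =
          ennreal (?h ?c ?s \<Omega> * (?t \<Omega> * ?h \<alpha> \<beta> \<Omega>))"
        using calculation(2) by (intro ennreal_mult[symmetric] mult_nonneg_nonneg) simp_all
      ultimately show "ennreal (?h ?c ?s \<Omega>) * ennreal (?t \<Omega> * ?h \<alpha> \<beta> \<Omega>) =
        ennreal (?t \<Omega> * (\<Prod>j\<in>UNIV. cond_var D (matrix_inv \<Omega>) j powr g j))"
        by (simp only:)
    qed
  qed
  finally show ?thesis .
qed

lemma finite_density_imp_exponent_bound: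
  assumes fin: "emeasure (density (restrict_space (lebesgue_sym E) (P_cone E))
    (\<lambda>\<Omega>. ennreal (exp (- trace (\<Omega> ** U)) * (\<Prod>j\<in>UNIV. cond_var D (matrix_inv \<Omega>) j powr g j))))
    (P_cone E) < \<infinity>"
  shows "g j < real (card (pa D j)) / 2 + 1"
proof (rule finite_imp_exponent_bound)
  let ?R = "restrict_space (lebesgue_sym E) (P_cone E)"
  let ?f = "\<lambda>\<Omega>. ennreal (exp (- trace (\<Omega> ** U)) * (\<Prod>j\<in>UNIV. cond_var D (matrix_inv \<Omega>) j powr g j))"
  let ?f' = "\<lambda>\<Omega>. ennreal (exp (- trace (\<Omega> ** U)) * (\<Prod>j\<in>UNIV. (1 / cond_prec j \<Omega>) powr g j))"
  have tr: "(\<lambda>\<Omega> :: real^'n^'n. trace (\<Omega> ** U)) \<in> borel_measurable borel"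
    unfolding trace_def matrix_matrix_mult_def vec_lambda_beta by measurable
  then have [measurable]: "(\<lambda>\<Omega>. trace (\<Omega> ** U)) \<in> borel_measurable ?R"
    by (intro measurable_restrict_space1) (simp add: lebesgue_sym_eq cong: measurable_cong_sets)
  have m: "?f \<in> borel_measurable ?R" using density_prod_cond_var_measurable by measurable
  have m': "?f' \<in> borel_measurable borel" using tr by measurable
  have sets: "P_cone E \<inter> space (lebesgue_sym E) \<in> sets (lebesgue_sym E)"
    by (simp add: lebesgue_sym_eq)
  have "P_cone E \<in> sets ?R" by (simp add: sets_restrict_space lebesgue_sym_eq image_iff) (metis Int_absorb P_cone_borel)
  then have "emeasure (density ?R ?f) (P_cone E) = (\<integral>\<^sup>+\<Omega>. ?f \<Omega> * indicator (P_cone E) \<Omega> \<partial>?R)"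
    by (rule emeasure_density[OF m])
  also have "\<dots> = (\<integral>\<^sup>+\<Omega>. ?f' \<Omega> \<partial>?R)"
    by (rule nn_integral_cong) (simp add: space_restrict_space cond_var_cond_prec)
  also have "\<dots> = (\<integral>\<^sup>+\<Omega>. ?f' \<Omega> * indicator (P_cone E) \<Omega> \<partial>lebesgue_sym E)"
    by (rule nn_integral_restrict_space[OF sets])
  also have "\<dots> = (\<integral>\<^sup>+\<theta>. ?f' (sym_matrix E \<theta>) * indicator (P_cone E) (sym_matrix E \<theta>) \<partial>edge_measure E)"
    unfolding lebesgue_sym_eq
    by (rule nn_integral_distr[OF measurable_sym_matrix]) (use m' in measurable)
  finally show "(\<integral>\<^sup>+\<theta>. ?f' (sym_matrix E \<theta>) * indicator (P_cone E) (sym_matrix E \<theta>) \<partial>edge_measure E) < \<infinity>"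
    using fin by simp
qed

end

theorem proposition6p1:
  fixes E :: "'n::finite set set"
    and D :: "('n \<times> 'n) set"
    and Cs :: "'n set list"
  assumes "homogeneous_graph E"
    and "perfect_order E Cs"
    and "dag_version D E"
    and "perfect_dag D"
    and "trans D"
  shows "\<forall>(\<alpha>, \<beta>) \<in> B_set E Cs. \<forall>UE \<in> Q_cone E.
    \<exists>(\<gamma> :: real^'n) (U :: real^'n^'n).
      (\<forall>j. \<gamma> $ j < real (card (pa D j)) / 2 + 1) \<and> posdef U \<and>
      type2_wishart E Cs \<alpha> \<beta> UE = dag_wishart D \<gamma> U"
proof (intro ballI, clarify)
  fix \<alpha> \<beta> UE
  assume B: "(\<alpha>, \<beta>) \<in> B_set E Cs" and UE: "UE \<in> Q_cone E"
  interpret transitive_perfect_dag D E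
    using assms(3-5) by unfold_locales
  let ?U = "completion E UE"
  define g where "g j = H_exponent Cs (\<lambda>i. (real (card (Cs ! i)) + 1) / 2)
      (\<lambda>i. (real (card (separator Cs i)) + 1) / 2) j + H_exponent Cs \<alpha> \<beta> j" for j
  define \<gamma> :: "real^'n" where "\<gamma> = (\<chi> j. g j)"
  have eq: "omega_measure E Cs \<alpha> \<beta> UE = density (restrict_space (lebesgue_sym E) (P_cone E))
    (\<lambda>\<Omega>. ennreal (exp (- trace (\<Omega> ** ?U)) * (\<Prod>j\<in>UNIV. cond_var D (matrix_inv \<Omega>) j powr g j)))"
    unfolding g_def by (rule omega_measure_eq[OF assms(2)])
  have "emeasure (omega_measure E Cs \<alpha> \<beta> UE) (P_cone E) < \<infinity>"
    using B UE by (auto simp: B_set_def)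
  then have "g j < real (card (pa D j)) / 2 + 1" for j
    unfolding eq by (rule finite_density_imp_exponent_bound)
  moreover have "posdef ?U" by (rule posdef_completion[OF UE])
  moreover have "type2_wishart E Cs \<alpha> \<beta> UE = dag_wishart D \<gamma> ?U"
    using assms(3)
    by (simp add: type2_wishart_def dag_wishart_def eq P_dag_eq_P_cone \<gamma>_def dag_version_def)
  ultimately show "\<exists>(\<gamma> :: real^'n) (U :: real^'n^'n).
      (\<forall>j. \<gamma> $ j < real (card (pa D j)) / 2 + 1) \<and> posdef U \<and>
      type2_wishart E Cs \<alpha> \<beta> UE = dag_wishart D \<gamma> U"
    by (intro exI[of _ \<gamma>] exI[of _ ?U]) (simp add: \<gamma>_def)
qed

end
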